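(* Let $M^{2n+1}(f,Q,\xi,\eta,g)$ be a weak $\beta$-Kenmotsu manifold with $\beta=\mathrm{const}\ne0$, and suppose that $g$ is a $\ast$-$\eta$-Ricci soliton with potential vector field $V$ and soliton constants $\lambda,\mu\in\mathbb R$, i.e. $\tfrac12\pounds_V g+\mathrm{Ric}^\ast=\lambda\,g+\mu\,\eta\otimes\eta$. Then $$(\pounds_V\eta)(\xi)=\eta(\pounds_V\xi)=0,$$ and the soliton constants satisfy $$\lambda+\mu=0.$$ The $\ast$-$\eta$-Ricci soliton is shrinking, steady, or expanding if $\mu$ is negative, zero, or positive, respectively.
   Context: A weak almost contact metric structure on a smooth manifold $M^{2n+1}$ (of dimension $2n+1$, $n\ge 1$) is a set $(f,Q,\xi,\eta,g)$, where $f$ is a $(1,1)$-tensor of rank $2n$, $Q$ is a nonsingular $(1,1)$-tensor, $\xi$ is a vector field, $\eta$ is a 1-form and $g$ is a Riemannian metric, such that $f^2=-Q+\eta\otimes\xi$, $\eta(\xi)=1$, $Q\xi=\xi$ and $g(fX,fY)=g(X,QY)-\eta(X)\eta(Y)$ for all vector fields $X,Y$. It is assumed that the distribution $\mathcal D=\ker\eta$ is $f$-invariant. $M(f,Q,\xi,\eta,g)$ is a weak $\beta$-Kenmotsu manifold (here $\beta$ is a nonzero real constant) if $(\nabla_X f)Y=\beta\{g(fX,Y)\,\xi-\eta(Y)\,fX\}$ for all vector fields $X,Y$, where $\nabla$ is the Levi-Civita connection of $g$. With $R_{X,Y}Z=\nabla_X\nabla_YZ-\nabla_Y\nabla_XZ-\nabla_{[X,Y]}Z$,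 the $\ast$-Ricci tensor is $\mathrm{Ric}^\ast(X,Y)=\tfrac12\,\mathrm{trace}\{Z\mapsto R_{X,fY}fZ\}$. $\pounds$ denotes the Lie derivative. A $\ast$-$\eta$-Ricci soliton is given by $\lambda,\mu\in\mathbb R$ and a vector field $V$ (the potential vector field) with $\tfrac12\pounds_V g+\mathrm{Ric}^\ast=\lambda\,g+\mu\,\eta\otimes\eta$ (in particular $\mathrm{Ric}^\ast$ is then symmetric); it is called expanding, steady, or shrinking if $\lambda$ is negative, zero, or positive, respectively. *)

theory Defs
  imports "HOL-Analysis.Analysis"
begin

section \<open>Smooth maps between Euclidean spaces\<close>

text \<open>Both notions are only used for open sets \<open>S\<close>.\<close>

primrec Ck_on :: "nat \<Rightarrow> 'e::euclidean_space set \<Rightarrow> ('e \<Rightarrow> 'f::euclidean_space) \<Rightarrow> bool" where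
  "Ck_on 0 S h \<longleftrightarrow> continuous_on S h"
| "Ck_on (Suc k) S h \<longleftrightarrow>
     h differentiable_on S \<and> (\<forall>v. Ck_on k S (\<lambda>x. frechet_derivative h (at x) v))"

definition smooth_on :: "'e::euclidean_space set \<Rightarrow> ('e \<Rightarrow> 'f::euclidean_space) \<Rightarrow> bool" where
  "smooth_on S h \<longleftrightarrow> (\<forall>k. Ck_on k S h)"


section \<open>Smooth manifolds\<close>

text \<open>
  The manifold is the whole (Hausdorff, second countable) type \<open>'a\<close>. A chart is a pair of its
  domain and its coordinate map into \<open>real ^ 'n\<close>, so the dimension is \<open>CARD('n)\<close>. The coordinate
  map is irrelevant outside the domain.
\<close>

type_synonym ('a, 'n) chart = "'a set \<times> ('a \<Rightarrow> real ^ 'n)"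
type_synonym ('a, 'n) atlas = "('a, 'n) chart set"

definition inv_chart :: "('a, 'n::finite) chart \<Rightarrow> real ^ 'n \<Rightarrow> 'a" where
  "inv_chart c = inv_into (fst c) (snd c)"

definition smooth_manifold ::
  "('a::{t2_space, second_countable_topology}, 'n::finite) atlas \<Rightarrow> bool" where
  "smooth_manifold A \<longleftrightarrow>
     (\<Union>c\<in>A. fst c) = UNIV \<and>
     (\<forall>c\<in>A. open (fst c) \<and> open (snd c ` fst c) \<and>
        homeomorphism (fst c) (snd c ` fst c) (snd c) (inv_chart c)) \<and>
     (\<forall>c\<in>A. \<forall>d\<in>A. smooth_on (snd c ` (fst c \<inter> fst d)) (snd d \<circ> inv_chart c))"

text \<open>
  Each point \<open>p\<close> gets a preferred chart around it, and the tangent space at \<open>p\<close> is identified with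
  \<open>real ^ 'n\<close> through the coordinate basis of that chart. Hence a vector field is a function
  \<open>X :: 'a \<Rightarrow> real ^ 'n\<close>, where \<open>X p\<close> is a tangent vector at \<open>p\<close>; the preferred charts
  at different points are unrelated, so smoothness has to be tested on the components in a fixed
  chart. Tensor fields act on tangent vectors at each point.
\<close>

definition chart_at :: "('a, 'n::finite) atlas \<Rightarrow> 'a \<Rightarrow> ('a, 'n) chart" where
  "chart_at A p = (SOME c. c \<in> A \<and> p \<in> fst c)"

text \<open>\<open>to_chart A c p\<close> sends a tangent vector at \<open>p\<close> to its components in the chart \<open>c\<close>;
  \<open>from_chart A c p\<close> is the inverse map.\<close>

definition to_chart ::
  "('a, 'n::finite) atlas \<Rightarrow> ('a, 'n) chart \<Rightarrow> 'a \<Rightarrow> real ^ 'n \<Rightarrow> real ^ 'n" where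
  "to_chart A c p =
     frechet_derivative (snd c \<circ> inv_chart (chart_at A p)) (at (snd (chart_at A p) p))"

definition from_chart ::
  "('a, 'n::finite) atlas \<Rightarrow> ('a, 'n) chart \<Rightarrow> 'a \<Rightarrow> real ^ 'n \<Rightarrow> real ^ 'n" where
  "from_chart A c p =
     frechet_derivative (snd (chart_at A p) \<circ> inv_chart c) (at (snd c p))"

definition vf_rep ::
  "('a, 'n::finite) atlas \<Rightarrow> ('a, 'n) chart \<Rightarrow> ('a \<Rightarrow> real ^ 'n) \<Rightarrow> real ^ 'n \<Rightarrow> real ^ 'n" where
  "vf_rep A c X = (\<lambda>p. to_chart A c p (X p)) \<circ> inv_chart c"

text \<open>Smoothness of functions and vector fields on an open subset \<open>W\<close> of the manifold; values
  outside \<open>W\<close> do not matter.\<close>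

definition smooth_fun_on ::
  "('a::topological_space, 'n::finite) atlas \<Rightarrow> 'a set \<Rightarrow> ('a \<Rightarrow> real) \<Rightarrow> bool" where
  "smooth_fun_on A W u \<longleftrightarrow> (\<forall>c\<in>A. smooth_on (snd c ` (fst c \<inter> W)) (u \<circ> inv_chart c))"

definition smooth_vf_on ::
  "('a::topological_space, 'n::finite) atlas \<Rightarrow> 'a set \<Rightarrow> ('a \<Rightarrow> real ^ 'n) \<Rightarrow> bool" where
  "smooth_vf_on A W X \<longleftrightarrow> (\<forall>c\<in>A. smooth_on (snd c ` (fst c \<inter> W)) (vf_rep A c X))"

definition dir_deriv ::
  "('a, 'n::finite) atlas \<Rightarrow> ('a \<Rightarrow> real ^ 'n) \<Rightarrow> ('a \<Rightarrow> real) \<Rightarrow> 'a \<Rightarrow> real" where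
  "dir_deriv A X u p =
     frechet_derivative (u \<circ> inv_chart (chart_at A p)) (at (snd (chart_at A p) p)) (X p)"

text \<open>The coordinate formula \<open>[X, Y] = dY(X) - dX(Y)\<close> in the preferred chart at \<open>p\<close>.\<close>

definition lie_bracket ::
  "('a, 'n::finite) atlas \<Rightarrow> ('a \<Rightarrow> real ^ 'n) \<Rightarrow> ('a \<Rightarrow> real ^ 'n) \<Rightarrow> 'a \<Rightarrow> real ^ 'n" where
  "lie_bracket A X Y p =
     (let c = chart_at A p in
        frechet_derivative (vf_rep A c Y) (at (snd c p)) (X p)
      - frechet_derivative (vf_rep A c X) (at (snd c p)) (Y p))"


section \<open>Tensor fields, Riemannian metrics and connections\<close>

definition one_form ::
  "('a::topological_space, 'n::finite) atlas \<Rightarrow> ('a \<Rightarrow> real ^ 'n \<Rightarrow> real) \<Rightarrow> bool" where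
  "one_form A \<omega> \<longleftrightarrow>
     (\<forall>p. linear (\<omega> p)) \<and>
     (\<forall>W X. open W \<longrightarrow> smooth_vf_on A W X \<longrightarrow> smooth_fun_on A W (\<lambda>p. \<omega> p (X p)))"

definition tensor11 ::
  "('a::topological_space, 'n::finite) atlas \<Rightarrow> ('a \<Rightarrow> real ^ 'n \<Rightarrow> real ^ 'n) \<Rightarrow> bool" where
  "tensor11 A T \<longleftrightarrow>
     (\<forall>p. linear (T p)) \<and>
     (\<forall>W X. open W \<longrightarrow> smooth_vf_on A W X \<longrightarrow> smooth_vf_on A W (\<lambda>p. T p (X p)))"

definition riemannian_metric ::
  "('a::topological_space, 'n::finite) atlas \<Rightarrow> ('a \<Rightarrow> real ^ 'n \<Rightarrow> real ^ 'n \<Rightarrow> real) \<Rightarrow> bool" where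
  "riemannian_metric A g \<longleftrightarrow>
     (\<forall>p. bilinear (g p)) \<and>
     (\<forall>p v w. g p v w = g p w v) \<and>
     (\<forall>p v. v \<noteq> 0 \<longrightarrow> 0 < g p v v) \<and>
     (\<forall>W X Y. open W \<longrightarrow> smooth_vf_on A W X \<longrightarrow> smooth_vf_on A W Y \<longrightarrow>
        smooth_fun_on A W (\<lambda>p. g p (X p) (Y p)))"

text \<open>
  A connection operates on vector fields defined on arbitrary open sets \<open>W\<close>. The Leibniz rule
  on \<open>W\<close>, applied to the indicator function of \<open>W\<close>, makes \<open>D X Y\<close> on \<open>W\<close> independent
  of the values of \<open>X\<close> and \<open>Y\<close> outside \<open>W\<close>, so compatibility with restrictions need not
  be required separately.
\<close>

definition affine_connection ::
  "('a::topological_space, 'n::finite) atlas \<Rightarrow>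
   (('a \<Rightarrow> real ^ 'n) \<Rightarrow> ('a \<Rightarrow> real ^ 'n) \<Rightarrow> 'a \<Rightarrow> real ^ 'n) \<Rightarrow> bool" where
  "affine_connection A D \<longleftrightarrow>
     (\<forall>W X Y. open W \<longrightarrow> smooth_vf_on A W X \<longrightarrow> smooth_vf_on A W Y \<longrightarrow>
        smooth_vf_on A W (D X Y)) \<and>
     (\<forall>W X X' Y. open W \<longrightarrow> smooth_vf_on A W X \<longrightarrow> smooth_vf_on A W X' \<longrightarrow> smooth_vf_on A W Y \<longrightarrow>
        (\<forall>p\<in>W. D (\<lambda>q. X q + X' q) Y p = D X Y p + D X' Y p)) \<and>
     (\<forall>W u X Y. open W \<longrightarrow> smooth_fun_on A W u \<longrightarrow> smooth_vf_on A W X \<longrightarrow> smooth_vf_on A W Y \<longrightarrow>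
        (\<forall>p\<in>W. D (\<lambda>q. u q *\<^sub>R X q) Y p = u p *\<^sub>R D X Y p)) \<and>
     (\<forall>W X Y Y'. open W \<longrightarrow> smooth_vf_on A W X \<longrightarrow> smooth_vf_on A W Y \<longrightarrow> smooth_vf_on A W Y' \<longrightarrow>
        (\<forall>p\<in>W. D X (\<lambda>q. Y q + Y' q) p = D X Y p + D X Y' p)) \<and>
     (\<forall>W u X Y. open W \<longrightarrow> smooth_fun_on A W u \<longrightarrow> smooth_vf_on A W X \<longrightarrow> smooth_vf_on A W Y \<longrightarrow>
        (\<forall>p\<in>W. D X (\<lambda>q. u q *\<^sub>R Y q) p = dir_deriv A X u p *\<^sub>R Y p + u p *\<^sub>R D X Y p))"

definition levi_civita ::
  "('a::topological_space, 'n::finite) atlas \<Rightarrow> ('a \<Rightarrow> real ^ 'n \<Rightarrow> real ^ 'n \<Rightarrow> real) \<Rightarrow>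
   (('a \<Rightarrow> real ^ 'n) \<Rightarrow> ('a \<Rightarrow> real ^ 'n) \<Rightarrow> 'a \<Rightarrow> real ^ 'n) \<Rightarrow> bool" where
  "levi_civita A g D \<longleftrightarrow>
     affine_connection A D \<and>
     (\<forall>W X Y. open W \<longrightarrow> smooth_vf_on A W X \<longrightarrow> smooth_vf_on A W Y \<longrightarrow>
        (\<forall>p\<in>W. D X Y p - D Y X p = lie_bracket A X Y p)) \<and>
     (\<forall>W X Y Z. open W \<longrightarrow> smooth_vf_on A W X \<longrightarrow> smooth_vf_on A W Y \<longrightarrow> smooth_vf_on A W Z \<longrightarrow>
        (\<forall>p\<in>W. dir_deriv A X (\<lambda>q. g q (Y q) (Z q)) p =
           g p (D X Y p) (Z p) + g p (Y p) (D X Z p)))"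

text \<open>\<open>(D\<^sub>X T) Y\<close> for a (1,1)-tensor field \<open>T\<close>.\<close>

definition cov_deriv11 ::
  "(('a \<Rightarrow> real ^ 'n) \<Rightarrow> ('a \<Rightarrow> real ^ 'n) \<Rightarrow> 'a \<Rightarrow> real ^ 'n::finite) \<Rightarrow>
   ('a \<Rightarrow> real ^ 'n \<Rightarrow> real ^ 'n) \<Rightarrow>
   ('a \<Rightarrow> real ^ 'n) \<Rightarrow> ('a \<Rightarrow> real ^ 'n) \<Rightarrow> 'a \<Rightarrow> real ^ 'n" where
  "cov_deriv11 D T X Y p = D X (\<lambda>q. T q (Y q)) p - T p (D X Y p)"

definition curvature ::
  "('a, 'n::finite) atlas \<Rightarrow>
   (('a \<Rightarrow> real ^ 'n) \<Rightarrow> ('a \<Rightarrow> real ^ 'n) \<Rightarrow> 'a \<Rightarrow> real ^ 'n) \<Rightarrow>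
   ('a \<Rightarrow> real ^ 'n) \<Rightarrow> ('a \<Rightarrow> real ^ 'n) \<Rightarrow> ('a \<Rightarrow> real ^ 'n) \<Rightarrow> 'a \<Rightarrow> real ^ 'n" where
  "curvature A D X Y Z p = D X (D Y Z) p - D Y (D X Z) p - D (lie_bracket A X Y) Z p"

text \<open>
  The curvature at \<open>p\<close> as a trilinear map on the tangent space: tangent vectors are extended to
  vector fields with constant components in the preferred chart at \<open>p\<close>. As curvature is
  tensorial, any other local extensions would give the same value.
\<close>

definition coord_extension ::
  "('a, 'n::finite) atlas \<Rightarrow> 'a \<Rightarrow> real ^ 'n \<Rightarrow> 'a \<Rightarrow> real ^ 'n" where
  "coord_extension A p v = (\<lambda>q. from_chart A (chart_at A p) q v)"

definition curvature_at ::
  "('a, 'n::finite) atlas \<Rightarrow>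
   (('a \<Rightarrow> real ^ 'n) \<Rightarrow> ('a \<Rightarrow> real ^ 'n) \<Rightarrow> 'a \<Rightarrow> real ^ 'n) \<Rightarrow>
   'a \<Rightarrow> real ^ 'n \<Rightarrow> real ^ 'n \<Rightarrow> real ^ 'n \<Rightarrow> real ^ 'n" where
  "curvature_at A D p x y z =
     curvature A D (coord_extension A p x) (coord_extension A p y) (coord_extension A p z) p"

definition star_ricci ::
  "('a, 'n::finite) atlas \<Rightarrow>
   (('a \<Rightarrow> real ^ 'n) \<Rightarrow> ('a \<Rightarrow> real ^ 'n) \<Rightarrow> 'a \<Rightarrow> real ^ 'n) \<Rightarrow>
   ('a \<Rightarrow> real ^ 'n \<Rightarrow> real ^ 'n) \<Rightarrow> 'a \<Rightarrow> real ^ 'n \<Rightarrow> real ^ 'n \<Rightarrow> real" where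
  "star_ricci A D f p x y =
     1 / 2 * trace (matrix (\<lambda>z. curvature_at A D p x (f p y) (f p z)))"

definition lie_deriv_form ::
  "('a, 'n::finite) atlas \<Rightarrow> ('a \<Rightarrow> real ^ 'n) \<Rightarrow> ('a \<Rightarrow> real ^ 'n \<Rightarrow> real) \<Rightarrow>
   ('a \<Rightarrow> real ^ 'n) \<Rightarrow> 'a \<Rightarrow> real" where
  "lie_deriv_form A V \<omega> X p =
     dir_deriv A V (\<lambda>q. \<omega> q (X q)) p - \<omega> p (lie_bracket A V X p)"

definition lie_deriv_metric ::
  "('a, 'n::finite) atlas \<Rightarrow> ('a \<Rightarrow> real ^ 'n) \<Rightarrow> ('a \<Rightarrow> real ^ 'n \<Rightarrow> real ^ 'n \<Rightarrow> real) \<Rightarrow>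
   ('a \<Rightarrow> real ^ 'n) \<Rightarrow> ('a \<Rightarrow> real ^ 'n) \<Rightarrow> 'a \<Rightarrow> real" where
  "lie_deriv_metric A V g X Y p =
     dir_deriv A V (\<lambda>q. g q (X q) (Y q)) p
     - g p (lie_bracket A V X p) (Y p) - g p (X p) (lie_bracket A V Y p)"


section \<open>Weak almost contact metric structures and solitons\<close>

definition weak_almost_contact_metric ::
  "('a::{t2_space, second_countable_topology}, 'n::finite) atlas \<Rightarrow> nat \<Rightarrow>
   ('a \<Rightarrow> real ^ 'n \<Rightarrow> real ^ 'n) \<Rightarrow> ('a \<Rightarrow> real ^ 'n \<Rightarrow> real ^ 'n) \<Rightarrow> ('a \<Rightarrow> real ^ 'n) \<Rightarrow>
   ('a \<Rightarrow> real ^ 'n \<Rightarrow> real) \<Rightarrow> ('a \<Rightarrow> real ^ 'n \<Rightarrow> real ^ 'n \<Rightarrow> real) \<Rightarrow> bool" where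
  "weak_almost_contact_metric A n f Q \<xi> \<eta> g \<longleftrightarrow>
     smooth_manifold A \<and> n \<ge> 1 \<and> CARD('n) = 2 * n + 1 \<and>
     tensor11 A f \<and> (\<forall>p. rank (matrix (f p)) = 2 * n) \<and>
     tensor11 A Q \<and> (\<forall>p. invertible (matrix (Q p))) \<and>
     smooth_vf_on A UNIV \<xi> \<and> one_form A \<eta> \<and> riemannian_metric A g \<and>
     (\<forall>p v. f p (f p v) = - Q p v + \<eta> p v *\<^sub>R \<xi> p) \<and>
     (\<forall>p. \<eta> p (\<xi> p) = 1) \<and>
     (\<forall>p. Q p (\<xi> p) = \<xi> p) \<and>
     (\<forall>p v w. g p (f p v) (f p w) = g p v (Q p w) - \<eta> p v * \<eta> p w) \<and>
     (\<forall>p v. \<eta> p v = 0 \<longrightarrow> \<eta> p (f p v) = 0)"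

definition weak_beta_kenmotsu ::
  "('a::{t2_space, second_countable_topology}, 'n::finite) atlas \<Rightarrow> nat \<Rightarrow>
   ('a \<Rightarrow> real ^ 'n \<Rightarrow> real ^ 'n) \<Rightarrow> ('a \<Rightarrow> real ^ 'n \<Rightarrow> real ^ 'n) \<Rightarrow> ('a \<Rightarrow> real ^ 'n) \<Rightarrow>
   ('a \<Rightarrow> real ^ 'n \<Rightarrow> real) \<Rightarrow> ('a \<Rightarrow> real ^ 'n \<Rightarrow> real ^ 'n \<Rightarrow> real) \<Rightarrow>
   (('a \<Rightarrow> real ^ 'n) \<Rightarrow> ('a \<Rightarrow> real ^ 'n) \<Rightarrow> 'a \<Rightarrow> real ^ 'n) \<Rightarrow> real \<Rightarrow> bool" where
  "weak_beta_kenmotsu A n f Q \<xi> \<eta> g D \<beta> \<longleftrightarrow>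
     weak_almost_contact_metric A n f Q \<xi> \<eta> g \<and> levi_civita A g D \<and> \<beta> \<noteq> 0 \<and>
     (\<forall>W X Y. open W \<longrightarrow> smooth_vf_on A W X \<longrightarrow> smooth_vf_on A W Y \<longrightarrow>
        (\<forall>p\<in>W. cov_deriv11 D f X Y p =
           \<beta> *\<^sub>R (g p (f p (X p)) (Y p) *\<^sub>R \<xi> p - \<eta> p (Y p) *\<^sub>R f p (X p))))"

definition star_eta_ricci_soliton ::
  "('a::topological_space, 'n::finite) atlas \<Rightarrow>
   ('a \<Rightarrow> real ^ 'n \<Rightarrow> real ^ 'n) \<Rightarrow> ('a \<Rightarrow> real ^ 'n \<Rightarrow> real) \<Rightarrow>
   ('a \<Rightarrow> real ^ 'n \<Rightarrow> real ^ 'n \<Rightarrow> real) \<Rightarrow>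
   (('a \<Rightarrow> real ^ 'n) \<Rightarrow> ('a \<Rightarrow> real ^ 'n) \<Rightarrow> 'a \<Rightarrow> real ^ 'n) \<Rightarrow>
   ('a \<Rightarrow> real ^ 'n) \<Rightarrow> real \<Rightarrow> real \<Rightarrow> bool" where
  "star_eta_ricci_soliton A f \<eta> g D V lam mu \<longleftrightarrow>
     smooth_vf_on A UNIV V \<and>
     (\<forall>W X Y. open W \<longrightarrow> smooth_vf_on A W X \<longrightarrow> smooth_vf_on A W Y \<longrightarrow>
        (\<forall>p\<in>W. 1 / 2 * lie_deriv_metric A V g X Y p + star_ricci A D f p (X p) (Y p) =
           lam * g p (X p) (Y p) + mu * (\<eta> p (X p) * \<eta> p (Y p))))"

text \<open>The type of a soliton depends only on its constant \<open>\<lambda>\<close>.\<close>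

definition expanding :: "real \<Rightarrow> bool" where "expanding lam \<longleftrightarrow> lam < 0"
definition steady :: "real \<Rightarrow> bool" where "steady lam \<longleftrightarrow> lam = 0"
definition shrinking :: "real \<Rightarrow> bool" where "shrinking lam \<longleftrightarrow> lam > 0"

end

theory Submission
  imports Defs
begin

text \<open>
  Let \<open>\<L>\<close> be the Lie derivative along \<open>\<xi>\<close> and \<open>c = \<lambda> + \<mu>\<close>. Locally a weak
  \<open>\<beta>\<close>-Kenmotsu manifold is a warped product \<open>dt\<^sup>2 + exp (2 \<beta> t) g\<^sub>0\<close> with \<open>\<xi>\<close> the
  \<open>t\<close>-direction, and the soliton equation on \<open>ker \<eta>\<close> contains the term
  \<open>\<beta> \<eta>(V) g\<close> with \<open>\<eta>(V) = c t + const\<close>, hence a multiple of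
  \<open>c t exp (2 \<beta> t)\<close>. Every other term is a combination of \<open>1\<close> and
  \<open>exp (2 \<beta> t)\<close> with coefficients independent of \<open>t\<close>, so \<open>c = 0\<close>. The proof
  below replaces the splitting, which would need flows, by infinitesimal identities: the
  operator \<open>\<L> - 2 \<beta>\<close> is applied twice.

  The structure equation gives \<open>\<nabla>\<^sub>X \<xi> = \<beta> (X - \<eta>(X) \<xi>)\<close> (\<open>nabla_xi\<close>), hence
  \<open>\<L> g = 2 \<beta> (g - \<eta> \<otimes> \<eta>)\<close>, \<open>d\<eta> = 0\<close> and \<open>\<L> f = 0\<close>. Since
  \<open>f \<xi> = 0\<close>, the \<open>\<ast>\<close>-Ricci tensor vanishes on \<open>(X, \<xi>)\<close>, and the soliton equation
  there determines \<open>\<L> V\<close> through the gradient of \<open>\<eta>(V)\<close> (\<open>L_V_dual\<close>). It follows that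
  \<open>\<eta>(\<L> V) = c\<close> and \<open>\<L> \<L> V = - 2 \<beta> (\<L> V - c \<xi>)\<close> (\<open>eta_L_V\<close>, \<open>L_L_V\<close>).

  On \<open>ker \<eta>\<close> two tensors have to be differentiated along \<open>\<xi>\<close>. For a Lie derivative of
  the metric, \<open>\<L> (\<pounds>\<^sub>Z g) = \<pounds>\<^bsub>\<L> Z\<^esub> g + 2 \<beta> \<pounds>\<^sub>Z g\<close> (\<open>xi_B\<close>). For the
  curvature, \<open>\<L> \<nabla>\<close> is the tensor \<open>- 2 \<beta>\<^sup>2 (g - \<eta> \<otimes> \<eta>) \<otimes> \<xi>\<close>
  (\<open>lie_connection_eq\<close>); this gives \<open>\<L> R\<close>, and a trace gives
  \<open>\<L> Ric\<^sup>\<ast> = - \<beta>\<^sup>3 F\<close> with an explicit \<open>F\<close> built from \<open>g\<close> and \<open>f\<close>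
  (\<open>xi_Ric\<close>).

  Applying \<open>\<L> - 2 \<beta>\<close> to the soliton equation on \<open>ker \<eta>\<close> and eliminating
  \<open>Ric\<^sup>\<ast>\<close> with the equation itself leaves
  \<open>\<onehalf> \<pounds>\<^bsub>\<L> V\<^esub> g + \<beta> \<pounds>\<^sub>V g - \<beta>\<^sup>3 F = 2 \<beta> \<lambda> g\<close>. Applying
  \<open>\<L> - 2 \<beta>\<close> once more removes \<open>F\<close> and the right-hand side:
  \<open>\<onehalf> \<pounds>\<^bsub>\<L> \<L> V\<^esub> g + \<beta> \<pounds>\<^bsub>\<L> V\<^esub> g = 0\<close>. With the
  formula for \<open>\<L> \<L> V\<close> this is \<open>\<beta> c \<pounds>\<^sub>\<xi> g = 2 \<beta>\<^sup>2 c g = 0\<close> on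
  \<open>ker \<eta> \<noteq> 0\<close>, so \<open>c = 0\<close>. The remaining claims follow from
  \<open>\<eta>(\<L> V) = c\<close>.
\<close>

section \<open>Smooth maps on open subsets of Euclidean space\<close>

lemma differentiable_on_openD:
  "h differentiable_on S \<Longrightarrow> open S \<Longrightarrow> x \<in> S \<Longrightarrow> h differentiable (at x)"
  by (simp add: differentiable_on_eq_differentiable_at)

lemma Ck_on_differentiable:
  "Ck_on (Suc k) S h \<Longrightarrow> open S \<Longrightarrow> x \<in> S \<Longrightarrow> h differentiable (at x)"
  by (auto intro: differentiable_on_openD)

lemma Ck_on_cong:
  assumes "open S" "\<And>x. x \<in> S \<Longrightarrow> h x = h' x" "Ck_on k S h"
  shows "Ck_on k S h'"
  using assms(2,3)
proof (induction k arbitrary: h h')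
  case 0
  then show ?case by (simp cong: continuous_on_cong)
next
  case (Suc k)
  have d: "h differentiable_on S" using Suc.prems by simp
  have fd: "frechet_derivative h (at x) = frechet_derivative h' (at x)" if "x \<in> S" for x
    by (rule frechet_derivative_transform_within_open[OF _ assms(1) that])
       (use d assms(1) that Suc.prems in \<open>auto intro: differentiable_on_openD\<close>)
  have "h' differentiable_on S"
    using d Suc.prems(1) by (metis differentiable_on_def differentiable_transform_within zero_less_one)
  moreover have "Ck_on k S (\<lambda>x. frechet_derivative h' (at x) v)" for v
    by (rule Suc.IH[of "\<lambda>x. frechet_derivative h (at x) v"]) (use fd Suc.prems in auto)
  ultimately show ?case by simp
qed

lemma Ck_on_subset: "Ck_on k S h \<Longrightarrow> T \<subseteq> S \<Longrightarrow> Ck_on k T h"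
  by (induction k arbitrary: h) (auto intro: continuous_on_subset differentiable_on_subset)

lemma Ck_on_pred: "Ck_on (Suc k) S h \<Longrightarrow> Ck_on k S h"
  by (induction k arbitrary: h) (auto intro: differentiable_imp_continuous_on)

lemma Ck_on_const: "Ck_on k S (\<lambda>x. c)"
  by (induction k arbitrary: c) auto

lemma Ck_on_Suc_has_derivativeI:
  assumes "open S" "\<And>x. x \<in> S \<Longrightarrow> (h has_derivative h' x) (at x)"
    and "\<And>v. Ck_on k S (\<lambda>x. h' x v)"
  shows "Ck_on (Suc k) S h"
proof -
  have "h differentiable_on S"
    using assms(1,2) differentiableI by (auto simp: differentiable_on_eq_differentiable_at)
  moreover have "Ck_on k S (\<lambda>x. frechet_derivative h (at x) v)" for v
    by (rule Ck_on_cong[OF assms(1) _ assms(3)[of v]]) (metis assms(2) frechet_derivative_at)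
  ultimately show ?thesis by simp
qed

lemma has_frechet_derivative: "h differentiable (at x) \<Longrightarrow> (h has_derivative frechet_derivative h (at x)) (at x)"
  using frechet_derivative_works by blast

lemma Ck_on_add:
  assumes "open S" "Ck_on k S h" "Ck_on k S h'" shows "Ck_on k S (\<lambda>x. h x + h' x)"
  using assms(2,3)
proof (induction k arbitrary: h h')
  case 0 then show ?case by (simp add: continuous_on_add)
next
  case (Suc k)
  show ?case
    by (rule Ck_on_Suc_has_derivativeI[OF assms(1)], rule has_derivative_add;
        (rule has_frechet_derivative, rule Ck_on_differentiable[OF _ assms(1)])?)
       (use Suc in auto)
qed

lemma Ck_on_scaleR:
  assumes "open S" "Ck_on k S u" "Ck_on k S h" shows "Ck_on k S (\<lambda>x. u x *\<^sub>R h x)"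
  using assms(2,3)
proof (induction k arbitrary: u h)
  case 0 then show ?case by (simp add: continuous_on_scaleR)
next
  case (Suc k)
  show ?case
  proof (rule Ck_on_Suc_has_derivativeI[OF assms(1)])
    show "((\<lambda>x. u x *\<^sub>R h x) has_derivative (\<lambda>v. u x *\<^sub>R frechet_derivative h (at x) v + frechet_derivative u (at x) v *\<^sub>R h x)) (at x)"
      if "x \<in> S" for x
      by (rule has_derivative_scaleR; rule has_frechet_derivative, rule Ck_on_differentiable[OF _ assms(1) that])
        (use Suc in auto)
    show "Ck_on k S (\<lambda>x. u x *\<^sub>R frechet_derivative h (at x) v + frechet_derivative u (at x) v *\<^sub>R h x)" for v
      using Suc.prems by (auto intro!: Ck_on_add[OF assms(1)] Suc.IH Ck_on_pred[of k S h] Ck_on_pred[of k S u])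
  qed
qed

lemma Ck_on_linear:
  assumes "open S" "Ck_on k S h" "bounded_linear L" shows "Ck_on k S (\<lambda>x. L (h x))"
  using assms(2)
proof (induction k arbitrary: h)
  case 0 then show ?case using assms(3) by (simp add: bounded_linear.continuous_on)
next
  case (Suc k)
  show ?case
  proof (rule Ck_on_Suc_has_derivativeI[OF assms(1)])
    show "((\<lambda>x. L (h x)) has_derivative (\<lambda>v. L (frechet_derivative h (at x) v))) (at x)" if "x \<in> S" for x
      by (rule bounded_linear.has_derivative[OF assms(3)], rule has_frechet_derivative,
          rule Ck_on_differentiable[OF Suc.prems assms(1) that])
    show "Ck_on k S (\<lambda>x. L (frechet_derivative h (at x) v))" for v
      using Suc.IH[of "\<lambda>x. frechet_derivative h (at x) v"] Suc.prems by simp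
  qed
qed

lemma Ck_on_sum:
  assumes "open S" "\<And>i. i \<in> I \<Longrightarrow> Ck_on k S (h i)"
  shows "Ck_on k S (\<lambda>x. \<Sum>i\<in>I. h i x)"
  using assms(2) by (induction I rule: infinite_finite_induct) (auto intro: Ck_on_const Ck_on_add[OF assms(1)])

lemma linear_expansion:
  assumes "linear L" shows "L v = (\<Sum>b\<in>Basis. (v \<bullet> b) *\<^sub>R L b)"
  by (metis (no_types, lifting) assms euclidean_representation linear_scale linear_sum sum.cong)

text \<open>
  The induction works because the chain rule, expanded in the basis, expresses the derivative of the
  composite by products of functions of the two kinds that the induction hypothesis covers.
\<close>

lemma Ck_on_compose:
  assumes "open S" "open T" "t ` S \<subseteq> T" "Ck_on k T h" "Ck_on k S t"
  shows "Ck_on k S (\<lambda>x. h (t x))"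
  using assms(4,5)
proof (induction k arbitrary: h)
  case 0
  then show ?case using assms(3) continuous_on_compose2 by auto
next
  case (Suc k)
  have tT: "t x \<in> T" if "x \<in> S" for x using that assms(3) by auto
  have dh: "h differentiable (at (t x))" if "x \<in> S" for x
    using Ck_on_differentiable[OF Suc.prems(1) assms(2) tT[OF that]] .
  have dt: "t differentiable (at x)" if "x \<in> S" for x
    using Ck_on_differentiable[OF Suc.prems(2) assms(1) that] .
  show ?case
  proof (rule Ck_on_Suc_has_derivativeI[OF assms(1)])
    show "((\<lambda>x. h (t x)) has_derivative
       (\<lambda>v. \<Sum>b\<in>Basis. (frechet_derivative t (at x) v \<bullet> b) *\<^sub>R frechet_derivative h (at (t x)) b)) (at x)" if "x \<in> S" for x
      using diff_chain_at[OF has_frechet_derivative[OF dt[OF that]] has_frechet_derivative[OF dh[OF that]]]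
      unfolding o_def by (subst (asm) linear_expansion[OF linear_frechet_derivative[OF dh[OF that]]])
    show "Ck_on k S (\<lambda>x. \<Sum>b\<in>Basis. (frechet_derivative t (at x) v \<bullet> b) *\<^sub>R frechet_derivative h (at (t x)) b)" for v
    proof (intro Ck_on_sum Ck_on_scaleR assms(1))
      show "Ck_on k S (\<lambda>x. frechet_derivative t (at x) v \<bullet> b)" for b
        by (rule Ck_on_linear[OF assms(1) _ bounded_linear_inner_left]) (use Suc.prems in auto)
      show "Ck_on k S (\<lambda>x. frechet_derivative h (at (t x)) b)" for b
        using Suc.IH[of "\<lambda>y. frechet_derivative h (at y) b"] Suc.prems(1) Ck_on_pred[OF Suc.prems(2)] by simp
    qed
  qed
qed

lemma smooth_on_cong: "open S \<Longrightarrow> smooth_on S h \<Longrightarrow> (\<And>x. x \<in> S \<Longrightarrow> h x = h' x) \<Longrightarrow> smooth_on S h'"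
  unfolding smooth_on_def using Ck_on_cong by blast

lemma smooth_on_subset: "smooth_on S h \<Longrightarrow> T \<subseteq> S \<Longrightarrow> smooth_on T h"
  unfolding smooth_on_def using Ck_on_subset by blast

lemma smooth_on_const: "smooth_on S (\<lambda>x. c)"
  unfolding smooth_on_def using Ck_on_const by blast

lemma smooth_on_add: "open S \<Longrightarrow> smooth_on S h \<Longrightarrow> smooth_on S h' \<Longrightarrow> smooth_on S (\<lambda>x. h x + h' x)"
  unfolding smooth_on_def by (auto intro: Ck_on_add)

lemma smooth_on_scaleR: "open S \<Longrightarrow> smooth_on S u \<Longrightarrow> smooth_on S h \<Longrightarrow> smooth_on S (\<lambda>x. u x *\<^sub>R h x)"
  unfolding smooth_on_def by (auto intro: Ck_on_scaleR)

lemma smooth_on_mult: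
  fixes h :: "'e::euclidean_space \<Rightarrow> real"
  shows "open S \<Longrightarrow> smooth_on S u \<Longrightarrow> smooth_on S h \<Longrightarrow> smooth_on S (\<lambda>x. u x * h x)"
  using smooth_on_scaleR[of S u h] by simp

lemma smooth_on_linear: "open S \<Longrightarrow> smooth_on S h \<Longrightarrow> bounded_linear L \<Longrightarrow> smooth_on S (\<lambda>x. L (h x))"
  unfolding smooth_on_def by (auto intro: Ck_on_linear[where L=L])

lemma smooth_on_sum: "open S \<Longrightarrow> (\<And>i. i \<in> I \<Longrightarrow> smooth_on S (h i)) \<Longrightarrow> smooth_on S (\<lambda>x. \<Sum>i\<in>I. h i x)"
  unfolding smooth_on_def by (auto intro: Ck_on_sum)

lemma smooth_on_compose:
  "open S \<Longrightarrow> open T \<Longrightarrow> t ` S \<subseteq> T \<Longrightarrow> smooth_on T h \<Longrightarrow> smooth_on S t \<Longrightarrow> smooth_on S (\<lambda>x. h (t x))"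
  unfolding smooth_on_def by (auto intro: Ck_on_compose[of S T t])

lemma smooth_on_differentiable: "smooth_on S h \<Longrightarrow> open S \<Longrightarrow> x \<in> S \<Longrightarrow> h differentiable (at x)"
  unfolding smooth_on_def using Ck_on_differentiable by blast

lemma smooth_on_derivative: "smooth_on S h \<Longrightarrow> smooth_on S (\<lambda>x. frechet_derivative h (at x) v)"
  unfolding smooth_on_def by (metis Ck_on.simps(2))

lemma smooth_on_derivative_apply:
  assumes "open S" "smooth_on S h" "smooth_on S X"
  shows "smooth_on S (\<lambda>x. frechet_derivative h (at x) (X x))"
proof (rule smooth_on_cong[OF assms(1)])
  show "smooth_on S (\<lambda>x. \<Sum>b\<in>Basis. (X x \<bullet> b) *\<^sub>R frechet_derivative h (at x) b)"
    using assms by (intro smooth_on_sum smooth_on_scaleR smooth_on_derivative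
        smooth_on_linear[OF _ _ bounded_linear_inner_left])
  show "(\<Sum>b\<in>Basis. (X x \<bullet> b) *\<^sub>R frechet_derivative h (at x) b) = frechet_derivative h (at x) (X x)"
    if "x \<in> S" for x
    by (rule linear_expansion[OF linear_frechet_derivative[OF smooth_on_differentiable[OF assms(2,1) that]], symmetric])
qed

lemma has_real_derivative_along_line:
  fixes h :: "'e::euclidean_space \<Rightarrow> real"
  assumes "h differentiable (at (a + s *\<^sub>R v))"
  shows "((\<lambda>s. h (a + s *\<^sub>R v)) has_real_derivative frechet_derivative h (at (a + s *\<^sub>R v)) v) (at s)"
proof -
  have "((\<lambda>s. a + s *\<^sub>R v) has_derivative (\<lambda>r. r *\<^sub>R v)) (at s)"
    by (auto intro!: derivative_eq_intros)
  from diff_chain_at[OF this has_frechet_derivative[OF assms]]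
  have "((\<lambda>s. h (a + s *\<^sub>R v)) has_derivative (\<lambda>r. frechet_derivative h (at (a + s *\<^sub>R v)) (r *\<^sub>R v))) (at s)"
    by (simp add: o_def)
  then show ?thesis
    unfolding has_field_derivative_def
    by (simp add: linear_scale[OF linear_frechet_derivative[OF assms]] mult_commute_abs)
qed

text \<open>
  Two applications of the mean value theorem turn the second difference quotient into a second
  derivative at a nearby point. The quotient is symmetric in \<open>v\<close> and \<open>w\<close>, which gives the
  symmetry of second derivatives.
\<close>

lemma second_difference_quotient_tendsto:
  fixes h :: "'e::euclidean_space \<Rightarrow> real"
  assumes S: "open S" and h: "smooth_on S h" and a: "a \<in> S"
  shows "((\<lambda>t. (h (a + t *\<^sub>R v + t *\<^sub>R w) - h (a + t *\<^sub>R v) - h (a + t *\<^sub>R w) + h a) / t\<^sup>2)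
     \<longlongrightarrow> frechet_derivative (\<lambda>x. frechet_derivative h (at x) v) (at a) w) (at_right 0)"
proof -
  define h1 where "h1 = (\<lambda>x. frechet_derivative h (at x) v)"
  define h2 where "h2 = (\<lambda>x. frechet_derivative h1 (at x) w)"
  have h1: "smooth_on S h1" unfolding h1_def by (rule smooth_on_derivative[OF h])
  have h2: "smooth_on S h2" unfolding h2_def by (rule smooth_on_derivative[OF h1])
  have "continuous (at a) h2"
    using smooth_on_differentiable[OF h2 S a] by (rule differentiable_imp_continuous_within)
  have "((\<lambda>t. (h (a + t *\<^sub>R v + t *\<^sub>R w) - h (a + t *\<^sub>R v) - h (a + t *\<^sub>R w) + h a) / t\<^sup>2) \<longlongrightarrow> h2 a) (at_right 0)"
  proof (rule tendstoI)
    fix e :: real assume "e > 0"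
    with \<open>continuous (at a) h2\<close> obtain d where d: "d > 0" "\<And>x. dist x a < d \<Longrightarrow> dist (h2 x) (h2 a) < e"
      by (metis continuous_at_eps_delta)
    obtain r where r: "r > 0" "ball a r \<subseteq> S" using S a open_contains_ball by blast
    define m where "m = min d r / (norm v + norm w + 1)"
    have nn: "norm v + norm w + 1 > 0" by (simp add: add_nonneg_pos)
    have m: "m > 0" unfolding m_def using d r nn by simp
    have close: "dist (a + x *\<^sub>R v + y *\<^sub>R w) a < min d r" if "0 \<le> x" "x < m" "0 \<le> y" "y < m" for x y
    proof -
      have "dist (a + x *\<^sub>R v + y *\<^sub>R w) a \<le> x * norm v + y * norm w"
        using norm_triangle_ineq[of "x *\<^sub>R v" "y *\<^sub>R w"] that by (simp add: dist_norm add.assoc)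
      also have "\<dots> \<le> m * norm v + m * norm w"
        using that by (intro add_mono mult_right_mono) auto
      also have "\<dots> < m * (norm v + norm w + 1)" using m by (simp add: algebra_simps)
      also have "\<dots> = min d r" unfolding m_def using nn by simp
      finally show ?thesis .
    qed
    have inS: "a + x *\<^sub>R v + y *\<^sub>R w \<in> S" if "0 \<le> x" "x < m" "0 \<le> y" "y < m" for x y
      using close[OF that] r(2) by (auto simp: dist_commute)
    have "dist ((h (a + t *\<^sub>R v + t *\<^sub>R w) - h (a + t *\<^sub>R v) - h (a + t *\<^sub>R w) + h a) / t\<^sup>2) (h2 a) < e"
      if t: "0 < t" "t < m" for t
    proof -
      define p where "p = (\<lambda>s. h (a + t *\<^sub>R w + s *\<^sub>R v) - h (a + s *\<^sub>R v))"
      have "\<exists>z. 0 < z \<and> z < t \<and> p t - p 0 = (t - 0) * (h1 (a + t *\<^sub>R w + z *\<^sub>R v) - h1 (a + z *\<^sub>R v))"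
      proof (rule MVT2[OF t(1)])
        fix x assume x: "0 \<le> x" "x \<le> t"
        have *: "h differentiable (at (a + t *\<^sub>R w + x *\<^sub>R v))" "h differentiable (at (a + x *\<^sub>R v))"
          using smooth_on_differentiable[OF h S] inS[of x t] inS[of x 0] x t by (auto simp: add_ac)
        show "(p has_real_derivative h1 (a + t *\<^sub>R w + x *\<^sub>R v) - h1 (a + x *\<^sub>R v)) (at x)"
          unfolding p_def h1_def
          by (intro DERIV_diff has_real_derivative_along_line *)
      qed
      then obtain z where z: "0 < z" "z < t" "p t - p 0 = t * (h1 (a + t *\<^sub>R w + z *\<^sub>R v) - h1 (a + z *\<^sub>R v))"
        by auto
      have "\<exists>y. 0 < y \<and> y < t \<and> h1 (a + z *\<^sub>R v + t *\<^sub>R w) - h1 (a + z *\<^sub>R v + 0 *\<^sub>R w) = (t - 0) * h2 (a + z *\<^sub>R v + y *\<^sub>R w)"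
      proof (rule MVT2[OF t(1)])
        fix y assume y: "0 \<le> y" "y \<le> t"
        have *: "h1 differentiable (at (a + z *\<^sub>R v + y *\<^sub>R w))"
          using smooth_on_differentiable[OF h1 S] inS[of z y] y t z by auto
        show "((\<lambda>y. h1 (a + z *\<^sub>R v + y *\<^sub>R w)) has_real_derivative h2 (a + z *\<^sub>R v + y *\<^sub>R w)) (at y)"
          unfolding h2_def by (rule has_real_derivative_along_line[OF *])
      qed
      then obtain y where y: "0 < y" "y < t" "h1 (a + t *\<^sub>R w + z *\<^sub>R v) - h1 (a + z *\<^sub>R v) = t * h2 (a + z *\<^sub>R v + y *\<^sub>R w)"
        by (auto simp: add_ac)
      have "p t - p 0 = t\<^sup>2 * h2 (a + z *\<^sub>R v + y *\<^sub>R w)"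
        using z(3) y(3) by (simp add: power2_eq_square)
      moreover have "p t - p 0 = h (a + t *\<^sub>R v + t *\<^sub>R w) - h (a + t *\<^sub>R v) - h (a + t *\<^sub>R w) + h a"
        by (simp add: p_def add_ac)
      ultimately have "(h (a + t *\<^sub>R v + t *\<^sub>R w) - h (a + t *\<^sub>R v) - h (a + t *\<^sub>R w) + h a) / t\<^sup>2 = h2 (a + z *\<^sub>R v + y *\<^sub>R w)"
        using t by simp
      moreover have "dist (a + z *\<^sub>R v + y *\<^sub>R w) a < d" using close[of z y] z y t by simp
      ultimately show ?thesis using d(2) by simp
    qed
    then show "\<forall>\<^sub>F t in at_right 0. dist ((h (a + t *\<^sub>R v + t *\<^sub>R w) - h (a + t *\<^sub>R v) - h (a + t *\<^sub>R w) + h a) / t\<^sup>2) (h2 a) < e"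
      unfolding eventually_at_right_field using m by blast
  qed
  then show ?thesis by (simp add: h1_def h2_def)
qed

lemma second_derivative_symmetric:
  fixes h :: "'e::euclidean_space \<Rightarrow> real"
  assumes "open S" "smooth_on S h" "a \<in> S"
  shows "frechet_derivative (\<lambda>x. frechet_derivative h (at x) v) (at a) w
       = frechet_derivative (\<lambda>x. frechet_derivative h (at x) w) (at a) v"
proof -
  have "(\<lambda>t. (h (a + t *\<^sub>R w + t *\<^sub>R v) - h (a + t *\<^sub>R w) - h (a + t *\<^sub>R v) + h a) / t\<^sup>2)
      = (\<lambda>t. (h (a + t *\<^sub>R v + t *\<^sub>R w) - h (a + t *\<^sub>R v) - h (a + t *\<^sub>R w) + h a) / t\<^sup>2)"
    by (simp add: algebra_simps)
  then show ?thesis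
    using second_difference_quotient_tendsto[OF assms, of v w]
      second_difference_quotient_tendsto[OF assms, of w v]
    by (metis (no_types, lifting) tendsto_unique trivial_limit_at_right_real)
qed

section \<open>Charts and changes of coordinates\<close>

lemma linear_expansion_vec:
  fixes v :: "real ^ 'n"
  assumes "linear L" shows "L v = (\<Sum>i\<in>UNIV. (v $ i) *\<^sub>R L (axis i 1))"
proof -
  have "v = (\<Sum>i\<in>UNIV. (v $ i) *\<^sub>R axis i 1)"
    by (simp add: vec_eq_iff axis_def if_distrib cong: if_cong)
  then show ?thesis
    using assms by (metis (no_types, lifting) linear_scale linear_sum sum.cong)
qed

text \<open>
  The Jacobian at \<open>q\<close> of the change of coordinates from the chart \<open>c\<close> to the chart \<open>d\<close>.
  Both conversions between tangent vectors and chart components are instances of it.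
\<close>

definition jac :: "('a, 'n::finite) chart \<Rightarrow> ('a, 'n) chart \<Rightarrow> 'a \<Rightarrow> real ^ 'n \<Rightarrow> real ^ 'n" where
  "jac c d q = frechet_derivative (snd d \<circ> inv_chart c) (at (snd c q))"

locale manifold =
  fixes A :: "('a::{t2_space, second_countable_topology}, 'n::finite) atlas"
  assumes manifold: "smooth_manifold A"
begin

lemma chart_open: "c \<in> A \<Longrightarrow> open (fst c)"
  using manifold by (auto simp: smooth_manifold_def)

lemma chart_homeomorphism: "c \<in> A \<Longrightarrow> homeomorphism (fst c) (snd c ` fst c) (snd c) (inv_chart c)"
  using manifold by (auto simp: smooth_manifold_def)

lemma chart_inv [simp]: "c \<in> A \<Longrightarrow> q \<in> fst c \<Longrightarrow> inv_chart c (snd c q) = q"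
  using chart_homeomorphism[of c] by (auto simp: homeomorphism_def)

lemma chart_image_open: 
  assumes "c \<in> A" "open W" shows "open (snd c ` (fst c \<inter> W))"
proof -
  have "openin (top_of_set (snd c ` fst c)) (snd c ` (fst c \<inter> W))"
    using homeomorphism_imp_open_map[OF chart_homeomorphism[OF assms(1)]] assms(2) by blast
  then show ?thesis
    using manifold assms(1) by (auto simp: smooth_manifold_def intro: openin_open_trans)
qed

lemma chart_at: "chart_at A p \<in> A" "p \<in> fst (chart_at A p)"
proof -
  have "p \<in> (\<Union>c\<in>A. fst c)" using manifold by (simp add: smooth_manifold_def)
  then have "\<exists>c. c \<in> A \<and> p \<in> fst c" by blast
  from someI_ex[OF this] show "chart_at A p \<in> A" "p \<in> fst (chart_at A p)"
    by (auto simp: chart_at_def)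
qed

lemma transition_smooth:
  "c \<in> A \<Longrightarrow> d \<in> A \<Longrightarrow> smooth_on (snd c ` (fst c \<inter> fst d)) (\<lambda>x. snd d (inv_chart c x))"
  using manifold by (simp add: smooth_manifold_def o_def)

lemma transition_has_derivative:
  assumes "c \<in> A" "d \<in> A" "q \<in> fst c" "q \<in> fst d"
  shows "((\<lambda>x. snd d (inv_chart c x)) has_derivative jac c d q) (at (snd c q))"
  using smooth_on_differentiable[OF transition_smooth chart_image_open, of c d "snd c q"] assms
  unfolding jac_def o_def
  by (intro has_frechet_derivative) (auto simp: chart_open)

lemma jac_linear: "c \<in> A \<Longrightarrow> d \<in> A \<Longrightarrow> q \<in> fst c \<Longrightarrow> q \<in> fst d \<Longrightarrow> linear (jac c d q)"
  using transition_has_derivative has_derivative_linear by blast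

lemma smooth_fun_has_derivative:
  assumes "c \<in> A" "open W" "q \<in> fst c" "q \<in> W" "smooth_fun_on A W u"
  shows "((\<lambda>x. u (inv_chart c x)) has_derivative
     frechet_derivative (u \<circ> inv_chart c) (at (snd c q))) (at (snd c q))"
  using assms smooth_on_differentiable[OF _ chart_image_open, of c W "u \<circ> inv_chart c" "snd c q"]
  unfolding smooth_fun_on_def
  by (metis (no_types, lifting) IntI comp_def ext has_frechet_derivative imageI)

lemma derivative_chart_change:
  assumes "b \<in> A" "c \<in> A" "q \<in> fst b" "q \<in> fst c"
    and "((\<lambda>x. h (inv_chart c x)) has_derivative L) (at (snd c q))"
  shows "((\<lambda>x. h (inv_chart b x)) has_derivative (\<lambda>v. L (jac b c q v))) (at (snd b q))"
proof -
  have "snd c (inv_chart b (snd b q)) = snd c q" using assms by simp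
  with assms(5) diff_chain_at[OF transition_has_derivative[of b c q], of "\<lambda>x. h (inv_chart c x)" L] assms(1-4)
  have *: "((\<lambda>x. h (inv_chart c (snd c (inv_chart b x)))) has_derivative (\<lambda>v. L (jac b c q v))) (at (snd b q))"
    by (simp add: o_def)
  show ?thesis
    by (rule has_derivative_transform_within_open[OF * chart_image_open[of b "fst c"]])
      (use assms in \<open>auto simp: chart_open\<close>)
qed

lemma jac_comp:
  assumes "b \<in> A" "c \<in> A" "d \<in> A" "q \<in> fst b" "q \<in> fst c" "q \<in> fst d"
  shows "jac c d q (jac b c q v) = jac b d q v"
  using has_derivative_unique[OF derivative_chart_change[OF assms(1,2,4,5) transition_has_derivative]
    transition_has_derivative] assms by metis

lemma jac_id:
  assumes "c \<in> A" "q \<in> fst c" shows "jac c c q v = v"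
proof -
  have "((\<lambda>x. snd c (inv_chart c x)) has_derivative (\<lambda>v. v)) (at (snd c q))"
    by (rule has_derivative_transform_within_open[OF has_derivative_ident chart_image_open[of c UNIV]])
      (use assms in auto)
  from has_derivative_unique[OF transition_has_derivative this] show ?thesis using assms by metis
qed

lemma to_chart_jac: "to_chart A c q = jac (chart_at A q) c q"
  by (simp add: to_chart_def jac_def)

lemma from_chart_jac: "from_chart A c q = jac c (chart_at A q) q"
  by (simp add: from_chart_def jac_def)

lemma to_chart_linear: "c \<in> A \<Longrightarrow> q \<in> fst c \<Longrightarrow> linear (to_chart A c q)"
  unfolding to_chart_jac using jac_linear chart_at by blast

lemma from_chart_linear: "c \<in> A \<Longrightarrow> q \<in> fst c \<Longrightarrow> linear (from_chart A c q)"
  unfolding from_chart_jac using jac_linear chart_at by blast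

lemma to_from_chart [simp]: "c \<in> A \<Longrightarrow> q \<in> fst c \<Longrightarrow> to_chart A c q (from_chart A c q v) = v"
  by (simp add: to_chart_jac from_chart_jac jac_comp jac_id chart_at)

lemma from_to_chart [simp]: "c \<in> A \<Longrightarrow> q \<in> fst c \<Longrightarrow> from_chart A c q (to_chart A c q v) = v"
  by (simp add: to_chart_jac from_chart_jac jac_comp jac_id chart_at)

lemma to_chart_at [simp]: "to_chart A (chart_at A p) p v = v"
  by (simp add: to_chart_jac jac_id chart_at)

lemma from_chart_at [simp]: "from_chart A (chart_at A p) p v = v"
  by (simp add: from_chart_jac jac_id chart_at)

section \<open>Smooth functions and vector fields\<close>

lemma smooth_fun_on_subset: "smooth_fun_on A W u \<Longrightarrow> W' \<subseteq> W \<Longrightarrow> smooth_fun_on A W' u"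
  unfolding smooth_fun_on_def by (meson Int_mono image_mono smooth_on_subset subset_refl)

lemma smooth_vf_on_subset: "smooth_vf_on A W X \<Longrightarrow> W' \<subseteq> W \<Longrightarrow> smooth_vf_on A W' X"
  unfolding smooth_vf_on_def by (meson Int_mono image_mono smooth_on_subset subset_refl)

text \<open>
  The coordinate expression \<open>h c\<close> in the chart \<open>c\<close> has to agree with \<open>u\<close> only on the region,
  which absorbs the arbitrary values of \<open>inv_chart c\<close> outside the image of the chart.
\<close>

lemma smooth_fun_onI:
  assumes "open W" "\<And>c. c \<in> A \<Longrightarrow> smooth_on (snd c ` (fst c \<inter> W)) (h c)"
    and "\<And>c q. c \<in> A \<Longrightarrow> q \<in> fst c \<Longrightarrow> q \<in> W \<Longrightarrow> h c (snd c q) = u q"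
  shows "smooth_fun_on A W u"
  unfolding smooth_fun_on_def
proof
  fix c assume c: "c \<in> A"
  show "smooth_on (snd c ` (fst c \<inter> W)) (u \<circ> inv_chart c)"
    by (rule smooth_on_cong[OF chart_image_open[OF c assms(1)] assms(2)[OF c]]) (use assms(3)[OF c] c in auto)
qed

lemma smooth_vf_onI:
  assumes "open W" "\<And>c. c \<in> A \<Longrightarrow> smooth_on (snd c ` (fst c \<inter> W)) (h c)"
    and "\<And>c q. c \<in> A \<Longrightarrow> q \<in> fst c \<Longrightarrow> q \<in> W \<Longrightarrow> h c (snd c q) = to_chart A c q (X q)"
  shows "smooth_vf_on A W X"
  unfolding smooth_vf_on_def
proof
  fix c assume c: "c \<in> A"
  show "smooth_on (snd c ` (fst c \<inter> W)) (vf_rep A c X)"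
    by (rule smooth_on_cong[OF chart_image_open[OF c assms(1)] assms(2)[OF c]])
      (use assms(3)[OF c] c in \<open>auto simp: vf_rep_def\<close>)
qed

lemma smooth_fun_onD: "smooth_fun_on A W u \<Longrightarrow> c \<in> A \<Longrightarrow> smooth_on (snd c ` (fst c \<inter> W)) (\<lambda>x. u (inv_chart c x))"
  by (simp add: smooth_fun_on_def o_def)

lemma smooth_vf_onD: "smooth_vf_on A W X \<Longrightarrow> c \<in> A \<Longrightarrow> smooth_on (snd c ` (fst c \<inter> W)) (vf_rep A c X)"
  by (simp add: smooth_vf_on_def)

lemma vf_rep_at [simp]: "c \<in> A \<Longrightarrow> q \<in> fst c \<Longrightarrow> vf_rep A c X (snd c q) = to_chart A c q (X q)"
  by (simp add: vf_rep_def)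

lemma smooth_fun_cong: "open W \<Longrightarrow> smooth_fun_on A W u \<Longrightarrow> (\<And>q. q \<in> W \<Longrightarrow> u q = u' q) \<Longrightarrow> smooth_fun_on A W u'"
  by (rule smooth_fun_onI[where h="\<lambda>c x. u (inv_chart c x)"]) (auto intro: smooth_fun_onD)

lemma smooth_vf_cong: "open W \<Longrightarrow> smooth_vf_on A W X \<Longrightarrow> (\<And>q. q \<in> W \<Longrightarrow> X q = X' q) \<Longrightarrow> smooth_vf_on A W X'"
  by (rule smooth_vf_onI[where h="\<lambda>c. vf_rep A c X"]) (auto intro: smooth_vf_onD)

lemma smooth_fun_const: "open W \<Longrightarrow> smooth_fun_on A W (\<lambda>q. r)"
  by (rule smooth_fun_onI[where h="\<lambda>c x. r"]) (auto intro: smooth_on_const)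

lemma smooth_fun_add: "open W \<Longrightarrow> smooth_fun_on A W u \<Longrightarrow> smooth_fun_on A W u' \<Longrightarrow> smooth_fun_on A W (\<lambda>q. u q + u' q)"
  by (rule smooth_fun_onI[where h="\<lambda>c x. u (inv_chart c x) + u' (inv_chart c x)"])
    (auto intro: smooth_on_add smooth_fun_onD chart_image_open)

lemma smooth_fun_mult: "open W \<Longrightarrow> smooth_fun_on A W u \<Longrightarrow> smooth_fun_on A W u' \<Longrightarrow> smooth_fun_on A W (\<lambda>q. u q * u' q)"
  by (rule smooth_fun_onI[where h="\<lambda>c x. u (inv_chart c x) * u' (inv_chart c x)"])
    (auto intro: smooth_on_mult smooth_fun_onD chart_image_open)

lemma smooth_fun_minus: "open W \<Longrightarrow> smooth_fun_on A W u \<Longrightarrow> smooth_fun_on A W (\<lambda>q. - u q)"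
  using smooth_fun_mult[OF _ smooth_fun_const[of W "-1"], of u] by simp

lemma smooth_fun_diff: "open W \<Longrightarrow> smooth_fun_on A W u \<Longrightarrow> smooth_fun_on A W u' \<Longrightarrow> smooth_fun_on A W (\<lambda>q. u q - u' q)"
  using smooth_fun_add[OF _ _ smooth_fun_minus, of W u u'] by simp

lemma smooth_fun_sum: "open W \<Longrightarrow> (\<And>i. i \<in> I \<Longrightarrow> smooth_fun_on A W (u i)) \<Longrightarrow> smooth_fun_on A W (\<lambda>q. \<Sum>i\<in>I. u i q)"
  by (induction I rule: infinite_finite_induct) (auto intro: smooth_fun_const smooth_fun_add)

lemma smooth_vf_zero: "open W \<Longrightarrow> smooth_vf_on A W (\<lambda>q. 0)"
  by (rule smooth_vf_onI[where h="\<lambda>c x. 0"]) (auto intro: smooth_on_const simp: linear_0[OF to_chart_linear])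

lemma smooth_vf_add: "open W \<Longrightarrow> smooth_vf_on A W X \<Longrightarrow> smooth_vf_on A W Y \<Longrightarrow> smooth_vf_on A W (\<lambda>q. X q + Y q)"
  by (rule smooth_vf_onI[where h="\<lambda>c x. vf_rep A c X x + vf_rep A c Y x"])
    (auto intro: smooth_on_add smooth_vf_onD chart_image_open simp: linear_add[OF to_chart_linear])

lemma smooth_vf_scaleR: "open W \<Longrightarrow> smooth_fun_on A W u \<Longrightarrow> smooth_vf_on A W X \<Longrightarrow> smooth_vf_on A W (\<lambda>q. u q *\<^sub>R X q)"
  by (rule smooth_vf_onI[where h="\<lambda>c x. u (inv_chart c x) *\<^sub>R vf_rep A c X x"])
    (auto intro: smooth_on_scaleR smooth_fun_onD smooth_vf_onD chart_image_open simp: linear_scale[OF to_chart_linear])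

lemma smooth_vf_minus: "open W \<Longrightarrow> smooth_vf_on A W X \<Longrightarrow> smooth_vf_on A W (\<lambda>q. - X q)"
  using smooth_vf_scaleR[OF _ smooth_fun_const[of W "-1"], of X] by simp

lemma smooth_vf_diff: "open W \<Longrightarrow> smooth_vf_on A W X \<Longrightarrow> smooth_vf_on A W Y \<Longrightarrow> smooth_vf_on A W (\<lambda>q. X q - Y q)"
  using smooth_vf_add[OF _ _ smooth_vf_minus, of W X Y] by simp

lemma smooth_vf_sum: "open W \<Longrightarrow> (\<And>i. i \<in> I \<Longrightarrow> smooth_vf_on A W (X i)) \<Longrightarrow> smooth_vf_on A W (\<lambda>q. \<Sum>i\<in>I. X i q)"
  by (induction I rule: infinite_finite_induct) (auto intro: smooth_vf_zero smooth_vf_add)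

section \<open>Directional derivatives\<close>

text \<open>
  Directional derivatives may be computed in any chart around the point, by the chain rule.
\<close>

lemma dir_deriv_eqI:
  assumes "c \<in> A" "p \<in> fst c" "((\<lambda>x. u (inv_chart c x)) has_derivative L) (at (snd c p))"
  shows "dir_deriv A X u p = L (to_chart A c p (X p))"
  using has_derivative_unique[OF derivative_chart_change[OF chart_at(1) assms(1) chart_at(2) assms(2,3)]
    has_frechet_derivative[OF differentiableI[OF derivative_chart_change[OF chart_at(1) assms(1) chart_at(2) assms(2,3)]]]]
  unfolding dir_deriv_def to_chart_jac o_def by metis

lemma dir_deriv_chart:
  assumes "c \<in> A" "open W" "p \<in> fst c" "p \<in> W" "smooth_fun_on A W u"
  shows "dir_deriv A X u p = frechet_derivative (u \<circ> inv_chart c) (at (snd c p)) (to_chart A c p (X p))"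
  by (rule dir_deriv_eqI[OF assms(1,3) smooth_fun_has_derivative[OF assms]])

lemma dir_deriv_smooth:
  assumes "open W" "smooth_vf_on A W X" "smooth_fun_on A W u"
  shows "smooth_fun_on A W (dir_deriv A X u)"
  by (rule smooth_fun_onI[where h="\<lambda>c x. frechet_derivative (u \<circ> inv_chart c) (at x) (vf_rep A c X x)"])
    (use assms in \<open>auto intro!: smooth_on_derivative_apply chart_image_open smooth_vf_onD
      simp: smooth_fun_on_def dir_deriv_chart[of _ W]\<close>)

lemma dir_deriv_cong:
  assumes "open W" "p \<in> W" "smooth_fun_on A W u" "\<And>q. q \<in> W \<Longrightarrow> u q = u' q" "X p = X' p"
  shows "dir_deriv A X u p = dir_deriv A X' u' p"
proof -
  let ?c = "chart_at A p"
  have "((\<lambda>x. u' (inv_chart ?c x)) has_derivative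
     frechet_derivative (u \<circ> inv_chart ?c) (at (snd ?c p))) (at (snd ?c p))"
    by (rule has_derivative_transform_within_open[OF smooth_fun_has_derivative[OF chart_at(1) assms(1) chart_at(2) assms(2,3)]
          chart_image_open[OF chart_at(1) assms(1)]])
      (use assms chart_at in auto)
  from dir_deriv_eqI[OF chart_at this, of X'] show ?thesis
    using dir_deriv_chart[OF chart_at(1) assms(1) chart_at(2) assms(2,3), of X] assms(5) by simp
qed

lemma dir_deriv_const [simp]: "dir_deriv A X (\<lambda>q. r) p = 0"
  using dir_deriv_eqI[OF chart_at, of "\<lambda>q. r" p "\<lambda>v. 0"] by simp

lemma dir_deriv_add:
  assumes "open W" "p \<in> W" "smooth_fun_on A W u" "smooth_fun_on A W u'"
  shows "dir_deriv A X (\<lambda>q. u q + u' q) p = dir_deriv A X u p + dir_deriv A X u' p"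
  using dir_deriv_eqI[OF chart_at has_derivative_add[OF
     smooth_fun_has_derivative[OF chart_at(1) assms(1) chart_at(2) assms(2,3)]
     smooth_fun_has_derivative[OF chart_at(1) assms(1) chart_at(2) assms(2,4)]], of X]
  by (simp add: dir_deriv_chart[OF chart_at(1) assms(1) chart_at(2) assms(2)] assms)

lemma dir_deriv_mult:
  assumes "open W" "p \<in> W" "smooth_fun_on A W u" "smooth_fun_on A W u'"
  shows "dir_deriv A X (\<lambda>q. u q * u' q) p = dir_deriv A X u p * u' p + u p * dir_deriv A X u' p"
  using dir_deriv_eqI[OF chart_at has_derivative_mult[OF
     smooth_fun_has_derivative[OF chart_at(1) assms(1) chart_at(2) assms(2,3)]
     smooth_fun_has_derivative[OF chart_at(1) assms(1) chart_at(2) assms(2,4)]], of X]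
  by (simp add: dir_deriv_chart[OF chart_at(1) assms(1) chart_at(2) assms(2)] assms chart_at)

lemma dir_deriv_cmult:
  assumes "open W" "p \<in> W" "smooth_fun_on A W u"
  shows "dir_deriv A X (\<lambda>q. r * u q) p = r * dir_deriv A X u p"
  using dir_deriv_mult[OF assms(1,2) smooth_fun_const[OF assms(1)] assms(3)] by simp

lemma dir_deriv_minus:
  assumes "open W" "p \<in> W" "smooth_fun_on A W u"
  shows "dir_deriv A X (\<lambda>q. - u q) p = - dir_deriv A X u p"
  using dir_deriv_cmult[OF assms, of X "-1"] by simp

lemma dir_deriv_diff:
  assumes "open W" "p \<in> W" "smooth_fun_on A W u" "smooth_fun_on A W u'"
  shows "dir_deriv A X (\<lambda>q. u q - u' q) p = dir_deriv A X u p - dir_deriv A X u' p"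
  using dir_deriv_add[OF assms(1-3) smooth_fun_minus[OF assms(1,4)]] dir_deriv_minus[OF assms(1,2,4)] by simp

lemma dir_deriv_sum:
  assumes "open W" "p \<in> W" "\<And>i. i \<in> I \<Longrightarrow> smooth_fun_on A W (u i)"
  shows "dir_deriv A X (\<lambda>q. \<Sum>i\<in>I. u i q) p = (\<Sum>i\<in>I. dir_deriv A X (u i) p)"
  using assms(3) by (induction I rule: infinite_finite_induct)
    (auto simp: dir_deriv_add[OF assms(1,2)] smooth_fun_sum[OF assms(1)])

lemma dir_deriv_linear:
  assumes "open W" "p \<in> W" "smooth_fun_on A W u"
  shows "linear (\<lambda>v. dir_deriv A (\<lambda>q. v) u p)"
  using has_derivative_linear[OF smooth_fun_has_derivative[OF chart_at(1) assms(1) chart_at(2) assms(2,3)]]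
  by (simp add: dir_deriv_chart[OF chart_at(1) assms(1) chart_at(2) assms(2,3)])

lemma dir_deriv_pointwise: "dir_deriv A X u p = dir_deriv A (\<lambda>q. X p) u p"
  by (simp add: dir_deriv_def)

lemma dir_deriv_field_add:
  assumes "open W" "p \<in> W" "smooth_fun_on A W u" "Z p = X p + Y p"
  shows "dir_deriv A Z u p = dir_deriv A X u p + dir_deriv A Y u p"
  using linear_add[OF dir_deriv_linear[OF assms(1-3)], of "X p" "Y p"] assms(4)
  by (simp add: dir_deriv_pointwise[of X] dir_deriv_pointwise[of Y] dir_deriv_pointwise[of Z])

lemma dir_deriv_field_scaleR:
  assumes "open W" "p \<in> W" "smooth_fun_on A W u" "Z p = r *\<^sub>R X p"
  shows "dir_deriv A Z u p = r * dir_deriv A X u p"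
  using linear_scale[OF dir_deriv_linear[OF assms(1-3)], of r "X p"] assms(4)
  by (simp add: dir_deriv_pointwise[of X] dir_deriv_pointwise[of Z])

section \<open>Coordinate functions and coordinate fields\<close>

lemma coord_smooth: "c \<in> A \<Longrightarrow> smooth_fun_on A (fst c) (\<lambda>q. snd c q $ i)"
  by (rule smooth_fun_onI[where h="\<lambda>d x. snd c (inv_chart d x) $ i"])
    (auto intro: chart_open chart_image_open smooth_on_linear[OF _ transition_smooth bounded_linear_vec_nth])

lemma coord_deriv:
  assumes "c \<in> A" "p \<in> fst c"
  shows "dir_deriv A X (\<lambda>q. snd c q $ i) p = to_chart A c p (X p) $ i"
proof (rule dir_deriv_eqI[OF assms])
  show "((\<lambda>x. snd c (inv_chart c x) $ i) has_derivative (\<lambda>v. v $ i)) (at (snd c p))"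
    by (rule has_derivative_transform_within_open[OF bounded_linear.has_derivative[OF bounded_linear_vec_nth has_derivative_ident]
          chart_image_open[of c UNIV]]) (use assms in auto)
qed

lemma components_smooth:
  assumes "c \<in> A" "open W" "smooth_vf_on A W X"
  shows "smooth_fun_on A (fst c \<inter> W) (\<lambda>q. to_chart A c q (X q) $ i)"
proof (rule smooth_fun_cong)
  show "open (fst c \<inter> W)" using assms chart_open by (intro open_Int)
  show "smooth_fun_on A (fst c \<inter> W) (dir_deriv A X (\<lambda>q. snd c q $ i))"
    by (intro dir_deriv_smooth \<open>open (fst c \<inter> W)\<close> smooth_vf_on_subset[OF assms(3)] smooth_fun_on_subset[OF coord_smooth[OF assms(1)]]) auto
qed (use assms coord_deriv in auto)

text \<open>
  Smoothness of a field can be tested on its components, which are directional derivatives of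
  coordinate functions. This reduces smoothness of Lie brackets to that of iterated derivatives.
\<close>

lemma smooth_vf_componentsI:
  assumes "open W" "\<And>c i. c \<in> A \<Longrightarrow> smooth_fun_on A (fst c \<inter> W) (\<lambda>q. to_chart A c q (X q) $ i)"
  shows "smooth_vf_on A W X"
proof (rule smooth_vf_onI[OF assms(1), where h="\<lambda>c x. \<Sum>i\<in>UNIV. (to_chart A c (inv_chart c x) (X (inv_chart c x)) $ i) *\<^sub>R axis i 1"])
  fix c assume c: "c \<in> A"
  show "smooth_on (snd c ` (fst c \<inter> W)) (\<lambda>x. \<Sum>i\<in>UNIV. (to_chart A c (inv_chart c x) (X (inv_chart c x)) $ i) *\<^sub>R axis i 1)"
  proof (intro smooth_on_sum smooth_on_scaleR smooth_on_const chart_image_open c assms(1))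
    fix i show "smooth_on (snd c ` (fst c \<inter> W)) (\<lambda>x. to_chart A c (inv_chart c x) (X (inv_chart c x)) $ i)"
      using smooth_fun_onD[OF assms(2)[OF c] c] by simp
  qed
qed (simp add: vec_eq_iff axis_def if_distrib cong: if_cong)

text \<open>
  In another chart \<open>d\<close> the field is a column of the Jacobian of the change of coordinates,
  composed with the inverse change of coordinates.
\<close>

lemma coord_field_smooth:
  assumes "c \<in> A" shows "smooth_vf_on A (fst c) (\<lambda>q. from_chart A c q v)"
proof (rule smooth_vf_onI[OF chart_open[OF assms], where h="\<lambda>d x. frechet_derivative (snd d \<circ> inv_chart c) (at (snd c (inv_chart d x))) v"])
  fix d assume d: "d \<in> A"
  have *: "smooth_on (snd c ` (fst c \<inter> fst d)) (\<lambda>y. frechet_derivative (snd d \<circ> inv_chart c) (at y) v)"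
    using smooth_on_derivative[OF transition_smooth[OF assms d]] by (simp add: o_def)
  show "smooth_on (snd d ` (fst d \<inter> fst c)) (\<lambda>x. frechet_derivative (snd d \<circ> inv_chart c) (at (snd c (inv_chart d x))) v)"
    by (rule smooth_on_compose[OF _ _ _ * transition_smooth[OF d assms]])
      (use d assms in \<open>auto simp: chart_open chart_image_open\<close>)
next
  fix d q assume "d \<in> A" "q \<in> fst d" "q \<in> fst c"
  then show "frechet_derivative (snd d \<circ> inv_chart c) (at (snd c (inv_chart d (snd d q)))) v = to_chart A d q (from_chart A c q v)"
    using assms by (simp add: to_chart_jac from_chart_jac jac_comp chart_at jac_def[of c d, symmetric])
qed

lemma field_expansion:
  assumes "c \<in> A" "q \<in> fst c"
  shows "X q = (\<Sum>i\<in>UNIV. (to_chart A c q (X q) $ i) *\<^sub>R from_chart A c q (axis i 1))"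
  using linear_expansion_vec[OF from_chart_linear[OF assms], of "to_chart A c q (X q)"] assms by simp

section \<open>The Lie bracket\<close>

lemma derivative_along_field_derivative:
  assumes "open S" "x \<in> S" "smooth_on S h" "smooth_on S Y"
  shows "frechet_derivative (\<lambda>y. frechet_derivative h (at y) (Y y)) (at x) w
    = (\<Sum>b\<in>Basis. (Y x \<bullet> b) *\<^sub>R frechet_derivative (\<lambda>y. frechet_derivative h (at y) b) (at x) w)
      + frechet_derivative h (at x) (frechet_derivative Y (at x) w)"
proof -
  have Y: "(Y has_derivative frechet_derivative Y (at x)) (at x)"
    using smooth_on_differentiable[OF assms(4,1,2)] by (rule has_frechet_derivative)
  have h: "((\<lambda>y. frechet_derivative h (at y) b) has_derivative frechet_derivative (\<lambda>y. frechet_derivative h (at y) b) (at x)) (at x)" for b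
    using smooth_on_differentiable[OF smooth_on_derivative[OF assms(3)] assms(1,2)] by (rule has_frechet_derivative)
  have ex: "frechet_derivative h (at y) v = (\<Sum>b\<in>Basis. (v \<bullet> b) *\<^sub>R frechet_derivative h (at y) b)" if "y \<in> S" for y v
    by (rule linear_expansion[OF linear_frechet_derivative[OF smooth_on_differentiable[OF assms(3,1) that]]])
  have *: "((\<lambda>y. \<Sum>b\<in>Basis. (Y y \<bullet> b) *\<^sub>R frechet_derivative h (at y) b) has_derivative
     (\<lambda>w. \<Sum>b\<in>Basis. (Y x \<bullet> b) *\<^sub>R frechet_derivative (\<lambda>y. frechet_derivative h (at y) b) (at x) w
        + (frechet_derivative Y (at x) w \<bullet> b) *\<^sub>R frechet_derivative h (at x) b)) (at x)"
    by (intro has_derivative_sum has_derivative_scaleR h has_derivative_inner_left Y)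
  have **: "((\<lambda>y. frechet_derivative h (at y) (Y y)) has_derivative
     (\<lambda>w. \<Sum>b\<in>Basis. (Y x \<bullet> b) *\<^sub>R frechet_derivative (\<lambda>y. frechet_derivative h (at y) b) (at x) w
        + (frechet_derivative Y (at x) w \<bullet> b) *\<^sub>R frechet_derivative h (at x) b)) (at x)"
    by (rule has_derivative_transform_within_open[OF * assms(1,2)]) (rule ex[symmetric])
  show ?thesis
    unfolding frechet_derivative_at[OF **, symmetric] by (simp add: sum.distrib ex[OF assms(2), symmetric])
qed

lemma second_derivative_symmetric_sum:
  fixes h :: "'e::euclidean_space \<Rightarrow> real"
  assumes "open S" "x \<in> S" "smooth_on S h"
  shows "(\<Sum>b\<in>Basis. (v \<bullet> b) *\<^sub>R frechet_derivative (\<lambda>y. frechet_derivative h (at y) b) (at x) w)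
       = (\<Sum>b\<in>Basis. (w \<bullet> b) *\<^sub>R frechet_derivative (\<lambda>y. frechet_derivative h (at y) b) (at x) v)"
proof -
  have h: "linear (frechet_derivative (\<lambda>y. frechet_derivative h (at y) b) (at x))" for b
    using smooth_on_differentiable[OF smooth_on_derivative[OF assms(3)] assms(1,2)] by (rule linear_frechet_derivative)
  have "(\<Sum>b\<in>Basis. (v \<bullet> b) *\<^sub>R frechet_derivative (\<lambda>y. frechet_derivative h (at y) b) (at x) w)
    = (\<Sum>b\<in>Basis. (v \<bullet> b) *\<^sub>R frechet_derivative (\<lambda>y. frechet_derivative h (at y) w) (at x) b)"
    by (simp add: second_derivative_symmetric[OF assms(1,3,2), of w])
  also have "\<dots> = frechet_derivative (\<lambda>y. frechet_derivative h (at y) w) (at x) v"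
    by (rule linear_expansion[OF h, symmetric])
  also have "\<dots> = frechet_derivative (\<lambda>y. frechet_derivative h (at y) v) (at x) w"
    by (rule second_derivative_symmetric[OF assms(1,3,2)])
  also have "\<dots> = (\<Sum>b\<in>Basis. (w \<bullet> b) *\<^sub>R frechet_derivative (\<lambda>y. frechet_derivative h (at y) v) (at x) b)"
    by (rule linear_expansion[OF h])
  also have "\<dots> = (\<Sum>b\<in>Basis. (w \<bullet> b) *\<^sub>R frechet_derivative (\<lambda>y. frechet_derivative h (at y) b) (at x) v)"
    by (simp add: second_derivative_symmetric[OF assms(1,3,2), of v])
  finally show ?thesis .
qed

text \<open>
  The second derivatives of \<open>u\<close> cancel by symmetry, and what is left of the product rule is the
  coordinate formula of the bracket. Locality, additivity, the Leibniz rule and the Jacobi identity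
  of the bracket are derived from this one, since a tangent vector is determined by the derivatives of functions along it.
\<close>

lemma dir_deriv_commutator:
  assumes W: "open W" "p \<in> W" and X: "smooth_vf_on A W X" and Y: "smooth_vf_on A W Y" and u: "smooth_fun_on A W u"
  shows "dir_deriv A X (dir_deriv A Y u) p - dir_deriv A Y (dir_deriv A X u) p = dir_deriv A (lie_bracket A X Y) u p"
proof -
  define c where "c = chart_at A p"
  have c: "c \<in> A" "p \<in> fst c" unfolding c_def by (rule chart_at)+
  define S where "S = snd c ` (fst c \<inter> W)"
  define h where "h = u \<circ> inv_chart c"
  have S: "open S" "snd c p \<in> S" unfolding S_def using chart_image_open c W by auto
  have h: "smooth_on S h" using u c unfolding h_def S_def smooth_fun_on_def by auto
  have lin: "linear (frechet_derivative h (at (snd c p)))"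
    by (rule linear_frechet_derivative[OF smooth_on_differentiable[OF h S]])
  have tc: "to_chart A c p v = v" for v unfolding c_def by simp
  have dd: "dir_deriv A X (dir_deriv A Y u) p =
      (\<Sum>b\<in>Basis. (Y p \<bullet> b) *\<^sub>R frechet_derivative (\<lambda>y. frechet_derivative h (at y) b) (at (snd c p)) (X p))
      + frechet_derivative h (at (snd c p)) (frechet_derivative (vf_rep A c Y) (at (snd c p)) (X p))"
    if "smooth_vf_on A W X" "smooth_vf_on A W Y" for X Y
  proof -
    have Ys: "smooth_on S (vf_rep A c Y)" using that(2) c unfolding S_def smooth_vf_on_def by auto
    have s: "smooth_on S (\<lambda>x. frechet_derivative h (at x) (vf_rep A c Y x))"
      by (rule smooth_on_derivative_apply[OF S(1) h Ys])
    have eq: "frechet_derivative h (at x) (vf_rep A c Y x) = dir_deriv A Y u (inv_chart c x)" if "x \<in> S" for x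
      using that c W u by (auto simp: S_def h_def dir_deriv_chart[of c W])
    have d: "((\<lambda>x. dir_deriv A Y u (inv_chart c x)) has_derivative
      frechet_derivative (\<lambda>x. frechet_derivative h (at x) (vf_rep A c Y x)) (at (snd c p))) (at (snd c p))"
      by (rule has_derivative_transform_within_open[OF has_frechet_derivative[OF smooth_on_differentiable[OF s S]] S eq])
    have "dir_deriv A X (dir_deriv A Y u) p = frechet_derivative (\<lambda>x. frechet_derivative h (at x) (vf_rep A c Y x)) (at (snd c p)) (X p)"
      using dir_deriv_eqI[OF c d, of X] by (simp add: tc)
    also have "\<dots> = (\<Sum>b\<in>Basis. (vf_rep A c Y (snd c p) \<bullet> b) *\<^sub>R frechet_derivative (\<lambda>y. frechet_derivative h (at y) b) (at (snd c p)) (X p))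
      + frechet_derivative h (at (snd c p)) (frechet_derivative (vf_rep A c Y) (at (snd c p)) (X p))"
      by (rule derivative_along_field_derivative[OF S h Ys])
    finally show ?thesis using c by (simp add: tc)
  qed
  have "dir_deriv A (lie_bracket A X Y) u p = frechet_derivative h (at (snd c p)) (lie_bracket A X Y p)"
    using dir_deriv_chart[OF c(1) W(1) c(2) W(2) u] by (simp add: tc h_def)
  moreover have "lie_bracket A X Y p = frechet_derivative (vf_rep A c Y) (at (snd c p)) (X p)
      - frechet_derivative (vf_rep A c X) (at (snd c p)) (Y p)"
    by (simp add: lie_bracket_def c_def Let_def)
  ultimately show ?thesis
    using dd[OF X Y] dd[OF Y X] second_derivative_symmetric_sum[OF S h, of "X p" "Y p"]
    by (simp add: linear_diff[OF lin])
qed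

lemma lie_bracket_smooth:
  assumes W: "open W" and X: "smooth_vf_on A W X" and Y: "smooth_vf_on A W Y"
  shows "smooth_vf_on A W (lie_bracket A X Y)"
proof (rule smooth_vf_componentsI[OF W])
  fix c i assume c: "c \<in> A"
  let ?O = "fst c \<inter> W" and ?u = "\<lambda>q. snd c q $ i"
  have O: "open ?O" using c W chart_open by (intro open_Int)
  have XY: "smooth_vf_on A ?O X" "smooth_vf_on A ?O Y" using X Y by (auto intro: smooth_vf_on_subset)
  have u: "smooth_fun_on A ?O ?u" using coord_smooth[OF c] by (rule smooth_fun_on_subset) auto
  show "smooth_fun_on A ?O (\<lambda>q. to_chart A c q (lie_bracket A X Y q) $ i)"
  proof (rule smooth_fun_cong[OF O])
    show "smooth_fun_on A ?O (\<lambda>q. dir_deriv A X (dir_deriv A Y ?u) q - dir_deriv A Y (dir_deriv A X ?u) q)"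
      using O XY u by (intro smooth_fun_diff dir_deriv_smooth)
    show "dir_deriv A X (dir_deriv A Y ?u) q - dir_deriv A Y (dir_deriv A X ?u) q = to_chart A c q (lie_bracket A X Y q) $ i" if "q \<in> ?O" for q
      using dir_deriv_commutator[OF O that XY u] coord_deriv[OF c, of q] that by auto
  qed
qed

text \<open>
  The coordinate functions of a chart already separate tangent vectors. They are defined on the
  domain of the chart only, whence the smaller open sets \<open>W'\<close>.
\<close>

lemma tangent_vector_eqI:
  assumes "p \<in> W" "open W" 
    and "\<And>u W'. open W' \<Longrightarrow> p \<in> W' \<Longrightarrow> W' \<subseteq> W \<Longrightarrow> smooth_fun_on A W' u \<Longrightarrow> dir_deriv A X u p = dir_deriv A Y u p"
  shows "X p = Y p"
proof -
  let ?c = "chart_at A p"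
  have "X p $ i = Y p $ i" for i
    using assms(3)[of "fst ?c \<inter> W" "\<lambda>q. snd ?c q $ i"] coord_deriv[OF chart_at, of X p i] coord_deriv[OF chart_at, of Y p i]
      assms(1,2) chart_open[OF chart_at(1)] smooth_fun_on_subset[OF coord_smooth[OF chart_at(1)]] chart_at
    by (simp add: open_Int)
  then show ?thesis by (simp add: vec_eq_iff)
qed

lemma lie_bracket_antisym: "lie_bracket A X Y p = - lie_bracket A Y X p"
  by (simp add: lie_bracket_def Let_def)

lemma lie_bracket_cong:
  assumes W: "open W" "p \<in> W" and X: "smooth_vf_on A W X" and Y: "smooth_vf_on A W Y"
    and eq: "\<And>q. q \<in> W \<Longrightarrow> X q = X' q" "\<And>q. q \<in> W \<Longrightarrow> Y q = Y' q"
  shows "lie_bracket A X Y p = lie_bracket A X' Y' p"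
proof (rule tangent_vector_eqI[OF W(2,1)])
  fix u W' assume W': "open W'" "p \<in> W'" "W' \<subseteq> W" and u: "smooth_fun_on A W' u"
  have s: "smooth_vf_on A W' X" "smooth_vf_on A W' Y" "smooth_vf_on A W' X'" "smooth_vf_on A W' Y'"
    using X Y smooth_vf_cong[OF W(1) X eq(1)] smooth_vf_cong[OF W(1) Y eq(2)] W'(3) smooth_vf_on_subset by blast+
  have "dir_deriv A X (dir_deriv A Y u) p = dir_deriv A X' (dir_deriv A Y' u) p"
    by (rule dir_deriv_cong[OF W'(1,2) dir_deriv_smooth[OF W'(1) s(2) u]])
       (use W' W eq in \<open>auto intro!: dir_deriv_cong[OF W'(1) _ u]\<close>)
  moreover have "dir_deriv A Y (dir_deriv A X u) p = dir_deriv A Y' (dir_deriv A X' u) p"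
    by (rule dir_deriv_cong[OF W'(1,2) dir_deriv_smooth[OF W'(1) s(1) u]])
       (use W' W eq in \<open>auto intro!: dir_deriv_cong[OF W'(1) _ u]\<close>)
  ultimately show "dir_deriv A (lie_bracket A X Y) u p = dir_deriv A (lie_bracket A X' Y') u p"
    using dir_deriv_commutator[OF W'(1,2) s(1,2) u] dir_deriv_commutator[OF W'(1,2) s(3,4) u] by simp
qed

lemma lie_bracket_add_right:
  assumes W: "open W" "p \<in> W" and X: "smooth_vf_on A W X" and Y: "smooth_vf_on A W Y" and Z: "smooth_vf_on A W Z"
  shows "lie_bracket A X (\<lambda>q. Y q + Z q) p = lie_bracket A X Y p + lie_bracket A X Z p"
proof (rule tangent_vector_eqI[OF W(2,1), where Y="\<lambda>q. lie_bracket A X Y q + lie_bracket A X Z q"])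
  fix u W' assume W': "open W'" "p \<in> W'" "W' \<subseteq> W" and u: "smooth_fun_on A W' u"
  let ?YZ = "\<lambda>q. Y q + Z q"
  have s: "smooth_vf_on A W' X" "smooth_vf_on A W' Y" "smooth_vf_on A W' Z"
    using X Y Z W'(3) smooth_vf_on_subset by blast+
  have YZ: "smooth_vf_on A W' ?YZ" using W' s by (intro smooth_vf_add)
  note ds = dir_deriv_smooth[OF W'(1)]
  have "dir_deriv A X (dir_deriv A ?YZ u) p = dir_deriv A X (\<lambda>q. dir_deriv A Y u q + dir_deriv A Z u q) p"
    by (rule dir_deriv_cong[OF W'(1,2) ds[OF YZ u]]) (auto intro!: dir_deriv_field_add[OF W'(1) _ u])
  also have "\<dots> = dir_deriv A X (dir_deriv A Y u) p + dir_deriv A X (dir_deriv A Z u) p"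
    by (rule dir_deriv_add[OF W'(1,2) ds[OF s(2) u] ds[OF s(3) u]])
  finally have 1: "dir_deriv A X (dir_deriv A ?YZ u) p = \<dots>" .
  have 2: "dir_deriv A ?YZ (dir_deriv A X u) p = dir_deriv A Y (dir_deriv A X u) p + dir_deriv A Z (dir_deriv A X u) p"
    by (rule dir_deriv_field_add[OF W'(1,2) ds[OF s(1) u]]) simp
  have 3: "dir_deriv A (\<lambda>q. lie_bracket A X Y q + lie_bracket A X Z q) u p
      = dir_deriv A (lie_bracket A X Y) u p + dir_deriv A (lie_bracket A X Z) u p"
    by (rule dir_deriv_field_add[OF W'(1,2) u]) simp
  show "dir_deriv A (lie_bracket A X ?YZ) u p = dir_deriv A (\<lambda>q. lie_bracket A X Y q + lie_bracket A X Z q) u p"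
    using 1 2 3 dir_deriv_commutator[OF W'(1,2) s(1) YZ u] dir_deriv_commutator[OF W'(1,2) s(1,2) u]
      dir_deriv_commutator[OF W'(1,2) s(1,3) u] by simp
qed

lemma lie_bracket_scaleR_right:
  assumes W: "open W" "p \<in> W" and X: "smooth_vf_on A W X" and Y: "smooth_vf_on A W Y" and w: "smooth_fun_on A W w"
  shows "lie_bracket A X (\<lambda>q. w q *\<^sub>R Y q) p = dir_deriv A X w p *\<^sub>R Y p + w p *\<^sub>R lie_bracket A X Y p"
proof (rule tangent_vector_eqI[OF W(2,1), where Y="\<lambda>q. dir_deriv A X w q *\<^sub>R Y q + w q *\<^sub>R lie_bracket A X Y q"])
  fix u W' assume W': "open W'" "p \<in> W'" "W' \<subseteq> W" and u: "smooth_fun_on A W' u"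
  let ?wY = "\<lambda>q. w q *\<^sub>R Y q"
  have s: "smooth_vf_on A W' X" "smooth_vf_on A W' Y" and w': "smooth_fun_on A W' w"
    using X Y w W'(3) smooth_vf_on_subset smooth_fun_on_subset by blast+
  have wY: "smooth_vf_on A W' ?wY" using W' s w' by (intro smooth_vf_scaleR)
  note ds = dir_deriv_smooth[OF W'(1)]
  have "dir_deriv A X (dir_deriv A ?wY u) p = dir_deriv A X (\<lambda>q. w q * dir_deriv A Y u q) p"
    by (rule dir_deriv_cong[OF W'(1,2) ds[OF wY u]]) (auto intro!: dir_deriv_field_scaleR[OF W'(1) _ u])
  also have "\<dots> = dir_deriv A X w p * dir_deriv A Y u p + w p * dir_deriv A X (dir_deriv A Y u) p"
    by (rule dir_deriv_mult[OF W'(1,2) w' ds[OF s(2) u]])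
  finally have 1: "dir_deriv A X (dir_deriv A ?wY u) p = \<dots>" .
  have 2: "dir_deriv A ?wY (dir_deriv A X u) p = w p * dir_deriv A Y (dir_deriv A X u) p"
    by (rule dir_deriv_field_scaleR[OF W'(1,2) ds[OF s(1) u]]) simp
  have 3: "dir_deriv A (\<lambda>q. dir_deriv A X w q *\<^sub>R Y q + w q *\<^sub>R lie_bracket A X Y q) u p
      = dir_deriv A (\<lambda>q. dir_deriv A X w q *\<^sub>R Y q) u p + dir_deriv A (\<lambda>q. w q *\<^sub>R lie_bracket A X Y q) u p"
    by (rule dir_deriv_field_add[OF W'(1,2) u]) simp
  have 4: "dir_deriv A (\<lambda>q. dir_deriv A X w q *\<^sub>R Y q) u p = dir_deriv A X w p * dir_deriv A Y u p"
    "dir_deriv A (\<lambda>q. w q *\<^sub>R lie_bracket A X Y q) u p = w p * dir_deriv A (lie_bracket A X Y) u p"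
    by (rule dir_deriv_field_scaleR[OF W'(1,2) u]; simp)+
  show "dir_deriv A (lie_bracket A X ?wY) u p = dir_deriv A (\<lambda>q. dir_deriv A X w q *\<^sub>R Y q + w q *\<^sub>R lie_bracket A X Y q) u p"
    using 1 2 3 4 dir_deriv_commutator[OF W'(1,2) s(1) wY u]
    by (simp add: algebra_simps dir_deriv_commutator[OF W'(1,2) s(1,2) u, symmetric])
qed

text \<open>
  Acting on functions, both sides are the same combination of third derivatives.
\<close>

lemma jacobi:
  assumes W: "open W" "p \<in> W" and X: "smooth_vf_on A W X" and Y: "smooth_vf_on A W Y" and Z: "smooth_vf_on A W Z"
  shows "lie_bracket A X (lie_bracket A Y Z) p = lie_bracket A (lie_bracket A X Y) Z p + lie_bracket A Y (lie_bracket A X Z) p"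
proof (rule tangent_vector_eqI[OF W(2,1), where Y="\<lambda>q. lie_bracket A (lie_bracket A X Y) Z q + lie_bracket A Y (lie_bracket A X Z) q"])
  fix u W' assume W': "open W'" "p \<in> W'" "W' \<subseteq> W" and u: "smooth_fun_on A W' u"
  have s: "smooth_vf_on A W' X" "smooth_vf_on A W' Y" "smooth_vf_on A W' Z"
    using X Y Z W'(3) smooth_vf_on_subset by blast+
  note ds = dir_deriv_smooth[OF W'(1)] and bs = lie_bracket_smooth[OF W'(1)] and com = dir_deriv_commutator[OF W'(1)]
  have exp: "dir_deriv A P (dir_deriv A (lie_bracket A Q R) u) p
      = dir_deriv A P (dir_deriv A Q (dir_deriv A R u)) p - dir_deriv A P (dir_deriv A R (dir_deriv A Q u)) p"
    if "smooth_vf_on A W' P" "smooth_vf_on A W' Q" "smooth_vf_on A W' R" for P Q R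
    using dir_deriv_cong[OF W'(1,2) ds[OF bs[OF that(2,3)] u], of "\<lambda>q. dir_deriv A Q (dir_deriv A R u) q - dir_deriv A R (dir_deriv A Q u) q" P P]
      com[OF _ that(2,3) u] dir_deriv_diff[OF W'(1,2) ds[OF that(2) ds[OF that(3) u]] ds[OF that(3) ds[OF that(2) u]]] by simp
  have "dir_deriv A (\<lambda>q. lie_bracket A (lie_bracket A X Y) Z q + lie_bracket A Y (lie_bracket A X Z) q) u p
     = dir_deriv A (lie_bracket A (lie_bracket A X Y) Z) u p + dir_deriv A (lie_bracket A Y (lie_bracket A X Z)) u p"
    by (rule dir_deriv_field_add[OF W'(1,2) u]) simp
  then show "dir_deriv A (lie_bracket A X (lie_bracket A Y Z)) u p
    = dir_deriv A (\<lambda>q. lie_bracket A (lie_bracket A X Y) Z q + lie_bracket A Y (lie_bracket A X Z) q) u p"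
    using com[OF W'(2) s(1) bs[OF s(2,3)] u] com[OF W'(2) bs[OF s(1,2)] s(3) u] com[OF W'(2) s(2) bs[OF s(1,3)] u]
      com[OF W'(2) s(2,3) ds[OF s(1) u]] com[OF W'(2) s(1,2) ds[OF s(3) u]] com[OF W'(2) s(1,3) ds[OF s(2) u]]
      exp[OF s(1,2,3)] exp[OF s(3,1,2)] exp[OF s(2,1,3)] by simp
qed

section \<open>Tensoriality\<close>

lemma frame_near_point:
  assumes "c \<in> A" "p \<in> fst c" "open W" "p \<in> W" "smooth_vf_on A W X"
  shows "open (fst c \<inter> W)" "p \<in> fst c \<inter> W"
    "\<And>i. smooth_fun_on A (fst c \<inter> W) (\<lambda>q. to_chart A c q (X q) $ i)"
    "\<And>i. smooth_vf_on A (fst c \<inter> W) (\<lambda>q. from_chart A c q (axis i 1))"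
proof -
  show "open (fst c \<inter> W)" using assms chart_open by (intro open_Int)
  show "p \<in> fst c \<inter> W" using assms by auto
  show "smooth_fun_on A (fst c \<inter> W) (\<lambda>q. to_chart A c q (X q) $ i)" for i
    using components_smooth assms by blast
  show "smooth_vf_on A (fst c \<inter> W) (\<lambda>q. from_chart A c q (axis i 1))" for i
    using smooth_vf_on_subset[OF coord_field_smooth[OF assms(1)]] by blast
qed

text \<open>
  Expand the field in a coordinate frame around \<open>p\<close>: an operator that is additive, homogeneous
  over functions and local sees only the coefficients at \<open>p\<close>.
\<close>

lemma tensorial:
  fixes F :: "('a \<Rightarrow> real ^ 'n) \<Rightarrow> real ^ 'n"
  assumes W: "open W" "p \<in> W"
    and add: "\<And>W' X Y. \<lbrakk>open W'; p \<in> W'; W' \<subseteq> W; smooth_vf_on A W' X; smooth_vf_on A W' Y\<rbrakk>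
       \<Longrightarrow> F (\<lambda>q. X q + Y q) = F X + F Y"
    and scaleR: "\<And>W' u X. \<lbrakk>open W'; p \<in> W'; W' \<subseteq> W; smooth_fun_on A W' u; smooth_vf_on A W' X\<rbrakk>
       \<Longrightarrow> F (\<lambda>q. u q *\<^sub>R X q) = u p *\<^sub>R F X"
    and cong: "\<And>W' X Y. \<lbrakk>open W'; p \<in> W'; W' \<subseteq> W; smooth_vf_on A W' X; \<And>q. q \<in> W' \<Longrightarrow> X q = Y q\<rbrakk>
       \<Longrightarrow> F X = F Y"
    and X: "smooth_vf_on A W X" and X': "smooth_vf_on A W X'" and eq: "X p = X' p"
  shows "F X = F X'"
proof -
  let ?c = "chart_at A p"
  let ?E = "\<lambda>i q. from_chart A ?c q (axis i 1)"
  have *: "F X = (\<Sum>i\<in>UNIV. (X p $ i) *\<^sub>R F (?E i))" if X: "smooth_vf_on A W X" for X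
  proof -
    note n = frame_near_point[OF chart_at W X]
    let ?O = "fst ?c \<inter> W"
    have sm: "smooth_vf_on A ?O (\<lambda>q. (to_chart A ?c q (X q) $ i) *\<^sub>R ?E i q)" for i
      by (intro smooth_vf_scaleR n)
    have fs: "F (\<lambda>q. \<Sum>i\<in>I. (to_chart A ?c q (X q) $ i) *\<^sub>R ?E i q) = (\<Sum>i\<in>I. (X p $ i) *\<^sub>R F (?E i))" if "finite I" for I
      using that
    proof (induction I rule: finite_induct)
      case empty
      show ?case using scaleR[OF n(1,2) _ smooth_fun_const[OF n(1)] X[THEN smooth_vf_on_subset], of 0] by simp
    next
      case (insert i I)
      have "F (\<lambda>q. (to_chart A ?c q (X q) $ i) *\<^sub>R ?E i q + (\<Sum>i\<in>I. (to_chart A ?c q (X q) $ i) *\<^sub>R ?E i q))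
         = F (\<lambda>q. (to_chart A ?c q (X q) $ i) *\<^sub>R ?E i q) + F (\<lambda>q. \<Sum>i\<in>I. (to_chart A ?c q (X q) $ i) *\<^sub>R ?E i q)"
        by (rule add[OF n(1,2) _ sm smooth_vf_sum[OF n(1) sm]]) auto
      moreover have "F (\<lambda>q. (to_chart A ?c q (X q) $ i) *\<^sub>R ?E i q) = (X p $ i) *\<^sub>R F (?E i)"
        using scaleR[OF n(1,2) _ n(3,4)] by simp
      ultimately show ?case using insert by simp
    qed
    have ex: "X q = (\<Sum>i\<in>UNIV. (to_chart A ?c q (X q) $ i) *\<^sub>R ?E i q)" if "q \<in> ?O" for q
      by (rule field_expansion[OF chart_at(1)]) (use that in auto)
    have "F X = F (\<lambda>q. \<Sum>i\<in>UNIV. (to_chart A ?c q (X q) $ i) *\<^sub>R ?E i q)"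
      by (rule cong[OF n(1,2) Int_lower2 smooth_vf_on_subset[OF X Int_lower2] ex])
    also have "\<dots> = (\<Sum>i\<in>UNIV. (X p $ i) *\<^sub>R F (?E i))" by (rule fs) simp
    finally show ?thesis .
  qed
  show ?thesis using *[OF X] *[OF X'] eq by simp
qed

end

section \<open>The Levi-Civita connection\<close>

locale riemannian = manifold A
  for A :: "('a::{t2_space, second_countable_topology}, 'n::finite) atlas" +
  fixes g :: "'a \<Rightarrow> real ^ 'n \<Rightarrow> real ^ 'n \<Rightarrow> real"
    and D :: "('a \<Rightarrow> real ^ 'n) \<Rightarrow> ('a \<Rightarrow> real ^ 'n) \<Rightarrow> 'a \<Rightarrow> real ^ 'n"
  assumes metric: "riemannian_metric A g" and levi_civita: "levi_civita A g D"
begin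

lemma connection: "affine_connection A D" using levi_civita by (simp add: levi_civita_def)

lemma metric_smooth: 
  "open W \<Longrightarrow> smooth_vf_on A W X \<Longrightarrow> smooth_vf_on A W Y \<Longrightarrow> smooth_fun_on A W (\<lambda>q. g q (X q) (Y q))"
  using metric by (simp add: riemannian_metric_def)

lemma metric_bilinear: "bilinear (g p)" using metric by (simp add: riemannian_metric_def)
lemma metric_sym: "g p v w = g p w v" using metric by (simp add: riemannian_metric_def)
lemma metric_pos: "v \<noteq> 0 \<Longrightarrow> 0 < g p v v" using metric by (simp add: riemannian_metric_def)

lemmas metric_simps = bilinear_ladd[OF metric_bilinear] bilinear_radd[OF metric_bilinear]
  bilinear_lmul[OF metric_bilinear] bilinear_rmul[OF metric_bilinear]
  bilinear_lsub[OF metric_bilinear] bilinear_rsub[OF metric_bilinear]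
  bilinear_lneg[OF metric_bilinear] bilinear_rneg[OF metric_bilinear]
  bilinear_lzero[OF metric_bilinear] bilinear_rzero[OF metric_bilinear]

lemma nabla_smooth: "open W \<Longrightarrow> smooth_vf_on A W X \<Longrightarrow> smooth_vf_on A W Y \<Longrightarrow> smooth_vf_on A W (D X Y)"
  using connection by (simp add: affine_connection_def)

lemma nabla_add_left:
  "open W \<Longrightarrow> p \<in> W \<Longrightarrow> smooth_vf_on A W X \<Longrightarrow> smooth_vf_on A W X' \<Longrightarrow> smooth_vf_on A W Y \<Longrightarrow>
    D (\<lambda>q. X q + X' q) Y p = D X Y p + D X' Y p"
  using connection by (simp add: affine_connection_def)

lemma nabla_scaleR_left:
  "open W \<Longrightarrow> p \<in> W \<Longrightarrow> smooth_fun_on A W u \<Longrightarrow> smooth_vf_on A W X \<Longrightarrow> smooth_vf_on A W Y \<Longrightarrow>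
    D (\<lambda>q. u q *\<^sub>R X q) Y p = u p *\<^sub>R D X Y p"
  using connection by (simp add: affine_connection_def)

lemma nabla_add_right:
  "open W \<Longrightarrow> p \<in> W \<Longrightarrow> smooth_vf_on A W X \<Longrightarrow> smooth_vf_on A W Y \<Longrightarrow> smooth_vf_on A W Y' \<Longrightarrow>
    D X (\<lambda>q. Y q + Y' q) p = D X Y p + D X Y' p"
  using connection by (simp add: affine_connection_def)

lemma nabla_leibniz:
  "open W \<Longrightarrow> p \<in> W \<Longrightarrow> smooth_fun_on A W u \<Longrightarrow> smooth_vf_on A W X \<Longrightarrow> smooth_vf_on A W Y \<Longrightarrow>
    D X (\<lambda>q. u q *\<^sub>R Y q) p = dir_deriv A X u p *\<^sub>R Y p + u p *\<^sub>R D X Y p"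
  using connection by (simp add: affine_connection_def)

lemma torsion_free:
  "open W \<Longrightarrow> p \<in> W \<Longrightarrow> smooth_vf_on A W X \<Longrightarrow> smooth_vf_on A W Y \<Longrightarrow>
    lie_bracket A X Y p = D X Y p - D Y X p"
  using levi_civita by (simp add: levi_civita_def)

lemma metric_compatible:
  "open W \<Longrightarrow> p \<in> W \<Longrightarrow> smooth_vf_on A W X \<Longrightarrow> smooth_vf_on A W Y \<Longrightarrow> smooth_vf_on A W Z \<Longrightarrow>
    dir_deriv A X (\<lambda>q. g q (Y q) (Z q)) p = g p (D X Y p) (Z p) + g p (Y p) (D X Z p)"
  using levi_civita by (simp add: levi_civita_def)

text \<open>
  Locality. The indicator function of \<open>W\<close> is smooth on \<open>W\<close> with vanishing derivative there, and
  multiplying by it makes fields that agree on \<open>W\<close> equal everywhere.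
\<close>

lemma nabla_cong:
  assumes W: "open W" "p \<in> W" and X: "smooth_vf_on A W X" and Y: "smooth_vf_on A W Y"
    and eq: "\<And>q. q \<in> W \<Longrightarrow> X q = X' q" "\<And>q. q \<in> W \<Longrightarrow> Y q = Y' q"
  shows "D X Y p = D X' Y' p"
proof -
  define u :: "'a \<Rightarrow> real" where "u = (\<lambda>q. if q \<in> W then 1 else 0)"
  have u: "smooth_fun_on A W u" by (rule smooth_fun_cong[OF W(1) smooth_fun_const[OF W(1), of 1]]) (simp add: u_def)
  have du: "dir_deriv A Z u p = 0" for Z
    using dir_deriv_cong[OF W u, of "\<lambda>q. 1" Z Z] by (simp add: u_def)
  have X': "smooth_vf_on A W X'" by (rule smooth_vf_cong[OF W(1) X eq(1)])
  have Y': "smooth_vf_on A W Y'" by (rule smooth_vf_cong[OF W(1) Y eq(2)])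
  have up: "u p = 1" using W by (simp add: u_def)
  have "(\<lambda>q. u q *\<^sub>R X q) = (\<lambda>q. u q *\<^sub>R X' q)" "(\<lambda>q. u q *\<^sub>R Y q) = (\<lambda>q. u q *\<^sub>R Y' q)"
    using eq by (auto simp: u_def)
  then have "D X Y p = D X' Y p" "D X' Y p = D X' Y' p"
    using nabla_scaleR_left[OF W u X Y] nabla_scaleR_left[OF W u X' Y]
      nabla_leibniz[OF W u X' Y] nabla_leibniz[OF W u X' Y'] by (simp_all add: up du)
  then show ?thesis by simp
qed

lemma nabla_minus_left:
  "open W \<Longrightarrow> p \<in> W \<Longrightarrow> smooth_vf_on A W X \<Longrightarrow> smooth_vf_on A W Y \<Longrightarrow> D (\<lambda>q. - X q) Y p = - D X Y p"
  using nabla_scaleR_left[OF _ _ smooth_fun_const, of W p X Y "-1"] by simp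

lemma nabla_diff_left:
  "open W \<Longrightarrow> p \<in> W \<Longrightarrow> smooth_vf_on A W X \<Longrightarrow> smooth_vf_on A W X' \<Longrightarrow> smooth_vf_on A W Y \<Longrightarrow>
    D (\<lambda>q. X q - X' q) Y p = D X Y p - D X' Y p"
  using nabla_add_left[OF _ _ _ smooth_vf_minus, of W p X X' Y] by (simp add: nabla_minus_left[of W])

lemma nabla_zero_right: "D X (\<lambda>q. 0) p = 0" if "smooth_vf_on A W X" "open W" "p \<in> W"
  using nabla_leibniz[OF that(2,3) smooth_fun_const[OF that(2)] that(1) that(1), of 0] by simp

section \<open>Curvature\<close>

lemma curvature_smooth:
  assumes "open W" "smooth_vf_on A W X" "smooth_vf_on A W Y" "smooth_vf_on A W Z"
  shows "smooth_vf_on A W (curvature A D X Y Z)"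
proof -
  have "curvature A D X Y Z = (\<lambda>p. D X (D Y Z) p - D Y (D X Z) p - D (lie_bracket A X Y) Z p)"
    by (simp add: fun_eq_iff curvature_def)
  then show ?thesis using assms by (simp add: smooth_vf_diff nabla_smooth lie_bracket_smooth)
qed

lemma curvature_antisym:
  assumes "open W" "p \<in> W" "smooth_vf_on A W X" "smooth_vf_on A W Y" "smooth_vf_on A W Z"
  shows "curvature A D X Y Z p = - curvature A D Y X Z p"
proof -
  have "lie_bracket A X Y = (\<lambda>q. - lie_bracket A Y X q)"
    by (rule ext) (rule lie_bracket_antisym)
  then show ?thesis using assms
    by (simp add: curvature_def nabla_minus_left[of W] lie_bracket_smooth)
qed

lemma curvature_cong:
  assumes W: "open W" "p \<in> W" and s: "smooth_vf_on A W X" "smooth_vf_on A W Y" "smooth_vf_on A W Z"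
    and eq: "\<And>q. q \<in> W \<Longrightarrow> X q = X' q" "\<And>q. q \<in> W \<Longrightarrow> Y q = Y' q" "\<And>q. q \<in> W \<Longrightarrow> Z q = Z' q"
  shows "curvature A D X Y Z p = curvature A D X' Y' Z' p"
proof -
  note nc = nabla_cong[OF W(1)]
  have "D X (D Y Z) p = D X' (D Y' Z') p"
    by (rule nc) (use W s eq in \<open>auto intro: nc nabla_smooth\<close>)
  moreover have "D Y (D X Z) p = D Y' (D X' Z') p"
    by (rule nc) (use W s eq in \<open>auto intro: nc nabla_smooth\<close>)
  moreover have "D (lie_bracket A X Y) Z p = D (lie_bracket A X' Y') Z' p"
    by (rule nc) (use W s eq in \<open>auto intro: lie_bracket_cong[OF W(1)] lie_bracket_smooth\<close>)
  ultimately show ?thesis by (simp add: curvature_def)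
qed

lemma lie_bracket_add_left:
  assumes "open W" "p \<in> W" "smooth_vf_on A W X" "smooth_vf_on A W Y" "smooth_vf_on A W Z"
  shows "lie_bracket A (\<lambda>q. Y q + Z q) X p = lie_bracket A Y X p + lie_bracket A Z X p"
  using lie_bracket_add_right[OF assms] by (simp add: lie_bracket_antisym[of _ X])

lemma lie_bracket_scaleR_left:
  assumes "open W" "p \<in> W" "smooth_vf_on A W X" "smooth_vf_on A W Y" "smooth_fun_on A W w"
  shows "lie_bracket A (\<lambda>q. w q *\<^sub>R Y q) X p = w p *\<^sub>R lie_bracket A Y X p - dir_deriv A X w p *\<^sub>R Y p"
  unfolding lie_bracket_antisym[of "\<lambda>q. w q *\<^sub>R Y q" X p] lie_bracket_scaleR_right[OF assms] lie_bracket_antisym[of Y X p]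
  by simp

lemma curvature_add_left:
  assumes W: "open W" "p \<in> W" and s: "smooth_vf_on A W X" "smooth_vf_on A W X'" "smooth_vf_on A W Y" "smooth_vf_on A W Z"
  shows "curvature A D (\<lambda>q. X q + X' q) Y Z p = curvature A D X Y Z p + curvature A D X' Y Z p"
proof -
  note ns = nabla_smooth[OF W(1)] and bs = lie_bracket_smooth[OF W(1)] and as = smooth_vf_add[OF W(1)]
  have 1: "D (\<lambda>q. X q + X' q) (D Y Z) p = D X (D Y Z) p + D X' (D Y Z) p"
    by (intro nabla_add_left[OF W] s ns)
  have "D Y (D (\<lambda>q. X q + X' q) Z) p = D Y (\<lambda>q. D X Z q + D X' Z q) p"
    by (rule nabla_cong[OF W]) (auto intro: nabla_add_left[OF W(1)] s ns as)
  also have "\<dots> = D Y (D X Z) p + D Y (D X' Z) p"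
    by (intro nabla_add_right[OF W] s ns)
  finally have 2: "D Y (D (\<lambda>q. X q + X' q) Z) p = \<dots>" .
  have "D (lie_bracket A (\<lambda>q. X q + X' q) Y) Z p = D (\<lambda>q. lie_bracket A X Y q + lie_bracket A X' Y q) Z p"
    by (rule nabla_cong[OF W]) (auto intro: lie_bracket_add_left[OF W(1)] s bs as)
  also have "\<dots> = D (lie_bracket A X Y) Z p + D (lie_bracket A X' Y) Z p"
    by (intro nabla_add_left[OF W] s bs)
  finally show ?thesis using 1 2 by (simp add: curvature_def)
qed

lemma curvature_scaleR_left:
  assumes W: "open W" "p \<in> W" and u: "smooth_fun_on A W u"
    and s: "smooth_vf_on A W X" "smooth_vf_on A W Y" "smooth_vf_on A W Z"
  shows "curvature A D (\<lambda>q. u q *\<^sub>R X q) Y Z p = u p *\<^sub>R curvature A D X Y Z p"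
proof -
  note ns = nabla_smooth[OF W(1)] and bs = lie_bracket_smooth[OF W(1)] and us = smooth_vf_scaleR[OF W(1)]
    and ds = dir_deriv_smooth[OF W(1)]
  have 1: "D (\<lambda>q. u q *\<^sub>R X q) (D Y Z) p = u p *\<^sub>R D X (D Y Z) p"
    by (intro nabla_scaleR_left[OF W] s ns u)
  have "D Y (D (\<lambda>q. u q *\<^sub>R X q) Z) p = D Y (\<lambda>q. u q *\<^sub>R D X Z q) p"
    by (rule nabla_cong[OF W]) (auto intro: nabla_scaleR_left[OF W(1)] s ns us u)
  also have "\<dots> = dir_deriv A Y u p *\<^sub>R D X Z p + u p *\<^sub>R D Y (D X Z) p"
    by (intro nabla_leibniz[OF W] s ns u)
  finally have 2: "D Y (D (\<lambda>q. u q *\<^sub>R X q) Z) p = \<dots>" .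
  have "D (lie_bracket A (\<lambda>q. u q *\<^sub>R X q) Y) Z p
      = D (\<lambda>q. u q *\<^sub>R lie_bracket A X Y q - dir_deriv A Y u q *\<^sub>R X q) Z p"
    by (rule nabla_cong[OF W]) (auto intro: lie_bracket_scaleR_left[OF W(1)] s bs us u)
  also have "\<dots> = D (\<lambda>q. u q *\<^sub>R lie_bracket A X Y q) Z p - D (\<lambda>q. dir_deriv A Y u q *\<^sub>R X q) Z p"
    by (intro nabla_diff_left[OF W] s bs us u ds)
  also have "\<dots> = u p *\<^sub>R D (lie_bracket A X Y) Z p - dir_deriv A Y u p *\<^sub>R D X Z p"
    using nabla_scaleR_left[OF W u bs[OF s(1,2)] s(3)] nabla_scaleR_left[OF W ds[OF s(2) u] s(1,3)] by simp
  finally show ?thesis using 1 2 by (simp add: curvature_def algebra_simps)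
qed

lemma curvature_add_right:
  assumes W: "open W" "p \<in> W" and s: "smooth_vf_on A W X" "smooth_vf_on A W Y" "smooth_vf_on A W Z" "smooth_vf_on A W Z'"
  shows "curvature A D X Y (\<lambda>q. Z q + Z' q) p = curvature A D X Y Z p + curvature A D X Y Z' p"
proof -
  note ns = nabla_smooth[OF W(1)] and bs = lie_bracket_smooth[OF W(1)] and as = smooth_vf_add[OF W(1)]
  have 1: "D X (D Y (\<lambda>q. Z q + Z' q)) p = D X (D Y Z) p + D X (D Y Z') p" if "smooth_vf_on A W X" "smooth_vf_on A W Y" for X Y
    using nabla_cong[OF W that(1) ns[OF that(2) as[OF s(3,4)]], of X "\<lambda>q. D Y Z q + D Y Z' q"]
      nabla_add_right[OF W that(1) ns[OF that(2) s(3)] ns[OF that(2) s(4)]]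
      nabla_add_right[OF W(1) _ that(2) s(3,4)] by simp
  show ?thesis
    using 1[OF s(1,2)] 1[OF s(2,1)] nabla_add_right[OF W bs[OF s(1,2)] s(3,4)] by (simp add: curvature_def)
qed

lemma curvature_scaleR_right:
  assumes W: "open W" "p \<in> W" and u: "smooth_fun_on A W u"
    and s: "smooth_vf_on A W X" "smooth_vf_on A W Y" "smooth_vf_on A W Z"
  shows "curvature A D X Y (\<lambda>q. u q *\<^sub>R Z q) p = u p *\<^sub>R curvature A D X Y Z p"
proof -
  note ns = nabla_smooth[OF W(1)] and bs = lie_bracket_smooth[OF W(1)] and us = smooth_vf_scaleR[OF W(1)]
    and ds = dir_deriv_smooth[OF W(1)]
  have 1: "D X (D Y (\<lambda>q. u q *\<^sub>R Z q)) p = dir_deriv A X (dir_deriv A Y u) p *\<^sub>R Z p + dir_deriv A Y u p *\<^sub>R D X Z p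
     + dir_deriv A X u p *\<^sub>R D Y Z p + u p *\<^sub>R D X (D Y Z) p"
    if XY: "smooth_vf_on A W X" "smooth_vf_on A W Y" for X Y
  proof -
    have "D X (D Y (\<lambda>q. u q *\<^sub>R Z q)) p = D X (\<lambda>q. dir_deriv A Y u q *\<^sub>R Z q + u q *\<^sub>R D Y Z q) p"
      by (rule nabla_cong[OF W]) (auto intro: nabla_leibniz[OF W(1)] s ns us u XY)
    also have "\<dots> = D X (\<lambda>q. dir_deriv A Y u q *\<^sub>R Z q) p + D X (\<lambda>q. u q *\<^sub>R D Y Z q) p"
      by (intro nabla_add_right[OF W] s ns us u ds XY)
    also have "\<dots> = (dir_deriv A X (dir_deriv A Y u) p *\<^sub>R Z p + dir_deriv A Y u p *\<^sub>R D X Z p)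
       + (dir_deriv A X u p *\<^sub>R D Y Z p + u p *\<^sub>R D X (D Y Z) p)"
      using nabla_leibniz[OF W ds[OF XY(2) u] XY(1) s(3)] nabla_leibniz[OF W u XY(1) ns[OF XY(2) s(3)]] by simp
    finally show ?thesis by (simp add: add_ac)
  qed
  show ?thesis
    using 1[OF s(1,2)] 1[OF s(2,1)] nabla_leibniz[OF W u bs[OF s(1,2)] s(3)]
      dir_deriv_commutator[OF W s(1,2) u, symmetric]
    by (simp add: curvature_def algebra_simps)
qed

lemma curvature_tensorial_left:
  assumes W: "open W" "p \<in> W" and s: "smooth_vf_on A W X" "smooth_vf_on A W X'" "smooth_vf_on A W Y" "smooth_vf_on A W Z"
    and eq: "X p = X' p"
  shows "curvature A D X Y Z p = curvature A D X' Y Z p"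
proof (rule tensorial[OF W _ _ _ s(1,2) eq, where F="\<lambda>X. curvature A D X Y Z p"])
  fix W' assume W': "open W'" "p \<in> W'" "W' \<subseteq> W"
  have r: "smooth_vf_on A W' Y" "smooth_vf_on A W' Z" using s W'(3) smooth_vf_on_subset by blast+
  show "curvature A D (\<lambda>q. X q + Y' q) Y Z p = curvature A D X Y Z p + curvature A D Y' Y Z p"
    if "smooth_vf_on A W' X" "smooth_vf_on A W' Y'" for X Y' by (rule curvature_add_left[OF W'(1,2) that r])
  show "curvature A D (\<lambda>q. u q *\<^sub>R X q) Y Z p = u p *\<^sub>R curvature A D X Y Z p"
    if "smooth_fun_on A W' u" "smooth_vf_on A W' X" for u X by (rule curvature_scaleR_left[OF W'(1,2) that r])
  show "curvature A D X Y Z p = curvature A D Y' Y Z p"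
    if "smooth_vf_on A W' X" "\<And>q. q \<in> W' \<Longrightarrow> X q = Y' q" for X Y' 
    by (rule curvature_cong[OF W'(1,2) that(1) r that(2)]) auto
qed

lemma curvature_tensorial_right:
  assumes W: "open W" "p \<in> W" and s: "smooth_vf_on A W X" "smooth_vf_on A W Y" "smooth_vf_on A W Z" "smooth_vf_on A W Z'"
    and eq: "Z p = Z' p"
  shows "curvature A D X Y Z p = curvature A D X Y Z' p"
proof (rule tensorial[OF W _ _ _ s(3,4) eq, where F="\<lambda>Z. curvature A D X Y Z p"])
  fix W' assume W': "open W'" "p \<in> W'" "W' \<subseteq> W"
  have r: "smooth_vf_on A W' X" "smooth_vf_on A W' Y" using s W'(3) smooth_vf_on_subset by blast+
  show "curvature A D X Y (\<lambda>q. Z q + Z' q) p = curvature A D X Y Z p + curvature A D X Y Z' p"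
    if "smooth_vf_on A W' Z" "smooth_vf_on A W' Z'" for Z Z' by (rule curvature_add_right[OF W'(1,2) r that])
  show "curvature A D X Y (\<lambda>q. u q *\<^sub>R Z q) p = u p *\<^sub>R curvature A D X Y Z p"
    if "smooth_fun_on A W' u" "smooth_vf_on A W' Z" for u Z by (rule curvature_scaleR_right[OF W'(1,2) that(1) r that(2)])
  show "curvature A D X Y Z p = curvature A D X Y Z' p"
    if "smooth_vf_on A W' Z" "\<And>q. q \<in> W' \<Longrightarrow> Z q = Z' q" for Z Z' 
    by (rule curvature_cong[OF W'(1,2) r that(1) _ _ that(2)]) auto
qed

lemma coord_extension_smooth: "smooth_vf_on A (fst (chart_at A p)) (coord_extension A p v)"
  unfolding coord_extension_def by (rule coord_field_smooth[OF chart_at(1)])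

lemma coord_extension_at [simp]: "coord_extension A p v p = v"
  by (simp add: coord_extension_def)

text \<open>
  By tensoriality in each argument the coordinate extensions may be replaced by any fields with the
  same values at \<open>p\<close>. The second argument is moved to the first place by antisymmetry.
\<close>

lemma curvature_eq_curvature_at:
  assumes W: "open W" "p \<in> W" and s: "smooth_vf_on A W X" "smooth_vf_on A W Y" "smooth_vf_on A W Z"
  shows "curvature A D X Y Z p = curvature_at A D p (X p) (Y p) (Z p)"
proof -
  let ?c = "chart_at A p"
  let ?O = "fst ?c \<inter> W" and ?E = "coord_extension A p"
  have O: "open ?O" "p \<in> ?O" using W chart_at chart_open[OF chart_at(1)] by (auto intro: open_Int)
  have t: "smooth_vf_on A ?O X" "smooth_vf_on A ?O Y" "smooth_vf_on A ?O Z" using s by (auto intro: smooth_vf_on_subset)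
  have e: "smooth_vf_on A ?O (?E v)" for v by (rule smooth_vf_on_subset[OF coord_extension_smooth]) auto
  have "curvature A D X Y Z p = curvature A D (?E (X p)) Y Z p"
    by (rule curvature_tensorial_left[OF O t(1) e t(2,3)]) simp
  also have "\<dots> = - curvature A D Y (?E (X p)) Z p" by (rule curvature_antisym[OF O e t(2,3)])
  also have "\<dots> = - curvature A D (?E (Y p)) (?E (X p)) Z p"
    using curvature_tensorial_left[OF O t(2) e[of "Y p"] e[of "X p"] t(3)] by simp
  also have "\<dots> = curvature A D (?E (X p)) (?E (Y p)) Z p" by (simp add: curvature_antisym[OF O e[of "X p"] e[of "Y p"] t(3)])
  also have "\<dots> = curvature A D (?E (X p)) (?E (Y p)) (?E (Z p)) p"
    by (rule curvature_tensorial_right[OF O e e t(3) e]) simp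
  finally show ?thesis by (simp add: curvature_at_def)
qed

lemma curvature_at_linear: "linear (curvature_at A D p x y)"
proof -
  let ?O = "fst (chart_at A p)" and ?E = "coord_extension A p"
  have O: "open ?O" "p \<in> ?O" using chart_at chart_open[OF chart_at(1)] by auto
  have e: "smooth_vf_on A ?O (?E v)" for v by (rule coord_extension_smooth)
  have ce: "curvature A D (?E x) (?E y) Z p = curvature_at A D p x y (Z p)" if "smooth_vf_on A ?O Z" for Z
    using curvature_eq_curvature_at[OF O e[of x] e[of y] that] by simp
  show ?thesis
  proof (rule linearI)
    fix v w
    have "curvature_at A D p x y (v + w) = curvature A D (?E x) (?E y) (\<lambda>q. ?E v q + ?E w q) p"
      by (subst ce) (auto intro: smooth_vf_add O e)
    also have "\<dots> = curvature A D (?E x) (?E y) (?E v) p + curvature A D (?E x) (?E y) (?E w) p"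
      by (rule curvature_add_right[OF O e e e e])
    finally show "curvature_at A D p x y (v + w) = curvature_at A D p x y v + curvature_at A D p x y w"
      by (simp add: ce[OF e])
  next
    fix r v
    have r: "smooth_fun_on A ?O (\<lambda>q. r)" by (rule smooth_fun_const[OF O(1)])
    have "curvature_at A D p x y (r *\<^sub>R v) = curvature A D (?E x) (?E y) (\<lambda>q. r *\<^sub>R ?E v q) p"
      by (subst ce) (auto intro: smooth_vf_scaleR O e r)
    also have "\<dots> = r *\<^sub>R curvature A D (?E x) (?E y) (?E v) p"
      by (rule curvature_scaleR_right[OF O r e e e])
    finally show "curvature_at A D p x y (r *\<^sub>R v) = r *\<^sub>R curvature_at A D p x y v"
      by (simp add: ce[OF e])
  qed
qed

end

section \<open>Traces\<close>

lemma trace_conjugate: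
  fixes L P P' :: "real ^ 'n \<Rightarrow> real ^ 'n"
  assumes "linear L" "linear P" "linear P'" "\<And>v. P' (P v) = v"
  shows "trace (matrix L) = (\<Sum>j\<in>UNIV. P (L (P' (axis j 1))) $ j)"
proof -
  have "(\<Sum>j\<in>UNIV. P (L (P' (axis j 1))) $ j) = trace (matrix (P \<circ> (L \<circ> P')))"
    by (simp add: trace_def matrix_def)
  also have "\<dots> = trace (matrix P ** (matrix L ** matrix P'))"
    using assms by (simp add: matrix_compose linear_compose)
  also have "\<dots> = trace (matrix L ** matrix P' ** matrix P)" by (rule trace_mul_sym)
  also have "\<dots> = trace (matrix L ** matrix (P' \<circ> P))"
    using assms by (simp add: matrix_compose matrix_mul_assoc)
  also have "P' \<circ> P = id" using assms by auto
  finally show ?thesis by (simp only: matrix_id_mat_1 matrix_mul_rid)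
qed

context manifold
begin

lemma lie_bracket_component:
  assumes c: "c \<in> A" and W: "open W" "p \<in> W" "W \<subseteq> fst c" and X: "smooth_vf_on A W X" and Y: "smooth_vf_on A W Y"
  shows "to_chart A c p (lie_bracket A X Y p) $ i
     = dir_deriv A X (\<lambda>q. to_chart A c q (Y q) $ i) p - dir_deriv A Y (\<lambda>q. to_chart A c q (X q) $ i) p"
proof -
  let ?u = "\<lambda>q. snd c q $ i"
  have u: "smooth_fun_on A W ?u" using coord_smooth[OF c] W(3) by (rule smooth_fun_on_subset)
  have *: "dir_deriv A Z (dir_deriv A Z' ?u) p = dir_deriv A Z (\<lambda>q. to_chart A c q (Z' q) $ i) p" if "smooth_vf_on A W Z'" for Z Z'
    by (rule dir_deriv_cong[OF W(1,2) dir_deriv_smooth[OF W(1) that u]]) (use coord_deriv[OF c] W(3) in auto)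
  have "to_chart A c p (lie_bracket A X Y p) $ i = dir_deriv A (lie_bracket A X Y) ?u p"
    using coord_deriv[OF c] W by (metis subsetD)
  then show ?thesis using dir_deriv_commutator[OF W(1,2) X Y u] *[OF X] *[OF Y] by simp
qed

text \<open>
  The Lie derivative commutes with the trace. In a coordinate frame \<open>E\<close>, the components of
  \<open>[X, E j]\<close> are minus the partial derivatives of those of \<open>X\<close>. They enter once through
  \<open>[X, L E j]\<close> and once through \<open>L [X, E j]\<close>; the two contributions differ by exchanging
  the summation indices and cancel.
\<close>

lemma lie_derivative_trace:
  assumes c: "c \<in> A" and p: "p \<in> fst c" and X: "smooth_vf_on A (fst c) X"
    and E: "E = (\<lambda>j q. from_chart A c q (axis j 1))"
    and L: "\<And>q. q \<in> fst c \<Longrightarrow> linear (L q)"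
    and B: "\<And>j. smooth_vf_on A (fst c) (\<lambda>q. L q (E j q))"
  shows "dir_deriv A X (\<lambda>q. \<Sum>j\<in>UNIV. to_chart A c q (L q (E j q)) $ j) p
    = (\<Sum>j\<in>UNIV. to_chart A c p (lie_bracket A X (\<lambda>q. L q (E j q)) p - L p (lie_bracket A X (E j) p)) $ j)"
proof -
  note W = chart_open[OF c] p subset_refl[of "fst c"]
  note cl = to_chart_linear[OF c p]
  have Es: "smooth_vf_on A (fst c) (E j)" for j unfolding E by (rule coord_field_smooth[OF c])
  have comp: "smooth_fun_on A (fst c) (\<lambda>q. to_chart A c q (Y q) $ i)" if "smooth_vf_on A (fst c) Y" for Y i
    using components_smooth[OF c W(1) that] by simp
  define b where "b = (\<lambda>i j. to_chart A c p (L p (E j p)) $ i)"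
  define e where "e = (\<lambda>j i. dir_deriv A (E j) (\<lambda>q. to_chart A c q (X q) $ i) p)"
  have Ep: "from_chart A c p (axis i 1) = E i p" for i by (simp add: E)
  have expand: "dir_deriv A Y u p = (\<Sum>i\<in>UNIV. (to_chart A c p (Y p) $ i) * dir_deriv A (E i) u p)" if u: "smooth_fun_on A (fst c) u" for Y u
  proof -
    have lin: "linear (\<lambda>v. dir_deriv A (\<lambda>q. v) u p)" by (rule dir_deriv_linear[OF W(1,2) u])
    have "dir_deriv A Y u p = dir_deriv A (\<lambda>q. \<Sum>i\<in>UNIV. (to_chart A c p (Y p) $ i) *\<^sub>R E i p) u p"
      unfolding E field_expansion[OF c p, of Y, symmetric] by (rule dir_deriv_pointwise)
    also have "\<dots> = (\<Sum>i\<in>UNIV. (to_chart A c p (Y p) $ i) * dir_deriv A (\<lambda>q. E i p) u p)"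
      by (simp add: linear_sum[OF lin] linear_scale[OF lin])
    also have "\<dots> = (\<Sum>i\<in>UNIV. (to_chart A c p (Y p) $ i) * dir_deriv A (E i) u p)"
      by (simp add: dir_deriv_def)
    finally show ?thesis .
  qed
  have Eb: "to_chart A c p (lie_bracket A X (E j) p) $ i = - e j i" for i j
  proof -
    have "dir_deriv A X (\<lambda>q. to_chart A c q (E j q) $ i) p = dir_deriv A X (\<lambda>q. axis j 1 $ i) p"
      by (rule dir_deriv_cong[OF W(1,2) comp[OF Es]]) (auto simp: E c)
    then show ?thesis
      using lie_bracket_component[OF c W X Es] by (simp add: e_def)
  qed
  have LEb: "to_chart A c p (L p (lie_bracket A X (E j) p)) $ j = (\<Sum>i\<in>UNIV. - e j i * b j i)" for j
  proof -
    have "lie_bracket A X (E j) p = (\<Sum>i\<in>UNIV. (- e j i) *\<^sub>R E i p)"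
      using field_expansion[OF c p, of "lie_bracket A X (E j)"] unfolding Eb Ep .
    then show ?thesis
      by (simp add: linear_sum[OF L[OF p]] linear_scale[OF L[OF p]] linear_sum[OF cl] linear_scale[OF cl] b_def
         linear_neg[OF L[OF p]] linear_neg[OF cl])
  qed
  have Bb: "to_chart A c p (lie_bracket A X (\<lambda>q. L q (E j q)) p) $ j
      = dir_deriv A X (\<lambda>q. to_chart A c q (L q (E j q)) $ j) p - (\<Sum>i\<in>UNIV. b i j * e i j)" for j
    using lie_bracket_component[OF c W X B] expand[OF comp[OF X], of "\<lambda>q. L q (E j q)"] by (simp add: b_def e_def)
  have "dir_deriv A X (\<lambda>q. \<Sum>j\<in>UNIV. to_chart A c q (L q (E j q)) $ j) p
     = (\<Sum>j\<in>UNIV. dir_deriv A X (\<lambda>q. to_chart A c q (L q (E j q)) $ j) p)"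
    by (rule dir_deriv_sum[OF W(1,2) comp[OF B]])
  moreover have "(\<Sum>j\<in>UNIV. to_chart A c p (lie_bracket A X (\<lambda>q. L q (E j q)) p - L p (lie_bracket A X (E j) p)) $ j)
     = (\<Sum>j\<in>UNIV. dir_deriv A X (\<lambda>q. to_chart A c q (L q (E j q)) $ j) p)
       - (\<Sum>j\<in>UNIV. \<Sum>i\<in>UNIV. b i j * e i j) + (\<Sum>j\<in>UNIV. \<Sum>i\<in>UNIV. e j i * b j i)"
    by (simp add: linear_diff[OF cl] Bb LEb sum_subtractf sum_negf sum.distrib)
  moreover have "(\<Sum>j\<in>UNIV. \<Sum>i\<in>UNIV. b i j * e i j) = (\<Sum>j\<in>UNIV. \<Sum>i\<in>UNIV. e j i * b j i)"
    by (subst sum.swap) (simp add: mult.commute)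
  ultimately show ?thesis by simp
qed

end

section \<open>The pointwise algebra of a weak almost contact metric structure\<close>

locale kenmotsu =
  fixes A :: "('a::{t2_space, second_countable_topology}, 'n::finite) atlas"
    and n :: nat
    and f Q :: "'a \<Rightarrow> real ^ 'n \<Rightarrow> real ^ 'n"
    and \<xi> :: "'a \<Rightarrow> real ^ 'n"
    and \<eta> :: "'a \<Rightarrow> real ^ 'n \<Rightarrow> real"
    and g :: "'a \<Rightarrow> real ^ 'n \<Rightarrow> real ^ 'n \<Rightarrow> real"
    and D :: "('a \<Rightarrow> real ^ 'n) \<Rightarrow> ('a \<Rightarrow> real ^ 'n) \<Rightarrow> 'a \<Rightarrow> real ^ 'n"
    and \<beta> :: real
  assumes kenmotsu: "weak_beta_kenmotsu A n f Q \<xi> \<eta> g D \<beta>"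
begin

lemma almost_contact: "weak_almost_contact_metric A n f Q \<xi> \<eta> g"
  using kenmotsu by (simp add: weak_beta_kenmotsu_def)

sublocale riemannian A g D
  using kenmotsu by unfold_locales (simp_all add: weak_beta_kenmotsu_def weak_almost_contact_metric_def)

lemma beta_nonzero: "\<beta> \<noteq> 0" using kenmotsu by (simp add: weak_beta_kenmotsu_def)

lemma f_linear: "linear (f p)" using almost_contact by (simp add: weak_almost_contact_metric_def tensor11_def)
lemma Q_linear: "linear (Q p)" using almost_contact by (simp add: weak_almost_contact_metric_def tensor11_def)
lemma eta_linear: "linear (\<eta> p)" using almost_contact by (simp add: weak_almost_contact_metric_def one_form_def)
lemma f_f: "f p (f p v) = - Q p v + \<eta> p v *\<^sub>R \<xi> p" using almost_contact by (simp add: weak_almost_contact_metric_def)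
lemma eta_xi [simp]: "\<eta> p (\<xi> p) = 1" using almost_contact by (simp add: weak_almost_contact_metric_def)
lemma Q_xi [simp]: "Q p (\<xi> p) = \<xi> p" using almost_contact by (simp add: weak_almost_contact_metric_def)
lemma g_f_f: "g p (f p v) (f p w) = g p v (Q p w) - \<eta> p v * \<eta> p w" using almost_contact by (simp add: weak_almost_contact_metric_def)
lemma eta_f_ker: "\<eta> p v = 0 \<Longrightarrow> \<eta> p (f p v) = 0" using almost_contact by (simp add: weak_almost_contact_metric_def)

lemma Q_injective: "Q p v = Q p w \<Longrightarrow> v = w"
proof -
  assume eq: "Q p v = Q p w"
  have "invertible (matrix (Q p))" using almost_contact by (simp add: weak_almost_contact_metric_def)
  then have "inj ((*v) (matrix (Q p)))" by (simp add: inj_matrix_vector_mult)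
  then show "v = w" using eq by (simp add: matrix_works linear_matrix_vector_mul_eq Q_linear inj_def)
qed

lemmas f_simps = linear_add[OF f_linear] linear_diff[OF f_linear] linear_scale[OF f_linear] linear_neg[OF f_linear] linear_0[OF f_linear]
lemmas eta_simps = linear_add[OF eta_linear] linear_diff[OF eta_linear] linear_scale[OF eta_linear] linear_neg[OF eta_linear] linear_0[OF eta_linear]

text \<open>
  On \<open>ker f\<close> the relation \<open>f\<^sup>2 = - Q + \<eta> \<otimes> \<xi>\<close> reads \<open>Q v = \<eta>(v) \<xi> = Q (\<eta>(v) \<xi>)\<close>,
  and \<open>Q\<close> is injective.
\<close>

lemma f_kernel: 
  assumes "f p v = 0" shows "v = \<eta> p v *\<^sub>R \<xi> p"
proof (rule Q_injective)
  have "- Q p v + \<eta> p v *\<^sub>R \<xi> p = 0" using f_f[of p v] assms by (simp add: f_simps)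
  then have "\<eta> p v *\<^sub>R \<xi> p = Q p v" by simp
  then show "Q p v = Q p (\<eta> p v *\<^sub>R \<xi> p)" by (subst linear_scale[OF Q_linear]) simp
qed

text \<open>
  Write \<open>f \<xi> = w + a \<xi>\<close> with \<open>\<eta>(w) = 0\<close>. From \<open>f\<^sup>2 \<xi> = - Q \<xi> + \<xi> = 0\<close>, the
  \<open>\<eta>\<close>-component gives \<open>a = 0\<close> since \<open>f\<close> preserves \<open>ker \<eta>\<close>, and then
  \<open>f w = 0\<close>, so that \<open>w = 0\<close>.
\<close>

lemma f_xi [simp]: "f p (\<xi> p) = 0"
proof -
  define a where "a = \<eta> p (f p (\<xi> p))"
  define w where "w = f p (\<xi> p) - a *\<^sub>R \<xi> p"
  have w: "\<eta> p w = 0" by (simp add: w_def a_def eta_simps)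
  have fxi: "f p (\<xi> p) = w + a *\<^sub>R \<xi> p" by (simp add: w_def)
  have "f p (f p (\<xi> p)) = 0" by (simp add: f_f)
  then have 0: "f p w + a *\<^sub>R (w + a *\<^sub>R \<xi> p) = 0" by (simp add: fxi f_simps)
  have "\<eta> p (f p w + a *\<^sub>R (w + a *\<^sub>R \<xi> p)) = a * a" by (simp add: eta_simps w eta_f_ker)
  with 0 have a: "a = 0" by (simp add: eta_simps)
  with 0 have "f p w = 0" by simp
  from f_kernel[OF this] w have "w = 0" by simp
  with fxi a show ?thesis by simp
qed

lemma g_xi [simp]: "g p v (\<xi> p) = \<eta> p v" "g p (\<xi> p) v = \<eta> p v"
proof -
  show "g p v (\<xi> p) = \<eta> p v" using g_f_f[of p v "\<xi> p"] by (simp add: metric_simps)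
  then show "g p (\<xi> p) v = \<eta> p v" by (simp add: metric_sym)
qed

lemma eta_f [simp]: "\<eta> p (f p v) = 0"
proof -
  have "f p (v - \<eta> p v *\<^sub>R \<xi> p) = f p v" by (simp add: f_simps)
  moreover have "\<eta> p (f p (v - \<eta> p v *\<^sub>R \<xi> p)) = 0" by (rule eta_f_ker) (simp add: eta_simps)
  ultimately show ?thesis by simp
qed

text \<open>
  This excludes \<open>ker \<eta> = 0\<close>: the rank is \<open>2 n > 0\<close>.
\<close>

lemma f_nonzero: "\<exists>v. f p v \<noteq> 0"
proof (rule ccontr)
  assume "\<nexists>v. f p v \<noteq> 0"
  then have "matrix (f p) = 0" by (simp add: matrix_def vec_eq_iff)
  then have "rank (matrix (f p)) = 0" by (simp add: rank_0)
  then show False using almost_contact by (auto simp: weak_almost_contact_metric_def)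
qed

text \<open>
  The metric of the leaves of \<open>ker \<eta>\<close>, extended by zero in the direction of \<open>\<xi>\<close>. It is the
  tensor in which all derivatives of \<open>g\<close>, \<open>\<eta>\<close> and \<open>\<nabla>\<close> along \<open>\<xi>\<close> are expressed.
\<close>

definition transverse :: "'a \<Rightarrow> real ^ 'n \<Rightarrow> real ^ 'n \<Rightarrow> real" where
  "transverse p v w = g p v w - \<eta> p v * \<eta> p w"

lemma transverse_sym: "transverse p v w = transverse p w v" by (simp add: transverse_def metric_sym[of p v])

lemma transverse_simps:
  "transverse p (v + v') w = transverse p v w + transverse p v' w" "transverse p v (w + w') = transverse p v w + transverse p v w'"
  "transverse p (v - v') w = transverse p v w - transverse p v' w" "transverse p v (w - w') = transverse p v w - transverse p v w'"
  "transverse p (r *\<^sub>R v) w = r * transverse p v w" "transverse p v (r *\<^sub>R w) = r * transverse p v w"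
  by (simp_all add: transverse_def metric_simps eta_simps algebra_simps)

lemma transverse_xi [simp]: "transverse p (\<xi> p) v = 0" "transverse p v (\<xi> p) = 0" by (simp_all add: transverse_def)

abbreviation L :: "('a \<Rightarrow> real ^ 'n) \<Rightarrow> 'a \<Rightarrow> real ^ 'n" where "L \<equiv> lie_bracket A \<xi>"

abbreviation B :: "('a \<Rightarrow> real ^ 'n) \<Rightarrow> ('a \<Rightarrow> real ^ 'n) \<Rightarrow> ('a \<Rightarrow> real ^ 'n) \<Rightarrow> 'a \<Rightarrow> real" where
  "B Z X Y \<equiv> lie_deriv_metric A Z g X Y"

abbreviation Ric :: "('a \<Rightarrow> real ^ 'n) \<Rightarrow> ('a \<Rightarrow> real ^ 'n) \<Rightarrow> 'a \<Rightarrow> real" where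
  "Ric X Y q \<equiv> star_ricci A D f q (X q) (Y q)"

end

section \<open>Derivatives along the structure field\<close>

text \<open>
  All fields are considered on one open set \<open>W\<close>; in the end it is the domain of a chart, where
  a coordinate frame is available for the traces.
\<close>

locale kenmotsu_region = kenmotsu A n f Q \<xi> \<eta> g D \<beta>
  for A :: "('a::{t2_space, second_countable_topology}, 'n::finite) atlas" and n f Q \<xi> \<eta> g D \<beta> +
  fixes W :: "'a set"
  assumes W: "open W"
begin

abbreviation VF :: "('a \<Rightarrow> real ^ 'n) \<Rightarrow> bool" where "VF \<equiv> smooth_vf_on A W"
abbreviation SF :: "('a \<Rightarrow> real) \<Rightarrow> bool" where "SF \<equiv> smooth_fun_on A W"

lemma xi_smooth: "VF \<xi>"
  using almost_contact smooth_vf_on_subset[of UNIV] by (simp add: weak_almost_contact_metric_def)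

lemma f_smooth: "VF X \<Longrightarrow> VF (\<lambda>q. f q (X q))"
  using almost_contact W by (simp add: weak_almost_contact_metric_def tensor11_def)

lemma eta_smooth: "VF X \<Longrightarrow> SF (\<lambda>q. \<eta> q (X q))"
  using almost_contact W by (simp add: weak_almost_contact_metric_def one_form_def)

lemmas smooth_rules = xi_smooth f_smooth eta_smooth metric_smooth[OF W] nabla_smooth[OF W] lie_bracket_smooth[OF W]
  dir_deriv_smooth[OF W] curvature_smooth[OF W]
  smooth_fun_add[OF W] smooth_fun_diff[OF W] smooth_fun_mult[OF W] smooth_fun_const[OF W]
  smooth_vf_add[OF W] smooth_vf_diff[OF W] smooth_vf_scaleR[OF W]

lemma transverse_smooth: "VF X \<Longrightarrow> VF Y \<Longrightarrow> SF (\<lambda>q. transverse q (X q) (Y q))"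
  unfolding transverse_def by (intro smooth_rules)

lemma B_smooth: 
  assumes "VF Z" "VF X" "VF Y" shows "SF (B Z X Y)"
proof -
  have "B Z X Y = (\<lambda>p. dir_deriv A Z (\<lambda>q. g q (X q) (Y q)) p
     - g p (lie_bracket A Z X p) (Y p) - g p (X p) (lie_bracket A Z Y p))"
    by (simp add: fun_eq_iff lie_deriv_metric_def)
  then show ?thesis using assms by (simp add: smooth_rules)
qed

lemmas deriv_cong = dir_deriv_cong[OF W]

text \<open>
  The structure equation for \<open>Y = \<xi>\<close> determines \<open>f (\<nabla>\<^sub>X \<xi>)\<close>, hence \<open>\<nabla>\<^sub>X \<xi>\<close> up to a
  multiple of \<open>\<xi>\<close>, and \<open>\<nabla>\<^sub>X \<xi>\<close> is orthogonal to \<open>\<xi>\<close> because \<open>\<xi>\<close> has unit length.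
\<close>

lemma nabla_xi:
  assumes p: "p \<in> W" and X: "VF X"
  shows "D X \<xi> p = \<beta> *\<^sub>R (X p - \<eta> p (X p) *\<^sub>R \<xi> p)"
proof -
  have "cov_deriv11 D f X \<xi> p = \<beta> *\<^sub>R (g p (f p (X p)) (\<xi> p) *\<^sub>R \<xi> p - \<eta> p (\<xi> p) *\<^sub>R f p (X p))"
    using kenmotsu W p X xi_smooth unfolding weak_beta_kenmotsu_def by metis
  then have "f p (D X \<xi> p - \<beta> *\<^sub>R X p) = 0"
    by (simp add: cov_deriv11_def nabla_zero_right[OF X W p] f_simps)
  from f_kernel[OF this] have *: "D X \<xi> p - \<beta> *\<^sub>R X p = \<eta> p (D X \<xi> p - \<beta> *\<^sub>R X p) *\<^sub>R \<xi> p" .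
  have "\<eta> p (D X \<xi> p) = 0"
    using metric_compatible[OF W p X xi_smooth xi_smooth] by simp
  with * show ?thesis by (simp add: eta_simps algebra_simps)
qed

lemma L_nabla: "p \<in> W \<Longrightarrow> VF X \<Longrightarrow> L X p = D \<xi> X p - \<beta> *\<^sub>R (X p - \<eta> p (X p) *\<^sub>R \<xi> p)"
  by (simp add: torsion_free[OF W] nabla_xi xi_smooth)

lemma eta_deriv:
  assumes "p \<in> W" "VF X" "VF Y"
  shows "dir_deriv A X (\<lambda>q. \<eta> q (Y q)) p = \<eta> p (D X Y p) + \<beta> * transverse p (X p) (Y p)"
  using metric_compatible[OF W assms(1,2) xi_smooth assms(3)] assms
  by (simp add: nabla_xi metric_simps transverse_def)

lemma eta_L: "p \<in> W \<Longrightarrow> VF X \<Longrightarrow> \<eta> p (L X p) = dir_deriv A \<xi> (\<lambda>q. \<eta> q (X q)) p"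
  by (simp add: eta_deriv xi_smooth L_nabla eta_simps)

text \<open>
  The form \<open>\<eta>\<close> is closed, because \<open>\<nabla>\<eta> = \<beta> (g - \<eta> \<otimes> \<eta>)\<close> is symmetric.
\<close>

lemma eta_closed:
  assumes "p \<in> W" "VF X" "VF Y"
  shows "dir_deriv A X (\<lambda>q. \<eta> q (Y q)) p - dir_deriv A Y (\<lambda>q. \<eta> q (X q)) p = \<eta> p (lie_bracket A X Y p)"
  using assms by (simp add: eta_deriv torsion_free[OF W] eta_simps transverse_sym)

lemma xi_g:
  assumes "p \<in> W" "VF X" "VF Y"
  shows "dir_deriv A \<xi> (\<lambda>q. g q (X q) (Y q)) p = g p (L X p) (Y p) + g p (X p) (L Y p) + 2 * \<beta> * transverse p (X p) (Y p)"
  using assms by (simp add: metric_compatible[OF W] xi_smooth L_nabla metric_simps transverse_def algebra_simps)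

lemma transverse_deriv:
  assumes "p \<in> W" "VF X" "VF Y" "VF Z"
  shows "dir_deriv A X (\<lambda>q. transverse q (Y q) (Z q)) p = transverse p (D X Y p) (Z p) + transverse p (Y p) (D X Z p)
     - \<beta> * (transverse p (X p) (Y p) * \<eta> p (Z p) + transverse p (X p) (Z p) * \<eta> p (Y p))"
proof -
  have "dir_deriv A X (\<lambda>q. transverse q (Y q) (Z q)) p = dir_deriv A X (\<lambda>q. g q (Y q) (Z q)) p
      - dir_deriv A X (\<lambda>q. \<eta> q (Y q) * \<eta> q (Z q)) p"
    unfolding transverse_def by (rule dir_deriv_diff[OF W assms(1)]) (intro smooth_rules assms)+
  also have "dir_deriv A X (\<lambda>q. \<eta> q (Y q) * \<eta> q (Z q)) p
     = (\<eta> p (D X Y p) + \<beta> * transverse p (X p) (Y p)) * \<eta> p (Z p) + \<eta> p (Y p) * (\<eta> p (D X Z p) + \<beta> * transverse p (X p) (Z p))"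
    using assms by (simp add: dir_deriv_mult[OF W] smooth_rules eta_deriv)
  also have "dir_deriv A X (\<lambda>q. g q (Y q) (Z q)) p = g p (D X Y p) (Z p) + g p (Y p) (D X Z p)"
    using assms by (simp add: metric_compatible[OF W])
  finally show ?thesis by (simp add: transverse_def algebra_simps)
qed

text \<open>
  The structure equation gives \<open>\<nabla>\<^sub>\<xi> f = 0\<close> as \<open>f \<xi> = 0\<close>, and \<open>\<nabla>\<xi>\<close> commutes with
  \<open>f\<close>. So \<open>f\<close> is invariant under the flow of \<open>\<xi>\<close>.
\<close>

lemma L_f: 
  assumes "p \<in> W" "VF X" shows "L (\<lambda>q. f q (X q)) p = f p (L X p)"
proof -
  have "cov_deriv11 D f \<xi> X p = \<beta> *\<^sub>R (g p (f p (\<xi> p)) (X p) *\<^sub>R \<xi> p - \<eta> p (X p) *\<^sub>R f p (\<xi> p))"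
    using kenmotsu W assms xi_smooth unfolding weak_beta_kenmotsu_def by metis
  then have "D \<xi> (\<lambda>q. f q (X q)) p = f p (D \<xi> X p)"
    by (simp add: cov_deriv11_def metric_simps)
  then show ?thesis using assms by (simp add: L_nabla f_smooth f_simps)
qed

lemma xi_commutes:
  assumes "p \<in> W" "VF X" "SF u"
  shows "dir_deriv A \<xi> (dir_deriv A X u) p = dir_deriv A X (dir_deriv A \<xi> u) p + dir_deriv A (L X) u p"
  using dir_deriv_commutator[OF W assms(1) xi_smooth assms(2,3)] by simp

lemma L_bracket:
  assumes "p \<in> W" "VF X" "VF Y"
  shows "L (lie_bracket A X Y) p = lie_bracket A (L X) Y p + lie_bracket A X (L Y) p"
  by (rule jacobi[OF W assms(1) xi_smooth assms(2,3)])

section \<open>The Lie derivative of the connection and of its curvature\<close>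

text \<open>
  The Lie derivative of the connection along \<open>\<xi>\<close>, a tensor of type (1,2).
\<close>

definition lie_connection :: "('a \<Rightarrow> real ^ 'n) \<Rightarrow> ('a \<Rightarrow> real ^ 'n) \<Rightarrow> 'a \<Rightarrow> real ^ 'n" where
  "lie_connection X Y q = L (D X Y) q - D (L X) Y q - D X (L Y) q"

text \<open>
  The Lie derivative of the identity \<open>\<nabla>\<^sub>X Y - \<nabla>\<^sub>Y X = [X, Y]\<close>.
\<close>

lemma lie_connection_sym:
  assumes p: "p \<in> W" and X: "VF X" and Y: "VF Y" shows "lie_connection X Y p = lie_connection Y X p"
proof -
  have "L (D X Y) p = L (\<lambda>q. D Y X q + lie_bracket A X Y q) p"
    by (rule lie_bracket_cong[OF W p xi_smooth nabla_smooth[OF W X Y]])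
      (simp_all add: torsion_free[OF W _ X Y])
  also have "\<dots> = L (D Y X) p + L (lie_bracket A X Y) p"
    by (intro lie_bracket_add_right[OF W p] smooth_rules X Y)
  also have "L (lie_bracket A X Y) p = D (L X) Y p - D Y (L X) p + (D X (L Y) p - D (L Y) X p)"
    unfolding L_bracket[OF p X Y] torsion_free[OF W p lie_bracket_smooth[OF W xi_smooth X] Y]
      torsion_free[OF W p X lie_bracket_smooth[OF W xi_smooth Y]] ..
  finally show ?thesis by (simp add: lie_connection_def)
qed

text \<open>
  The Lie derivative of \<open>\<nabla> g = 0\<close>: the left-hand side is \<open>\<nabla>\<^sub>X (\<L> g)\<close>, and \<open>\<L> g\<close> is
  \<open>2 \<beta>\<close> times the transverse metric, whose covariant derivative is \<open>transverse_deriv\<close>.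
\<close>

lemma lie_connection_metric:
  assumes p: "p \<in> W" and X: "VF X" and Y: "VF Y" and Z: "VF Z"
  shows "g p (lie_connection X Y p) (Z p) + g p (Y p) (lie_connection X Z p)
    = - 2 * \<beta>\<^sup>2 * (transverse p (X p) (Y p) * \<eta> p (Z p) + transverse p (X p) (Z p) * \<eta> p (Y p))"
proof -
  note s = smooth_rules X Y Z transverse_smooth
  let ?g = "\<lambda>q. g q (Y q) (Z q)"
  have "dir_deriv A \<xi> (dir_deriv A X ?g) p = dir_deriv A \<xi> (\<lambda>q. g q (D X Y q) (Z q) + g q (Y q) (D X Z q)) p"
    by (rule deriv_cong[OF p]) (simp_all add: s metric_compatible[OF W])
  also have "\<dots> = g p (L (D X Y) p) (Z p) + g p (D X Y p) (L Z p) + 2 * \<beta> * transverse p (D X Y p) (Z p)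
     + (g p (L Y p) (D X Z p) + g p (Y p) (L (D X Z) p) + 2 * \<beta> * transverse p (Y p) (D X Z p))"
    using p by (simp add: dir_deriv_add[OF W] s xi_g)
  finally have 1: "dir_deriv A \<xi> (dir_deriv A X ?g) p = \<dots>" .
  have "dir_deriv A X (dir_deriv A \<xi> ?g) p = dir_deriv A X (\<lambda>q. g q (L Y q) (Z q) + g q (Y q) (L Z q) + 2 * \<beta> * transverse q (Y q) (Z q)) p"
    by (rule deriv_cong[OF p]) (simp_all add: s xi_g)
  also have "\<dots> = g p (D X (L Y) p) (Z p) + g p (L Y p) (D X Z p) + (g p (D X Y p) (L Z p) + g p (Y p) (D X (L Z) p))
      + 2 * \<beta> * (transverse p (D X Y p) (Z p) + transverse p (Y p) (D X Z p)
     - \<beta> * (transverse p (X p) (Y p) * \<eta> p (Z p) + transverse p (X p) (Z p) * \<eta> p (Y p)))"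
    using p by (simp add: dir_deriv_add[OF W] dir_deriv_cmult[OF W] s metric_compatible[OF W] transverse_deriv)
  finally have 2: "dir_deriv A X (dir_deriv A \<xi> ?g) p = \<dots>" .
  have 3: "dir_deriv A (L X) ?g p = g p (D (L X) Y p) (Z p) + g p (Y p) (D (L X) Z p)"
    using p by (simp add: s metric_compatible[OF W])
  have "dir_deriv A \<xi> (dir_deriv A X ?g) p = dir_deriv A X (dir_deriv A \<xi> ?g) p + dir_deriv A (L X) ?g p"
    by (rule xi_commutes[OF p X]) (simp add: s)
  then show ?thesis unfolding 1 2 3 by (simp add: lie_connection_def metric_simps algebra_simps power2_eq_square)
qed

lemma lie_connection_smooth: "VF X \<Longrightarrow> VF Y \<Longrightarrow> VF (lie_connection X Y)"
proof -
  assume "VF X" "VF Y"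
  have "lie_connection X Y = (\<lambda>q. L (D X Y) q - D (L X) Y q - D X (L Y) q)" by (simp add: fun_eq_iff lie_connection_def)
  then show ?thesis using \<open>VF X\<close> \<open>VF Y\<close> by (simp add: smooth_rules)
qed

text \<open>
  Symmetry and the metric identity determine the tensor by the permutation of arguments that proves
  uniqueness of the Levi-Civita connection.
\<close>

lemma lie_connection_eq:
  assumes p: "p \<in> W" and X: "VF X" and Y: "VF Y"
  shows "lie_connection X Y p = (- 2 * \<beta>\<^sup>2 * transverse p (X p) (Y p)) *\<^sub>R \<xi> p"
proof -
  \<comment> \<open>The claim is that \<open>Z p = 0\<close>, so testing with \<open>Z\<close> itself suffices.\<close>
  define Z where "Z = (\<lambda>q. lie_connection X Y q - (- 2 * \<beta>\<^sup>2 * transverse q (X q) (Y q)) *\<^sub>R \<xi> q)"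
  have Z: "VF Z" unfolding Z_def by (intro smooth_rules lie_connection_smooth transverse_smooth X Y)
  have "2 * g p (lie_connection X Y p) (Z p) = 2 * (- 2 * \<beta>\<^sup>2 * transverse p (X p) (Y p)) * \<eta> p (Z p)"
    using lie_connection_metric[OF p X Y Z] lie_connection_metric[OF p Y X Z] lie_connection_metric[OF p Z X Y]
      lie_connection_sym[OF p X Y] lie_connection_sym[OF p X Z] lie_connection_sym[OF p Y Z]
    by (simp add: transverse_sym[of p "Y p" "X p"] transverse_sym[of p "Z p"] metric_sym[of p "X p"] metric_sym[of p "Y p"] algebra_simps)
  then have "g p (lie_connection X Y p - (- 2 * \<beta>\<^sup>2 * transverse p (X p) (Y p)) *\<^sub>R \<xi> p) (Z p) = 0"
    by (simp add: metric_simps)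
  then have "g p (Z p) (Z p) = 0" by (simp add: Z_def)
  then have "Z p = 0" using metric_pos[of "Z p" p] by force
  then show ?thesis by (simp add: Z_def eq_neg_iff_add_eq_0)
qed

lemma L_D:
  assumes p: "p \<in> W" and X: "VF X" and Y: "VF Y"
  shows "L (D X Y) p = D (L X) Y p + D X (L Y) p + (- 2 * \<beta>\<^sup>2 * transverse p (X p) (Y p)) *\<^sub>R \<xi> p"
  using lie_connection_eq[OF assms] by (simp add: lie_connection_def algebra_simps)

text \<open>
  \<open>L_D\<close> is used twice, for the outer and the inner derivative; the inner use leaves the covariant
  derivative of a multiple of \<open>\<xi>\<close>.
\<close>

lemma L_DD:
  assumes p: "p \<in> W" and X: "VF X" and Y: "VF Y" and Z: "VF Z"
  shows "L (D X (D Y Z)) p = D (L X) (D Y Z) p + D X (D (L Y) Z) p + D X (D Y (L Z)) p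
    + (- 2 * \<beta>\<^sup>2) *\<^sub>R ((transverse p (X p) (D Y Z p) + dir_deriv A X (\<lambda>q. transverse q (Y q) (Z q)) p) *\<^sub>R \<xi> p
       + (\<beta> * transverse p (Y p) (Z p)) *\<^sub>R (X p - \<eta> p (X p) *\<^sub>R \<xi> p))"
proof -
  note s = smooth_rules X Y Z transverse_smooth
  let ?k = "\<lambda>q. - 2 * \<beta>\<^sup>2 * transverse q (Y q) (Z q)"
  have "D X (L (D Y Z)) p = D X (\<lambda>q. D (L Y) Z q + D Y (L Z) q + ?k q *\<^sub>R \<xi> q) p"
    by (rule nabla_cong[OF W p]) (simp_all add: s L_D)
  also have "\<dots> = D X (\<lambda>q. D (L Y) Z q + D Y (L Z) q) p + D X (\<lambda>q. ?k q *\<^sub>R \<xi> q) p"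
    by (intro nabla_add_right[OF W p] s)
  also have "D X (\<lambda>q. D (L Y) Z q + D Y (L Z) q) p = D X (D (L Y) Z) p + D X (D Y (L Z)) p"
    by (intro nabla_add_right[OF W p] s)
  also have "D X (\<lambda>q. ?k q *\<^sub>R \<xi> q) p = dir_deriv A X ?k p *\<^sub>R \<xi> p + ?k p *\<^sub>R D X \<xi> p"
    by (intro nabla_leibniz[OF W p] s)
  also have "dir_deriv A X ?k p = - 2 * \<beta>\<^sup>2 * dir_deriv A X (\<lambda>q. transverse q (Y q) (Z q)) p"
    by (intro dir_deriv_cmult[OF W p] s)
  also have "D X \<xi> p = \<beta> *\<^sub>R (X p - \<eta> p (X p) *\<^sub>R \<xi> p)" by (rule nabla_xi[OF p X])
  finally show ?thesis
    unfolding L_D[OF p X nabla_smooth[OF W Y Z]] by (simp add: algebra_simps)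
qed

text \<open>
  In general \<open>(\<L> R)(X, Y) Z = (\<nabla>\<^sub>X S)(Y, Z) - (\<nabla>\<^sub>Y S)(X, Z)\<close> where \<open>S = \<L> \<nabla>\<close>.
  For \<open>X\<close> and \<open>Y\<close> in \<open>ker \<eta>\<close> the component along \<open>\<xi>\<close> is an antisymmetrisation
  of \<open>\<nabla>\<close> of the transverse metric that vanishes, and only the terms with \<open>\<nabla>\<xi>\<close> remain.
\<close>

lemma L_curvature:
  assumes p: "p \<in> W" and X: "VF X" and Y: "VF Y" and Z: "VF Z"
    and eX: "\<And>q. q \<in> W \<Longrightarrow> \<eta> q (X q) = 0" and eY: "\<And>q. q \<in> W \<Longrightarrow> \<eta> q (Y q) = 0"
  shows "L (curvature A D X Y Z) p = curvature A D (L X) Y Z p + curvature A D X (L Y) Z p + curvature A D X Y (L Z) p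
    - (2 * \<beta>^3) *\<^sub>R (transverse p (Y p) (Z p) *\<^sub>R X p - transverse p (X p) (Z p) *\<^sub>R Y p)"
proof -
  note s = smooth_rules X Y Z transverse_smooth
  have Ldiff: "L (\<lambda>q. U q - U' q) p = L U p - L U' p" if "VF U" "VF U'" for U U'
    using lie_bracket_add_right[OF W p xi_smooth smooth_vf_diff[OF W that] that(2)] by simp
  have "curvature A D X Y Z = (\<lambda>q. D X (D Y Z) q - D Y (D X Z) q - D (lie_bracket A X Y) Z q)"
    by (simp add: fun_eq_iff curvature_def)
  then have 1: "L (curvature A D X Y Z) p = L (D X (D Y Z)) p - L (D Y (D X Z)) p - L (D (lie_bracket A X Y) Z) p"
    by (simp add: Ldiff s)
  have "D (L (lie_bracket A X Y)) Z p = D (\<lambda>q. lie_bracket A (L X) Y q + lie_bracket A X (L Y) q) Z p"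
    by (rule nabla_cong[OF W p]) (simp_all add: s L_bracket)
  also have "\<dots> = D (lie_bracket A (L X) Y) Z p + D (lie_bracket A X (L Y)) Z p"
    by (intro nabla_add_left[OF W p] s)
  finally have 2: "L (D (lie_bracket A X Y) Z) p = D (lie_bracket A (L X) Y) Z p + D (lie_bracket A X (L Y)) Z p
      + D (lie_bracket A X Y) (L Z) p + (- 2 * \<beta>\<^sup>2 * transverse p (lie_bracket A X Y p) (Z p)) *\<^sub>R \<xi> p"
    using L_D[OF p lie_bracket_smooth[OF W X Y] Z] by simp
  have 3: "transverse p (X p) (D Y Z p) + dir_deriv A X (\<lambda>q. transverse q (Y q) (Z q)) p
     = transverse p (Y p) (D X Z p) + dir_deriv A Y (\<lambda>q. transverse q (X q) (Z q)) p + transverse p (lie_bracket A X Y p) (Z p)"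
    using p by (simp add: transverse_deriv X Y Z torsion_free[OF W] eX eY transverse_simps transverse_sym[of p "X p" "Y p"])
  show ?thesis
    unfolding 1 2 L_DD[OF p X Y Z] L_DD[OF p Y X Z] 3 curvature_def
    by (simp add: eX[OF p] eY[OF p] algebra_simps power2_eq_square power3_eq_cube)
qed

section \<open>Lie derivatives of the metric\<close>

lemma L_ker: 
  assumes "p \<in> W" "VF X" "\<And>q. q \<in> W \<Longrightarrow> \<eta> q (X q) = 0" shows "\<eta> p (L X p) = 0"
proof -
  have "dir_deriv A \<xi> (\<lambda>q. \<eta> q (X q)) p = dir_deriv A \<xi> (\<lambda>q. 0) p"
    by (rule deriv_cong[OF assms(1)]) (simp_all add: assms eta_smooth)
  then show ?thesis using assms by (simp add: eta_L)
qed

lemma xi_g_ker: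
  assumes "p \<in> W" "VF X" "VF Y" "\<eta> p (Y p) = 0"
  shows "dir_deriv A \<xi> (\<lambda>q. g q (X q) (Y q)) p = g p (L X p) (Y p) + g p (X p) (L Y p) + 2 * \<beta> * g p (X p) (Y p)"
    "dir_deriv A \<xi> (\<lambda>q. g q (Y q) (X q)) p = g p (L Y p) (X p) + g p (Y p) (L X p) + 2 * \<beta> * g p (Y p) (X p)"
  using assms by (simp_all add: xi_g transverse_def)

text \<open>
  This is \<open>\<L> \<pounds>\<^sub>Z = \<pounds>\<^sub>Z \<L> + \<pounds>\<^bsub>[\<xi>, Z]\<^esub>\<close> applied to \<open>g\<close>, where
  \<open>\<L> g = 2 \<beta> (g - \<eta> \<otimes> \<eta>)\<close>. The Lie derivative of \<open>\<eta> \<otimes> \<eta>\<close> along any field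
  vanishes on \<open>ker \<eta>\<close>.
\<close>

lemma xi_B:
  assumes p: "p \<in> W" and Z: "VF Z" and X: "VF X" and Y: "VF Y"
    and eX: "\<And>q. q \<in> W \<Longrightarrow> \<eta> q (X q) = 0" and eY: "\<And>q. q \<in> W \<Longrightarrow> \<eta> q (Y q) = 0"
  shows "dir_deriv A \<xi> (B Z X Y) p = B Z (L X) Y p + B Z X (L Y) p + B (L Z) X Y p + 2 * \<beta> * B Z X Y p"
proof -
  note s = smooth_rules X Y Z
  let ?g = "\<lambda>q. g q (X q) (Y q)"
  have "B Z X Y = (\<lambda>p. dir_deriv A Z ?g p - g p (lie_bracket A Z X p) (Y p) - g p (X p) (lie_bracket A Z Y p))"
    by (simp add: fun_eq_iff lie_deriv_metric_def)
  then have "dir_deriv A \<xi> (B Z X Y) p = dir_deriv A \<xi> (dir_deriv A Z ?g) p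
      - dir_deriv A \<xi> (\<lambda>q. g q (lie_bracket A Z X q) (Y q)) p - dir_deriv A \<xi> (\<lambda>q. g q (X q) (lie_bracket A Z Y q)) p"
    using p by (simp add: dir_deriv_diff[OF W] s)
  also have "dir_deriv A \<xi> (dir_deriv A Z ?g) p = dir_deriv A Z (dir_deriv A \<xi> ?g) p + dir_deriv A (L Z) ?g p"
    by (rule xi_commutes[OF p Z]) (simp add: s)
  also have "dir_deriv A Z (dir_deriv A \<xi> ?g) p = dir_deriv A Z (\<lambda>q. g q (L X q) (Y q) + g q (X q) (L Y q) + 2 * \<beta> * g q (X q) (Y q)) p"
    by (rule deriv_cong[OF p]) (simp_all add: s xi_g_ker eY)
  also have "\<dots> = dir_deriv A Z (\<lambda>q. g q (L X q) (Y q)) p + dir_deriv A Z (\<lambda>q. g q (X q) (L Y q)) p + 2 * \<beta> * dir_deriv A Z ?g p"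
    using p by (simp add: dir_deriv_add[OF W] dir_deriv_cmult[OF W] s)
  also have "dir_deriv A \<xi> (\<lambda>q. g q (lie_bracket A Z X q) (Y q)) p
     = g p (lie_bracket A (L Z) X p + lie_bracket A Z (L X) p) (Y p) + g p (lie_bracket A Z X p) (L Y p) + 2 * \<beta> * g p (lie_bracket A Z X p) (Y p)"
    using p by (simp add: xi_g_ker eY s L_bracket)
  also have "dir_deriv A \<xi> (\<lambda>q. g q (X q) (lie_bracket A Z Y q)) p
     = g p (L X p) (lie_bracket A Z Y p) + g p (X p) (lie_bracket A (L Z) Y p + lie_bracket A Z (L Y) p) + 2 * \<beta> * g p (X p) (lie_bracket A Z Y p)"
    using p by (simp add: xi_g_ker eX s L_bracket)
  finally show ?thesis unfolding lie_deriv_metric_def[of A _ _ _ _ p] by (simp add: metric_simps algebra_simps)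
qed

lemma B_xi: 
  assumes "p \<in> W" "VF X" "VF Y" shows "B \<xi> X Y p = 2 * \<beta> * transverse p (X p) (Y p)"
  using assms by (simp add: lie_deriv_metric_def xi_g)

lemma B_linear_field:
  assumes p: "p \<in> W" and Z: "VF Z" and U: "VF U" and X: "VF X" and Y: "VF Y"
    and eq: "\<And>q. q \<in> W \<Longrightarrow> Z' q = r *\<^sub>R Z q + t *\<^sub>R U q"
  shows "B Z' X Y p = r * B Z X Y p + t * B U X Y p"
proof -
  note s = smooth_rules X Y Z U
  have Z': "VF (\<lambda>q. r *\<^sub>R Z q + t *\<^sub>R U q)" by (intro s)
  have sc: "lie_bracket A (\<lambda>q. a *\<^sub>R P q) X p = a *\<^sub>R lie_bracket A P X p" if "VF P" "VF X" for a P X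
    using lie_bracket_scaleR_left[OF W p that(2,1) smooth_fun_const[OF W, of a]] by simp
  have br: "lie_bracket A Z' X p = r *\<^sub>R lie_bracket A Z X p + t *\<^sub>R lie_bracket A U X p" if X: "VF X" for X
  proof -
    have "lie_bracket A Z' X p = lie_bracket A (\<lambda>q. r *\<^sub>R Z q + t *\<^sub>R U q) X p"
      by (rule lie_bracket_cong[OF W p Z' X, symmetric]) (simp_all add: eq)
    also have "\<dots> = lie_bracket A (\<lambda>q. r *\<^sub>R Z q) X p + lie_bracket A (\<lambda>q. t *\<^sub>R U q) X p"
      by (intro lie_bracket_add_left[OF W p] s that)
    finally show ?thesis by (simp add: sc Z U X)
  qed
  have gs: "SF (\<lambda>q. g q (X q) (Y q))" by (intro s)
  have "dir_deriv A Z' (\<lambda>q. g q (X q) (Y q)) p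
     = dir_deriv A (\<lambda>q. r *\<^sub>R Z q) (\<lambda>q. g q (X q) (Y q)) p + dir_deriv A (\<lambda>q. t *\<^sub>R U q) (\<lambda>q. g q (X q) (Y q)) p"
    by (rule dir_deriv_field_add[OF W p gs]) (simp add: eq p)
  also have "\<dots> = r * dir_deriv A Z (\<lambda>q. g q (X q) (Y q)) p + t * dir_deriv A U (\<lambda>q. g q (X q) (Y q)) p"
    by (simp add: dir_deriv_field_scaleR[OF W p gs])
  finally show ?thesis by (simp add: lie_deriv_metric_def br X Y metric_simps algebra_simps)
qed

end

section \<open>The star-Ricci tensor along the structure field\<close>

context kenmotsu
begin

text \<open>
  As \<open>f \<xi> = 0\<close>, the operator under the trace is the curvature with a vanishing argument.
\<close>

lemma star_ricci_xi: "star_ricci A D f p x (\<xi> p) = 0"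
proof -
  let ?O = "fst (chart_at A p)" and ?E = "coord_extension A p"
  have O: "open ?O" "p \<in> ?O" using chart_at chart_open[OF chart_at(1)] by auto
  have "curvature_at A D p x 0 z = 0" for z
  proof -
    note e = coord_extension_smooth[of p x] coord_extension_smooth[of p z] 
    have "curvature_at A D p x 0 z = curvature A D (?E x) (\<lambda>q. 0) (?E z) p"
      using curvature_eq_curvature_at[OF O e(1) smooth_vf_zero[OF O(1)] e(2)] by simp
    also have "\<dots> = - curvature A D (\<lambda>q. 0 *\<^sub>R ?E x q) (?E x) (?E z) p"
      using curvature_antisym[OF O e(1) smooth_vf_zero[OF O(1)] e(2)] by simp
    also have "\<dots> = 0"
      using curvature_scaleR_left[OF O smooth_fun_const[OF O(1)] e(1) e(1) e(2), of 0] by simp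
    finally show ?thesis .
  qed
  then show ?thesis by (simp add: star_ricci_def matrix_def trace_def)
qed

end

context kenmotsu_region
begin

text \<open>
  Up to the factor \<open>- \<beta>\<^sup>3\<close>, the derivative of the \<open>\<ast>\<close>-Ricci tensor along \<open>\<xi>\<close>. In the
  local warped product the \<open>\<ast>\<close>-Ricci tensor is that of the leaf minus a multiple of this form,
  and the former does not change along \<open>\<xi>\<close>.
\<close>

definition ricci_defect :: "('a \<Rightarrow> real ^ 'n) \<Rightarrow> ('a \<Rightarrow> real ^ 'n) \<Rightarrow> 'a \<Rightarrow> real" where
  "ricci_defect X Y q = g q (f q (Y q)) (f q (X q)) - g q (X q) (f q (f q (Y q)))"

lemma ricci_defect_smooth: "VF X \<Longrightarrow> VF Y \<Longrightarrow> SF (ricci_defect X Y)"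
proof -
  assume "VF X" "VF Y"
  moreover have "ricci_defect X Y = (\<lambda>q. g q (f q (Y q)) (f q (X q)) - g q (X q) (f q (f q (Y q))))"
    by (simp add: fun_eq_iff ricci_defect_def)
  ultimately show ?thesis by (simp add: smooth_rules)
qed

lemma xi_ricci_defect:
  assumes p: "p \<in> W" and X: "VF X" and Y: "VF Y"
  shows "dir_deriv A \<xi> (ricci_defect X Y) p = ricci_defect (L X) Y p + ricci_defect X (L Y) p + 2 * \<beta> * ricci_defect X Y p"
proof -
  note s = smooth_rules X Y
  have "dir_deriv A \<xi> (ricci_defect X Y) p = dir_deriv A \<xi> (\<lambda>q. g q (f q (Y q)) (f q (X q)) - g q (X q) (f q (f q (Y q)))) p"
    by (rule deriv_cong[OF p]) (simp_all add: ricci_defect_def ricci_defect_smooth X Y)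
  also have "\<dots> = dir_deriv A \<xi> (\<lambda>q. g q (f q (Y q)) (f q (X q))) p - dir_deriv A \<xi> (\<lambda>q. g q (X q) (f q (f q (Y q)))) p"
    by (intro dir_deriv_diff[OF W p] s)
  also have "\<dots> = g p (f p (L Y p)) (f p (X p)) + g p (f p (Y p)) (f p (L X p)) + 2 * \<beta> * g p (f p (Y p)) (f p (X p))
     - (g p (L X p) (f p (f p (Y p))) + g p (X p) (f p (f p (L Y p))) + 2 * \<beta> * g p (X p) (f p (f p (Y p))))"
    using p by (simp add: xi_g_ker s L_f)
  finally show ?thesis by (simp add: ricci_defect_def algebra_simps)
qed

end

locale kenmotsu_chart = kenmotsu A n f Q \<xi> \<eta> g D \<beta>
  for A :: "('a::{t2_space, second_countable_topology}, 'n::finite) atlas" and n f Q \<xi> \<eta> g D \<beta> +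
  fixes c :: "('a, 'n) chart"
  assumes c: "c \<in> A"
begin

sublocale kenmotsu_region A n f Q \<xi> \<eta> g D \<beta> "fst c"
  by unfold_locales (rule chart_open[OF c])

definition E :: "'n \<Rightarrow> 'a \<Rightarrow> real ^ 'n" where "E = (\<lambda>j q. from_chart A c q (axis j 1))"

lemma E_smooth: "VF (E j)" unfolding E_def by (rule coord_field_smooth[OF c])

lemma Ric_chart:
  assumes p: "p \<in> fst c" and X: "VF X" and Y: "VF Y"
  shows "Ric X Y p = 1 / 2 * (\<Sum>j\<in>UNIV. to_chart A c p (curvature_at A D p (X p) (f p (Y p)) (f p (E j p))) $ j)"
  unfolding star_ricci_def E_def
  by (subst trace_conjugate[OF linear_compose[OF f_linear curvature_at_linear, unfolded o_def]
        to_chart_linear[OF c p] from_chart_linear[OF c p]]) (simp_all add: c p)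

lemma curvature_frame:
  "q \<in> fst c \<Longrightarrow> VF X \<Longrightarrow> VF Y \<Longrightarrow> VF Z \<Longrightarrow>
    curvature_at A D q (X q) (f q (Y q)) (f q (Z q)) = curvature A D X (\<lambda>q. f q (Y q)) (\<lambda>q. f q (Z q)) q"
  by (simp add: curvature_eq_curvature_at[OF W] f_smooth)

lemma curvature_frame_smooth:
  assumes "VF X" "VF Y" 
  shows "VF (\<lambda>q. curvature_at A D q (X q) (f q (Y q)) (f q (E j q)))"
  by (rule smooth_vf_cong[OF W curvature_smooth[OF W assms(1) f_smooth[OF assms(2)] f_smooth[OF E_smooth[of j]]]])
    (simp add: curvature_frame assms E_smooth)

lemma Ric_smooth: 
  assumes X: "VF X" and Y: "VF Y" shows "SF (Ric X Y)"
proof (rule smooth_fun_cong[OF W])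
  have "SF (\<lambda>p. to_chart A c p (curvature_at A D p (X p) (f p (Y p)) (f p (E j p))) $ j)" for j
    using components_smooth[OF c W curvature_frame_smooth[OF X Y, of j], of j] by simp
  then show "SF (\<lambda>p. 1 / 2 * (\<Sum>j\<in>UNIV. to_chart A c p (curvature_at A D p (X p) (f p (Y p)) (f p (E j p))) $ j))"
    by (intro smooth_fun_mult smooth_fun_const smooth_fun_sum W)
qed (simp add: Ric_chart X Y)

text \<open>
  The Lie derivative passes through the trace, through \<open>f\<close>, and acts on \<open>R\<close> by
  \<open>L_curvature\<close>. The correction term there is a sum of two operators of rank one, whose traces are
  the two terms of \<open>ricci_defect\<close>.
\<close>

lemma xi_Ric:
  assumes p: "p \<in> fst c" and X: "VF X" and Y: "VF Y" and eX: "\<And>q. q \<in> fst c \<Longrightarrow> \<eta> q (X q) = 0"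
  shows "dir_deriv A \<xi> (Ric X Y) p = Ric (L X) Y p + Ric X (L Y) p - \<beta>^3 * ricci_defect X Y p"
proof -
  note cl = to_chart_linear[OF c p]
  define T where "T = (\<lambda>q z. curvature_at A D q (X q) (f q (Y q)) (f q z))"
  have T: "linear (T q)" for q
    unfolding T_def by (rule linear_compose[OF f_linear curvature_at_linear, unfolded o_def])
  have TE: "VF (\<lambda>q. T q (E j q))" for j unfolding T_def by (rule curvature_frame_smooth[OF X Y])
  have tr: "SF (\<lambda>q. \<Sum>j\<in>UNIV. to_chart A c q (T q (E j q)) $ j)"
    using components_smooth[OF c W TE] by (intro smooth_fun_sum W) simp
  have "dir_deriv A \<xi> (Ric X Y) p = dir_deriv A \<xi> (\<lambda>q. 1 / 2 * (\<Sum>j\<in>UNIV. to_chart A c q (T q (E j q)) $ j)) p"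
    by (rule deriv_cong[OF p Ric_smooth[OF X Y]]) (simp_all add: Ric_chart X Y T_def)
  also have "\<dots> = 1 / 2 * dir_deriv A \<xi> (\<lambda>q. \<Sum>j\<in>UNIV. to_chart A c q (T q (E j q)) $ j) p"
    by (rule dir_deriv_cmult[OF W p tr])
  also have "dir_deriv A \<xi> (\<lambda>q. \<Sum>j\<in>UNIV. to_chart A c q (T q (E j q)) $ j) p
    = (\<Sum>j\<in>UNIV. to_chart A c p (L (\<lambda>q. T q (E j q)) p - T p (L (E j) p)) $ j)"
    by (rule lie_derivative_trace[OF c p xi_smooth E_def T TE])
  also have "\<dots> = (\<Sum>j\<in>UNIV. to_chart A c p (curvature_at A D p (L X p) (f p (Y p)) (f p (E j p))) $ j
      + to_chart A c p (curvature_at A D p (X p) (f p (L Y p)) (f p (E j p))) $ j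
      - 2 * \<beta>^3 * (transverse p (f p (Y p)) (f p (E j p)) * (to_chart A c p (X p) $ j) 
          - transverse p (X p) (f p (E j p)) * (to_chart A c p (f p (Y p)) $ j)))"
  proof (rule sum.cong[OF refl])
    fix j
    let ?fY = "\<lambda>q. f q (Y q)" and ?fE = "\<lambda>q. f q (E j q)"
    note s = smooth_rules X Y E_smooth[of j]
    have cv: "curvature A D U P Z p = curvature_at A D p (U p) (P p) (Z p)" if "VF U" "VF P" "VF Z" for U P Z
      using curvature_eq_curvature_at[OF W p that] .
    have "L (\<lambda>q. T q (E j q)) p = L (curvature A D X ?fY ?fE) p"
      by (rule lie_bracket_cong[OF W p xi_smooth TE]) (simp_all add: T_def curvature_frame X Y E_smooth)
    also have "\<dots> = curvature A D (L X) ?fY ?fE p + curvature A D X (L ?fY) ?fE p + curvature A D X ?fY (L ?fE) p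
        - (2 * \<beta>^3) *\<^sub>R (transverse p (f p (Y p)) (f p (E j p)) *\<^sub>R X p - transverse p (X p) (f p (E j p)) *\<^sub>R f p (Y p))"
      by (rule L_curvature[OF p]) (simp_all add: s eX)
    also have "curvature A D (L X) ?fY ?fE p = curvature_at A D p (L X p) (f p (Y p)) (f p (E j p))"
      by (simp add: cv s)
    also have "curvature A D X (L ?fY) ?fE p = curvature_at A D p (X p) (f p (L Y p)) (f p (E j p))"
      using p by (simp add: cv s L_f)
    also have "curvature A D X ?fY (L ?fE) p = T p (L (E j) p)"
      using p by (simp add: cv s L_f T_def)
    finally have "L (\<lambda>q. T q (E j q)) p - T p (L (E j) p) = curvature_at A D p (L X p) (f p (Y p)) (f p (E j p))
        + curvature_at A D p (X p) (f p (L Y p)) (f p (E j p))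
        - (2 * \<beta>^3) *\<^sub>R (transverse p (f p (Y p)) (f p (E j p)) *\<^sub>R X p - transverse p (X p) (f p (E j p)) *\<^sub>R f p (Y p))"
      by simp
    then show "to_chart A c p (L (\<lambda>q. T q (E j q)) p - T p (L (E j) p)) $ j
      = to_chart A c p (curvature_at A D p (L X p) (f p (Y p)) (f p (E j p))) $ j
      + to_chart A c p (curvature_at A D p (X p) (f p (L Y p)) (f p (E j p))) $ j
      - 2 * \<beta>^3 * (transverse p (f p (Y p)) (f p (E j p)) * (to_chart A c p (X p) $ j) 
          - transverse p (X p) (f p (E j p)) * (to_chart A c p (f p (Y p)) $ j))"
      by (simp add: linear_add[OF cl] linear_diff[OF cl] linear_scale[OF cl])
  qed
  also have "\<dots> = 2 * Ric (L X) Y p + 2 * Ric X (L Y) p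
     - 2 * \<beta>^3 * ((\<Sum>j\<in>UNIV. transverse p (f p (Y p)) (f p (E j p)) * (to_chart A c p (X p) $ j)) 
          - (\<Sum>j\<in>UNIV. transverse p (X p) (f p (E j p)) * (to_chart A c p (f p (Y p)) $ j)))"
    using Ric_chart[OF p lie_bracket_smooth[OF W xi_smooth X] Y] Ric_chart[OF p X lie_bracket_smooth[OF W xi_smooth Y]]
    by (simp add: sum.distrib sum_subtractf flip: sum_distrib_left)
  also have "(\<Sum>j\<in>UNIV. transverse p (f p (Y p)) (f p (E j p)) * (to_chart A c p (X p) $ j)) = transverse p (f p (Y p)) (f p (X p))"
  proof -
    have "linear (\<lambda>z. transverse p (f p (Y p)) (f p z))" by (rule linearI) (simp_all add: f_simps transverse_simps)
    from linear_compose[OF from_chart_linear[OF c p] this, unfolded o_def]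
    have "transverse p (f p (Y p)) (f p (from_chart A c p (to_chart A c p (X p))))
      = (\<Sum>i\<in>UNIV. (to_chart A c p (X p) $ i) *\<^sub>R transverse p (f p (Y p)) (f p (from_chart A c p (axis i 1))))"
      by (rule linear_expansion_vec)
    then show ?thesis using c p by (simp add: E_def mult.commute)
  qed
  also have "(\<Sum>j\<in>UNIV. transverse p (X p) (f p (E j p)) * (to_chart A c p (f p (Y p)) $ j)) = transverse p (X p) (f p (f p (Y p)))"
  proof -
    have "linear (\<lambda>z. transverse p (X p) (f p z))" by (rule linearI) (simp_all add: f_simps transverse_simps)
    from linear_compose[OF from_chart_linear[OF c p] this, unfolded o_def]
    have "transverse p (X p) (f p (from_chart A c p (to_chart A c p (f p (Y p)))))
      = (\<Sum>i\<in>UNIV. (to_chart A c p (f p (Y p)) $ i) *\<^sub>R transverse p (X p) (f p (from_chart A c p (axis i 1))))"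
      by (rule linear_expansion_vec)
    then show ?thesis using c p by (simp add: E_def mult.commute)
  qed
  finally show ?thesis by (simp add: ricci_defect_def transverse_def)
qed

end

section \<open>The soliton equation\<close>

locale kenmotsu_soliton = kenmotsu_chart A n f Q \<xi> \<eta> g D \<beta> c
  for A :: "('a::{t2_space, second_countable_topology}, 'n::finite) atlas" and n f Q \<xi> \<eta> g D \<beta> c +
  fixes V :: "'a \<Rightarrow> real ^ 'n" and lam mu :: real
  assumes soliton: "star_eta_ricci_soliton A f \<eta> g D V lam mu"
begin

lemma V_smooth: "VF V"
  using soliton smooth_vf_on_subset[of UNIV] by (simp add: star_eta_ricci_soliton_def)

lemma soliton_eq:
  "p \<in> fst c \<Longrightarrow> VF X \<Longrightarrow> VF Y \<Longrightarrow>
   1 / 2 * B V X Y p + Ric X Y p = lam * g p (X p) (Y p) + mu * (\<eta> p (X p) * \<eta> p (Y p))"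
  using soliton W unfolding star_eta_ricci_soliton_def by metis

text \<open>
  On \<open>(X, \<xi>)\<close> the \<open>\<ast>\<close>-Ricci tensor vanishes, and closedness of \<open>\<eta>\<close> turns
  \<open>V (\<eta>(X)) - \<eta>([V, X])\<close> into \<open>X (\<eta>(V))\<close>.
\<close>

lemma L_V_dual:
  assumes p: "p \<in> fst c" and X: "VF X"
  shows "g p (X p) (L V p) = 2 * (lam + mu) * \<eta> p (X p) - dir_deriv A X (\<lambda>q. \<eta> q (V q)) p"
proof -
  have "B V X \<xi> p = 2 * (lam + mu) * \<eta> p (X p)"
    using soliton_eq[OF p X xi_smooth] by (simp add: star_ricci_xi algebra_simps)
  moreover have "B V X \<xi> p = dir_deriv A V (\<lambda>q. \<eta> q (X q)) p - \<eta> p (lie_bracket A V X p) + g p (X p) (L V p)"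
    using lie_bracket_antisym[of V \<xi> p] by (simp add: lie_deriv_metric_def metric_simps)
  ultimately show ?thesis using eta_closed[OF p V_smooth X] by simp
qed

lemma eta_L_V: "p \<in> fst c \<Longrightarrow> \<eta> p (L V p) = lam + mu"
  using L_V_dual[OF _ xi_smooth, of p] eta_L[OF _ V_smooth, of p] by simp

text \<open>
  Differentiate \<open>L_V_dual\<close> along \<open>\<xi>\<close>. As \<open>\<xi> (\<eta>(V)) = \<lambda> + \<mu>\<close> is constant, only
  the derivative of the metric contributes.
\<close>

lemma L_L_V:
  assumes p: "p \<in> fst c"
  shows "L (L V) p = (- 2 * \<beta>) *\<^sub>R (L V p - (lam + mu) *\<^sub>R \<xi> p)"
proof -
  let ?c = "lam + mu" and ?u = "\<lambda>q. \<eta> q (V q)"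
  note s = smooth_rules V_smooth
  \<comment> \<open>The claim is that \<open>X p = 0\<close>, so testing with \<open>X\<close> itself suffices.\<close>
  define X where "X = (\<lambda>q. L (L V) q + (2 * \<beta>) *\<^sub>R (L V q - ?c *\<^sub>R \<xi> q))"
  have X: "VF X" unfolding X_def by (intro s)
  have "dir_deriv A \<xi> (\<lambda>q. g q (X q) (L V q)) p = dir_deriv A \<xi> (\<lambda>q. 2 * ?c * \<eta> q (X q) - dir_deriv A X ?u q) p"
    by (rule deriv_cong[OF p]) (simp_all add: s X L_V_dual)
  also have "\<dots> = 2 * ?c * \<eta> p (L X p) - (dir_deriv A X (dir_deriv A \<xi> ?u) p + dir_deriv A (L X) ?u p)"
    using p by (simp add: dir_deriv_diff[OF W] dir_deriv_cmult[OF W] s X eta_L xi_commutes)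
  also have "dir_deriv A X (dir_deriv A \<xi> ?u) p = dir_deriv A X (\<lambda>q. ?c) p"
    by (rule deriv_cong[OF p]) (simp_all add: s eta_L_V flip: eta_L)
  finally have "g p (X p) (L (L V) p) + 2 * \<beta> * transverse p (X p) (L V p) = 0"
    using p by (simp add: xi_g s X L_V_dual)
  then have "g p (X p) (L (L V) p + (2 * \<beta>) *\<^sub>R (L V p - ?c *\<^sub>R \<xi> p)) = 0"
    using p by (simp add: metric_simps transverse_def eta_L_V algebra_simps)
  then have "g p (X p) (X p) = 0" by (simp add: X_def)
  then have "X p = 0" using metric_pos[of "X p" p] by force
  then show ?thesis by (simp add: X_def eq_neg_iff_add_eq_0)
qed

text \<open>
  Apply \<open>\<L>\<close> to the soliton equation on \<open>ker \<eta>\<close>. The terms in which \<open>\<L>\<close> hits \<open>X\<close>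
  or \<open>Y\<close> cancel by the equation itself, because \<open>\<L> X\<close> and \<open>\<L> Y\<close> stay in \<open>ker \<eta>\<close>.
\<close>

lemma soliton_derivative:
  assumes p: "p \<in> fst c" and X: "VF X" and Y: "VF Y"
    and eX: "\<And>q. q \<in> fst c \<Longrightarrow> \<eta> q (X q) = 0" and eY: "\<And>q. q \<in> fst c \<Longrightarrow> \<eta> q (Y q) = 0"
  shows "1 / 2 * B (L V) X Y p + \<beta> * B V X Y p - \<beta>^3 * ricci_defect X Y p = 2 * \<beta> * lam * g p (X p) (Y p)"
proof -
  note s = smooth_rules X Y V_smooth B_smooth Ric_smooth
  have LX: "VF (L X)" and LY: "VF (L Y)" by (intro s)+
  have "dir_deriv A \<xi> (\<lambda>q. 1 / 2 * B V X Y q + Ric X Y q) p = dir_deriv A \<xi> (\<lambda>q. lam * g q (X q) (Y q)) p"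
    by (rule deriv_cong[OF p]) (simp_all add: s soliton_eq[OF _ X Y] eX eY del: times_divide_eq_left mult_1_left)
  moreover have "dir_deriv A \<xi> (\<lambda>q. 1 / 2 * B V X Y q + Ric X Y q) p
      = 1 / 2 * dir_deriv A \<xi> (B V X Y) p + dir_deriv A \<xi> (Ric X Y) p"
    using dir_deriv_add[OF W p smooth_fun_mult[OF W smooth_fun_const[OF W, of "1/2"] B_smooth[OF V_smooth X Y]] Ric_smooth[OF X Y], of \<xi>]
      dir_deriv_cmult[OF W p B_smooth[OF V_smooth X Y], of \<xi> "1/2"] by simp
  moreover have "dir_deriv A \<xi> (\<lambda>q. lam * g q (X q) (Y q)) p
      = lam * (g p (L X p) (Y p) + g p (X p) (L Y p) + 2 * \<beta> * g p (X p) (Y p))"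
    using p by (simp add: dir_deriv_cmult[OF W] s xi_g_ker eY)
  ultimately show ?thesis
    using soliton_eq[OF p LX Y] soliton_eq[OF p X LY] xi_B[OF p V_smooth X Y eX eY] xi_Ric[OF p X Y eX]
      L_ker[OF p X eX] L_ker[OF p Y eY] soliton_eq[OF p X Y] eX[OF p] eY[OF p]
    by (simp add: algebra_simps)
qed

text \<open>
  Apply \<open>\<L> - 2 \<beta>\<close> to \<open>soliton_derivative\<close>. On \<open>ker \<eta>\<close> this operator annihilates both
  \<open>g\<close> and the form \<open>ricci_defect\<close>.
\<close>

lemma soliton_second_derivative:
  assumes p: "p \<in> fst c" and X: "VF X" and Y: "VF Y"
    and eX: "\<And>q. q \<in> fst c \<Longrightarrow> \<eta> q (X q) = 0" and eY: "\<And>q. q \<in> fst c \<Longrightarrow> \<eta> q (Y q) = 0"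
  shows "1 / 2 * B (L (L V)) X Y p + \<beta> * B (L V) X Y p = 0"
proof -
  note s = smooth_rules X Y V_smooth B_smooth ricci_defect_smooth
  have LX: "VF (L X)" and LY: "VF (L Y)" and LV: "VF (L V)" by (intro s)+
  note eLX = L_ker[OF _ X eX] and eLY = L_ker[OF _ Y eY]
  let ?F = "\<lambda>q. 1 / 2 * B (L V) X Y q + \<beta> * B V X Y q - \<beta>^3 * ricci_defect X Y q"
  have "dir_deriv A \<xi> ?F p = dir_deriv A \<xi> (\<lambda>q. (2 * \<beta> * lam) * g q (X q) (Y q)) p"
    by (rule deriv_cong[OF p]) ((intro s) | simp only: soliton_derivative[OF _ X Y eX eY])+
  moreover have "dir_deriv A \<xi> ?F p = 1 / 2 * dir_deriv A \<xi> (B (L V) X Y) p + \<beta> * dir_deriv A \<xi> (B V X Y) p - \<beta>^3 * dir_deriv A \<xi> (ricci_defect X Y) p"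
  proof -
    note b = B_smooth[OF LV X Y] B_smooth[OF V_smooth X Y] ricci_defect_smooth[OF X Y]
    have m: "SF (\<lambda>q. r * u q)" if "SF u" for r u using that by (intro s)
    show ?thesis
      by (simp only: dir_deriv_diff[OF W p smooth_fun_add[OF W m[OF b(1)] m[OF b(2)]] m[OF b(3)]]
          dir_deriv_add[OF W p m[OF b(1)] m[OF b(2)]] dir_deriv_cmult[OF W p b(1)] dir_deriv_cmult[OF W p b(2)] dir_deriv_cmult[OF W p b(3)])
  qed
  moreover have "dir_deriv A \<xi> (\<lambda>q. (2 * \<beta> * lam) * g q (X q) (Y q)) p
      = (2 * \<beta> * lam) * (g p (L X p) (Y p) + g p (X p) (L Y p) + 2 * \<beta> * g p (X p) (Y p))"
    using p dir_deriv_cmult[OF W p metric_smooth[OF W X Y], of \<xi> "2 * \<beta> * lam"] xi_g_ker(1)[OF p X Y eY] by simp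
  ultimately have *: "1 / 2 * (B (L V) (L X) Y p + B (L V) X (L Y) p + B (L (L V)) X Y p + 2 * \<beta> * B (L V) X Y p)
      + \<beta> * (B V (L X) Y p + B V X (L Y) p + B (L V) X Y p + 2 * \<beta> * B V X Y p)
      - \<beta>^3 * (ricci_defect (L X) Y p + ricci_defect X (L Y) p + 2 * \<beta> * ricci_defect X Y p)
      = (2 * \<beta> * lam) * (g p (L X p) (Y p) + g p (X p) (L Y p) + 2 * \<beta> * g p (X p) (Y p))"
    by (simp only: xi_B[OF p V_smooth X Y eX eY] xi_B[OF p LV X Y eX eY] xi_ricci_defect[OF p X Y])
  have "2 * \<beta> * (1 / 2 * B (L V) X Y p + \<beta> * B V X Y p - \<beta>^3 * ricci_defect X Y p) = 2 * \<beta> * (2 * \<beta> * lam * g p (X p) (Y p))"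
    using soliton_derivative[OF p X Y eX eY] by simp
  with * soliton_derivative[OF p LX Y eLX eY] soliton_derivative[OF p X LY eX eLY]
  show ?thesis by (simp add: algebra_simps)
qed

text \<open>
  Insert \<open>L_L_V\<close> into \<open>soliton_second_derivative\<close>: the terms with \<open>\<L> V\<close> cancel, and what
  remains is \<open>\<beta> (\<lambda> + \<mu>) \<L> g = 0\<close> on \<open>ker \<eta>\<close>, where \<open>\<L> g = 2 \<beta> g\<close> is definite.
\<close>

lemma soliton_constants:
  assumes p: "p \<in> fst c" shows "lam + mu = 0"
proof -
  obtain v where v: "f p v \<noteq> 0" using f_nonzero by blast
  \<comment> \<open>The image of \<open>f\<close> consists of vectors of \<open>ker \<eta>\<close>, also away from \<open>p\<close>.\<close>
  define X where "X = (\<lambda>q. f q (from_chart A c q (to_chart A c p v)))"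
  have X: "VF X" unfolding X_def by (intro f_smooth coord_field_smooth c)
  have eX: "\<eta> q (X q) = 0" for q by (simp add: X_def)
  have Xp: "X p = f p v" using c p by (simp add: X_def)
  have LV: "VF (L V)" by (intro smooth_rules V_smooth)
  have "B (L (L V)) X X p = (- 2 * \<beta>) * B (L V) X X p + (2 * \<beta> * (lam + mu)) * B \<xi> X X p"
    by (rule B_linear_field[OF p LV xi_smooth X X]) (simp add: L_L_V algebra_simps)
  then have "\<beta> * (lam + mu) * B \<xi> X X p = 1 / 2 * B (L (L V)) X X p + \<beta> * B (L V) X X p"
    by (simp add: field_simps)
  also have "\<dots> = 0" by (rule soliton_second_derivative[OF p X X eX eX])
  finally have "\<beta> * (lam + mu) * B \<xi> X X p = 0" .
  moreover have "B \<xi> X X p = 2 * \<beta> * g p (X p) (X p)" using B_xi[OF p X X] by (simp add: transverse_def eX)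
  moreover have "g p (X p) (X p) > 0" using v metric_pos Xp by simp
  ultimately show ?thesis using beta_nonzero by simp
qed

end

theorem proposition6:
  fixes A :: "('a::{t2_space, second_countable_topology}, 'n::finite) atlas"
    and n :: nat
    and f Q :: "'a \<Rightarrow> real ^ 'n \<Rightarrow> real ^ 'n"
    and \<xi> V :: "'a \<Rightarrow> real ^ 'n"
    and \<eta> :: "'a \<Rightarrow> real ^ 'n \<Rightarrow> real"
    and g :: "'a \<Rightarrow> real ^ 'n \<Rightarrow> real ^ 'n \<Rightarrow> real"
    and D :: "('a \<Rightarrow> real ^ 'n) \<Rightarrow> ('a \<Rightarrow> real ^ 'n) \<Rightarrow> 'a \<Rightarrow> real ^ 'n"
    and \<beta> lam mu :: real
  assumes "weak_beta_kenmotsu A n f Q \<xi> \<eta> g D \<beta>"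
    and "star_eta_ricci_soliton A f \<eta> g D V lam mu"
  shows "(\<forall>p. lie_deriv_form A V \<eta> \<xi> p = 0 \<and> \<eta> p (lie_bracket A V \<xi> p) = 0) \<and>
    lam + mu = 0 \<and>
    (mu < 0 \<longrightarrow> shrinking lam) \<and> (mu = 0 \<longrightarrow> steady lam) \<and> (mu > 0 \<longrightarrow> expanding lam)"
proof -
  interpret kenmotsu A n f Q \<xi> \<eta> g D \<beta> by unfold_locales (rule assms(1))
  have local_form: "lam + mu = 0 \<and> \<eta> p (lie_bracket A V \<xi> p) = 0" for p
  proof -
    interpret kenmotsu_soliton A n f Q \<xi> \<eta> g D \<beta> "chart_at A p" V lam mu
      by unfold_locales (rule chart_at assms(2))+
    have "\<eta> p (lie_bracket A V \<xi> p) = - \<eta> p (lie_bracket A \<xi> V p)"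
      using lie_bracket_antisym[of V \<xi> p] by (simp add: eta_simps)
    then show ?thesis using soliton_constants[OF chart_at(2)] eta_L_V[OF chart_at(2)] by simp
  qed
  then have "lie_deriv_form A V \<eta> \<xi> p = 0" for p by (simp add: lie_deriv_form_def)
  moreover from local_form have "lam + mu = 0" by blast
  then have "lam = - mu" by simp
  ultimately show ?thesis using local_form by (simp add: shrinking_def steady_def expanding_def)
qed

end
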